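(* Let $\mathcal{C}$ be an extriangulated category. For $i=1,2$, let $x_i:=(\mathcal{X}_i,\mathcal{Y}_i)$ be an $s$-cotorsion pair in $\mathcal{C}$, and assume $x_1\le x_2$, i.e. $\mathcal{Y}_1\subseteq\mathcal{Y}_2$. Let $\mathcal{H}_{[x_1,x_2]}:=\mathcal{X}_1\cap\mathcal{Y}_2$. Then there exist mutually inverse isomorphisms of posets $$\Phi:\mathsf{cotors}[x_1,x_2]\to\mathsf{cotors}\,\mathcal{H}_{[x_1,x_2]},\qquad \Psi:\mathsf{cotors}\,\mathcal{H}_{[x_1,x_2]}\to\mathsf{cotors}[x_1,x_2],$$ where $\Phi(\mathcal{X},\mathcal{Y}):=(\mathcal{X}\cap\mathcal{Y}_2,\ \mathcal{X}_1\cap\mathcal{Y})$ and $\Psi(\mathcal{A},\mathcal{B}):=(\mathsf{add}(\mathcal{X}_2\ast\mathcal{A}),\ \mathsf{add}(\mathcal{B}\ast\mathcal{Y}_1))$. Moreover, if $\mathbb{E}^2(\mathcal{X}_1,\mathcal{Y}_2)=0$, then $\mathsf{cotors}[x_1,x_2]=\mathsf{scotors}[x_1,x_2]$.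
   Context: Conventions: $R$ is a commutative unital ring; $\mathcal{C}$ is a small additive $R$-linear category; all subcategories are full, additive and closed under isomorphisms. Extriangulated category (Nakaoka--Palu): a triple $(\mathcal{C},\mathbb{E},\mathfrak{s})$ with $\mathbb{E}:\mathcal{C}^{\mathrm{op}}\times\mathcal{C}\to \mathrm{Mod}\,R$ an $R$-bilinear functor and $\mathfrak{s}$ assigning to each $\delta\in\mathbb{E}(C,A)$ an equivalence class $\mathfrak{s}(\delta)=[A\to B\to C]$ of complexes (equivalence: an isomorphism of middle terms compatible with identities of $A$ and $C$). Write $a_*\delta=\mathbb{E}(C,a)(\delta)$, $c^*\delta=\mathbb{E}(c,A)(\delta)$. Axioms: (i) $\mathfrak{s}(0)$ is the split class $[A\to A\oplus C\to C]$ and $\mathfrak{s}(\delta\oplus\delta')=\mathfrak{s}(\delta)\oplus\mathfrak{s}(\delta')$; (ii) for $\mathfrak{s}(\delta)=[A\xrightarrow{f}B\xrightarrow{g}C]$, $\mathfrak{s}(\delta')=[A'\xrightarrow{f'}B'\xrightarrow{g'}C']$ and $a:A\to A'$, $c:C\to C'$ with $a_*\delta=c^*\delta'$, there is $b$ with $bf=f'a$, $g'b=cg$; (iii) (ET3) for $a,b$ with $bf=f'a$ there is $c$ with $cg=g'b$ and $a_*\delta=c^*\delta'$, and dually (ET3)$^{\mathrm{op}}$; (iv) (ET4) if $\mathfrak{s}(\delta)=[A\xrightarrow{f}B\xrightarrow{f'}D]$ and $\mathfrak{s}(\delta')=[B\xrightarrow{g}C\xrightarrow{g'}F]$, there are $E$,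 $h:C\to E$, $d:D\to E$, $e:E\to F$ and $\delta''\in\mathbb{E}(E,A)$ with $\mathfrak{s}(\delta'')=[A\xrightarrow{gf}C\xrightarrow{h}E]$, $hg=df'$, $eh=g'$, $\mathfrak{s}(f'_*\delta')=[D\xrightarrow{d}E\xrightarrow{e}F]$, $d^*\delta''=\delta$, $f_*\delta''=e^*\delta'$, and dually (ET4)$^{\mathrm{op}}$. A complex $A\to B\to C$ with $[A\to B\to C]=\mathfrak{s}(\delta)$ for some $\delta$ is an $\mathfrak{s}$-conflation, written $A\to B\to C\dashrightarrow$. Higher extensions (Gorsky--Nakaoka--Palu): $\mathbb{E}^1=\mathbb{E}$ and $\mathbb{E}^{n}(C,A)=\int^{X\in\mathcal{C}}\mathbb{E}^{n-1}(X,A)\otimes_R\mathbb{E}(C,X)$ for $n\ge2$. $\mathbb{E}^k(\mathcal{X},\mathcal{Y})=0$ means vanishing on all pairs of objects. For subcategories $\mathcal{X},\mathcal{Y}$: $\mathcal{X}\ast\mathcal{Y}$ consists of $M$ with an $\mathfrak{s}$-conflation $X\to M\to Y\dashrightarrow$; $\mathrm{Cone}(\mathcal{X},\mathcal{Y})$ of $M$ with $X\to Y\to M\dashrightarrow$; $\mathrm{Cocone}(\mathcal{X},\mathcal{Y})$ of $M$ with $M\to X\to Y\dashrightarrow$ (always $X\in\mathcal{X}$, $Y\in\mathcal{Y}$). $\mathsf{add}\,\mathcal{X}$ is the smallest subcategory containing $\mathcal{X}$ closed under finite direct sums and direct summands. A cotorsion pair in $\mathcal{C}$ is a pair $(\mathcal{X},\mathcal{Y})$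 of subcategories closed under direct summands with $\mathbb{E}(\mathcal{X},\mathcal{Y})=0$, $\mathcal{C}=\mathrm{Cone}(\mathcal{Y},\mathcal{X})$ and $\mathcal{C}=\mathrm{Cocone}(\mathcal{Y},\mathcal{X})$. It is an $s$-cotorsion pair if moreover $\mathbb{E}^2(\mathcal{X},\mathcal{Y})=0$. $\mathsf{cotors}\,\mathcal{C}$ is the set of cotorsion pairs, partially ordered by $(\mathcal{X},\mathcal{Y})\le(\mathcal{X}',\mathcal{Y}')$ iff $\mathcal{Y}\subseteq\mathcal{Y}'$. $\mathsf{scotors}\,\mathcal{C}$ is the subposet of $s$-cotorsion pairs. $\mathsf{cotors}[x_1,x_2]:=\{x\in\mathsf{cotors}\,\mathcal{C}\mid x_1\le x\le x_2\}$ and $\mathsf{scotors}[x_1,x_2]:=\mathsf{scotors}\,\mathcal{C}\cap\mathsf{cotors}[x_1,x_2]$. The subcategory $\mathcal{H}_{[x_1,x_2]}$ (the coheart) is closed under extensions in $\mathcal{C}$ and is regarded as an extriangulated category with $\mathbb{E}$ and $\mathfrak{s}$ restricted (its conflations are the $\mathfrak{s}$-conflations of $\mathcal{C}$ with all three terms in it); $\mathsf{cotors}\,\mathcal{H}_{[x_1,x_2]}$ is the poset of cotorsion pairs in it. *)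

theory Defs
  imports "HOL-Algebra.Module" "HOL-Algebra.AbelCoset" "HOL-Library.FuncSet"
begin

section \<open>Linear categories with a bifunctor and a realization\<close>

text \<open>
  A small category is given by a set of objects inside a type \<^typ>\<open>'o\<close>, with morphisms and
  extensions being elements of carriers inside types \<^typ>\<open>'m\<close> and \<^typ>\<open>'e\<close>.
  As morphisms may be tagged with their domain and codomain (and extensions with their two end
  terms), composition and the action of the bifunctor carry no object arguments; they are only
  constrained on matching arguments.

  \<open>Ext K C A\<close> is \<open>\<bbbE>(C, A)\<close> and \<open>ExtMap K c a\<close> is \<open>\<bbbE>(c, a)\<close>.
  A sequence \<open>A \<rightarrow> B \<rightarrow> C\<close> between fixed ends \<open>A\<close> and \<open>C\<close> is a triple \<open>(B, f, g)\<close>;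
  \<open>Real K C A \<delta>\<close> is the class \<open>\<s>(\<delta>)\<close>, a set of such triples.
  The ring multiplication fields of the records \<open>Hom K A B\<close> and \<open>Ext K C A\<close> are not used.
\<close>

record ('r, 'o, 'm, 'e) ext_cat =
  Obj :: "'o set"
  Hom :: "'o \<Rightarrow> 'o \<Rightarrow> ('r, 'm) module"
  Comp :: "'m \<Rightarrow> 'm \<Rightarrow> 'm"  (infixl \<open>\<bullet>\<index>\<close> 75)
  Ident :: "'o \<Rightarrow> 'm"
  Ext :: "'o \<Rightarrow> 'o \<Rightarrow> ('r, 'e) module"
  ExtMap :: "'m \<Rightarrow> 'm \<Rightarrow> 'e \<Rightarrow> 'e"
  Real :: "'o \<Rightarrow> 'o \<Rightarrow> 'e \<Rightarrow> ('o \<times> 'm \<times> 'm) set"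

abbreviation arr :: "('r, 'o, 'm, 'e) ext_cat \<Rightarrow> 'o \<Rightarrow> 'o \<Rightarrow> 'm set"
  where "arr K A B \<equiv> carrier (Hom K A B)"

definition ext_push :: "('r, 'o, 'm, 'e) ext_cat \<Rightarrow> 'o \<Rightarrow> 'm \<Rightarrow> 'e \<Rightarrow> 'e"
  \<comment> \<open>\<open>a\<^sub>* \<delta> = \<bbbE>(C, a)(\<delta>)\<close> for \<open>\<delta> \<in> \<bbbE>(C, A)\<close>\<close>
  where "ext_push K C a \<delta> = ExtMap K (Ident K C) a \<delta>"

definition ext_pull :: "('r, 'o, 'm, 'e) ext_cat \<Rightarrow> 'o \<Rightarrow> 'm \<Rightarrow> 'e \<Rightarrow> 'e"
  \<comment> \<open>\<open>c\<^sup>* \<delta> = \<bbbE>(c, A)(\<delta>)\<close> for \<open>\<delta> \<in> \<bbbE>(C, A)\<close>\<close>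
  where "ext_pull K A c \<delta> = ExtMap K c (Ident K A) \<delta>"

definition iso_arr :: "('r, 'o, 'm, 'e) ext_cat \<Rightarrow> 'o \<Rightarrow> 'o \<Rightarrow> 'm \<Rightarrow> bool"
  where "iso_arr K A B f \<longleftrightarrow> f \<in> arr K A B \<and>
    (\<exists>g \<in> arr K B A. g \<bullet>\<^bsub>K\<^esub> f = Ident K A \<and> f \<bullet>\<^bsub>K\<^esub> g = Ident K B)"

definition isomorphic :: "('r, 'o, 'm, 'e) ext_cat \<Rightarrow> 'o \<Rightarrow> 'o \<Rightarrow> bool"
  where "isomorphic K A B \<longleftrightarrow> (\<exists>f. iso_arr K A B f)"

definition zero_object :: "('r, 'o, 'm, 'e) ext_cat \<Rightarrow> 'o \<Rightarrow> bool"
  where "zero_object K Z \<longleftrightarrow> Z \<in> Obj K \<and>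
    (\<forall>A \<in> Obj K. (\<exists>!f. f \<in> arr K Z A) \<and> (\<exists>!f. f \<in> arr K A Z))"

text \<open>\<open>S = A \<oplus> B\<close> with injections \<open>i, j\<close> and projections \<open>p, q\<close>.\<close>

definition biproduct ::
    "('r, 'o, 'm, 'e) ext_cat \<Rightarrow> 'o \<Rightarrow> 'o \<Rightarrow> 'o \<Rightarrow> 'm \<Rightarrow> 'm \<Rightarrow> 'm \<Rightarrow> 'm \<Rightarrow> bool"
  where "biproduct K A B S i j p q \<longleftrightarrow>
    A \<in> Obj K \<and> B \<in> Obj K \<and> S \<in> Obj K \<and>
    i \<in> arr K A S \<and> j \<in> arr K B S \<and> p \<in> arr K S A \<and> q \<in> arr K S B \<and>
    p \<bullet>\<^bsub>K\<^esub> i = Ident K A \<and> q \<bullet>\<^bsub>K\<^esub> j = Ident K B \<and>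
    q \<bullet>\<^bsub>K\<^esub> i = \<zero>\<^bsub>Hom K A B\<^esub> \<and> p \<bullet>\<^bsub>K\<^esub> j = \<zero>\<^bsub>Hom K B A\<^esub> \<and>
    (i \<bullet>\<^bsub>K\<^esub> p) \<oplus>\<^bsub>Hom K S S\<^esub> (j \<bullet>\<^bsub>K\<^esub> q) = Ident K S"

definition complexes :: "('r, 'o, 'm, 'e) ext_cat \<Rightarrow> 'o \<Rightarrow> 'o \<Rightarrow> ('o \<times> 'm \<times> 'm) set"
  where "complexes K A C = {(B, f, g). B \<in> Obj K \<and> f \<in> arr K A B \<and> g \<in> arr K B C \<and>
    g \<bullet>\<^bsub>K\<^esub> f = \<zero>\<^bsub>Hom K A C\<^esub>}"

definition seq_equiv ::
    "('r, 'o, 'm, 'e) ext_cat \<Rightarrow> 'o \<Rightarrow> 'o \<Rightarrow> (('o \<times> 'm \<times> 'm) \<times> ('o \<times> 'm \<times> 'm)) set"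
  where "seq_equiv K A C = {((B, f, g), (B', f', g')).
    (B, f, g) \<in> complexes K A C \<and> (B', f', g') \<in> complexes K A C \<and>
    (\<exists>b. iso_arr K B B' b \<and> b \<bullet>\<^bsub>K\<^esub> f = f' \<and> g' \<bullet>\<^bsub>K\<^esub> b = g)}"

text \<open>\<open>realizes K A f B g C \<delta>\<close> says \<open>\<s>(\<delta>) = [A \<rightarrow> B \<rightarrow> C]\<close>, the arrows being \<open>f\<close> and \<open>g\<close>.\<close>

definition realizes ::
    "('r, 'o, 'm, 'e) ext_cat \<Rightarrow> 'o \<Rightarrow> 'm \<Rightarrow> 'o \<Rightarrow> 'm \<Rightarrow> 'o \<Rightarrow> 'e \<Rightarrow> bool"
  where "realizes K A f B g C \<delta> \<longleftrightarrow> A \<in> Obj K \<and> C \<in> Obj K \<and>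
    \<delta> \<in> carrier (Ext K C A) \<and> (B, f, g) \<in> complexes K A C \<and>
    Real K C A \<delta> = seq_equiv K A C `` {(B, f, g)}"

definition conflation ::
    "('r, 'o, 'm, 'e) ext_cat \<Rightarrow> 'o \<Rightarrow> 'm \<Rightarrow> 'o \<Rightarrow> 'm \<Rightarrow> 'o \<Rightarrow> bool"
  where "conflation K A f B g C \<longleftrightarrow> (\<exists>\<delta>. realizes K A f B g C \<delta>)"

locale linear_category =
  fixes R :: "('r, 'x) ring_scheme" and K :: "('r, 'o, 'm, 'e) ext_cat" (structure)
  assumes ring_R: "cring R"
    and hom_module: "\<lbrakk>A \<in> Obj K; B \<in> Obj K\<rbrakk> \<Longrightarrow> module R (Hom K A B)"
    and ident_arr: "A \<in> Obj K \<Longrightarrow> Ident K A \<in> arr K A A"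
    and comp_arr: "\<lbrakk>A \<in> Obj K; B \<in> Obj K; C \<in> Obj K; f \<in> arr K A B; g \<in> arr K B C\<rbrakk>
      \<Longrightarrow> g \<bullet> f \<in> arr K A C"
    and comp_ident_right: "\<lbrakk>A \<in> Obj K; B \<in> Obj K; f \<in> arr K A B\<rbrakk> \<Longrightarrow> f \<bullet> Ident K A = f"
    and comp_ident_left: "\<lbrakk>A \<in> Obj K; B \<in> Obj K; f \<in> arr K A B\<rbrakk> \<Longrightarrow> Ident K B \<bullet> f = f"
    and comp_assoc: "\<lbrakk>A \<in> Obj K; B \<in> Obj K; C \<in> Obj K; D \<in> Obj K;
        f \<in> arr K A B; g \<in> arr K B C; h \<in> arr K C D\<rbrakk>
      \<Longrightarrow> (h \<bullet> g) \<bullet> f = h \<bullet> (g \<bullet> f)"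
    and comp_add_right: "\<lbrakk>A \<in> Obj K; B \<in> Obj K; C \<in> Obj K;
        f \<in> arr K A B; f' \<in> arr K A B; g \<in> arr K B C\<rbrakk>
      \<Longrightarrow> g \<bullet> (f \<oplus>\<^bsub>Hom K A B\<^esub> f') = (g \<bullet> f) \<oplus>\<^bsub>Hom K A C\<^esub> (g \<bullet> f')"
    and comp_add_left: "\<lbrakk>A \<in> Obj K; B \<in> Obj K; C \<in> Obj K;
        f \<in> arr K A B; g \<in> arr K B C; g' \<in> arr K B C\<rbrakk>
      \<Longrightarrow> (g \<oplus>\<^bsub>Hom K B C\<^esub> g') \<bullet> f = (g \<bullet> f) \<oplus>\<^bsub>Hom K A C\<^esub> (g' \<bullet> f)"
    and comp_smult_right: "\<lbrakk>A \<in> Obj K; B \<in> Obj K; C \<in> Obj K;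
        r \<in> carrier R; f \<in> arr K A B; g \<in> arr K B C\<rbrakk>
      \<Longrightarrow> g \<bullet> (r \<odot>\<^bsub>Hom K A B\<^esub> f) = r \<odot>\<^bsub>Hom K A C\<^esub> (g \<bullet> f)"
    and comp_smult_left: "\<lbrakk>A \<in> Obj K; B \<in> Obj K; C \<in> Obj K;
        r \<in> carrier R; f \<in> arr K A B; g \<in> arr K B C\<rbrakk>
      \<Longrightarrow> (r \<odot>\<^bsub>Hom K B C\<^esub> g) \<bullet> f = r \<odot>\<^bsub>Hom K A C\<^esub> (g \<bullet> f)"

locale additive_category = linear_category +
  assumes zero_object_exists: "\<exists>Z. zero_object K Z"
    and biproduct_exists: "\<lbrakk>A \<in> Obj K; B \<in> Obj K\<rbrakk> \<Longrightarrow> \<exists>S i j p q. biproduct K A B S i j p q"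

section \<open>Extriangulated categories\<close>

locale bilinear_ext_functor = additive_category +
  assumes ext_module: "\<lbrakk>C \<in> Obj K; A \<in> Obj K\<rbrakk> \<Longrightarrow> module R (Ext K C A)"
    and ext_map_closed: "\<lbrakk>C \<in> Obj K; C' \<in> Obj K; A \<in> Obj K; A' \<in> Obj K;
        c \<in> arr K C' C; a \<in> arr K A A'; \<delta> \<in> carrier (Ext K C A)\<rbrakk>
      \<Longrightarrow> ExtMap K c a \<delta> \<in> carrier (Ext K C' A')"
    and ext_map_add: "\<lbrakk>C \<in> Obj K; C' \<in> Obj K; A \<in> Obj K; A' \<in> Obj K;
        c \<in> arr K C' C; a \<in> arr K A A'; \<delta> \<in> carrier (Ext K C A); \<delta>' \<in> carrier (Ext K C A)\<rbrakk>
      \<Longrightarrow> ExtMap K c a (\<delta> \<oplus>\<^bsub>Ext K C A\<^esub> \<delta>')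
          = ExtMap K c a \<delta> \<oplus>\<^bsub>Ext K C' A'\<^esub> ExtMap K c a \<delta>'"
    and ext_map_smult: "\<lbrakk>C \<in> Obj K; C' \<in> Obj K; A \<in> Obj K; A' \<in> Obj K;
        c \<in> arr K C' C; a \<in> arr K A A'; r \<in> carrier R; \<delta> \<in> carrier (Ext K C A)\<rbrakk>
      \<Longrightarrow> ExtMap K c a (r \<odot>\<^bsub>Ext K C A\<^esub> \<delta>) = r \<odot>\<^bsub>Ext K C' A'\<^esub> ExtMap K c a \<delta>"
    and ext_map_ident: "\<lbrakk>C \<in> Obj K; A \<in> Obj K; \<delta> \<in> carrier (Ext K C A)\<rbrakk>
      \<Longrightarrow> ExtMap K (Ident K C) (Ident K A) \<delta> = \<delta>"
    and ext_map_comp: "\<lbrakk>C \<in> Obj K; C' \<in> Obj K; C'' \<in> Obj K; A \<in> Obj K; A' \<in> Obj K; A'' \<in> Obj K;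
        c \<in> arr K C' C; c' \<in> arr K C'' C'; a \<in> arr K A A'; a' \<in> arr K A' A'';
        \<delta> \<in> carrier (Ext K C A)\<rbrakk>
      \<Longrightarrow> ExtMap K (c \<bullet> c') (a' \<bullet> a) \<delta> = ExtMap K c' a' (ExtMap K c a \<delta>)"
    and ext_map_add_left: "\<lbrakk>C \<in> Obj K; C' \<in> Obj K; A \<in> Obj K; A' \<in> Obj K;
        c \<in> arr K C' C; c' \<in> arr K C' C; a \<in> arr K A A'; \<delta> \<in> carrier (Ext K C A)\<rbrakk>
      \<Longrightarrow> ExtMap K (c \<oplus>\<^bsub>Hom K C' C\<^esub> c') a \<delta>
          = ExtMap K c a \<delta> \<oplus>\<^bsub>Ext K C' A'\<^esub> ExtMap K c' a \<delta>"
    and ext_map_smult_left: "\<lbrakk>C \<in> Obj K; C' \<in> Obj K; A \<in> Obj K; A' \<in> Obj K;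
        r \<in> carrier R; c \<in> arr K C' C; a \<in> arr K A A'; \<delta> \<in> carrier (Ext K C A)\<rbrakk>
      \<Longrightarrow> ExtMap K (r \<odot>\<^bsub>Hom K C' C\<^esub> c) a \<delta> = r \<odot>\<^bsub>Ext K C' A'\<^esub> ExtMap K c a \<delta>"
    and ext_map_add_right: "\<lbrakk>C \<in> Obj K; C' \<in> Obj K; A \<in> Obj K; A' \<in> Obj K;
        c \<in> arr K C' C; a \<in> arr K A A'; a' \<in> arr K A A'; \<delta> \<in> carrier (Ext K C A)\<rbrakk>
      \<Longrightarrow> ExtMap K c (a \<oplus>\<^bsub>Hom K A A'\<^esub> a') \<delta>
          = ExtMap K c a \<delta> \<oplus>\<^bsub>Ext K C' A'\<^esub> ExtMap K c a' \<delta>"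
    and ext_map_smult_right: "\<lbrakk>C \<in> Obj K; C' \<in> Obj K; A \<in> Obj K; A' \<in> Obj K;
        r \<in> carrier R; c \<in> arr K C' C; a \<in> arr K A A'; \<delta> \<in> carrier (Ext K C A)\<rbrakk>
      \<Longrightarrow> ExtMap K c (r \<odot>\<^bsub>Hom K A A'\<^esub> a) \<delta> = r \<odot>\<^bsub>Ext K C' A'\<^esub> ExtMap K c a \<delta>"

text \<open>
  In \<open>real_sum\<close>, \<open>\<delta> \<oplus> \<delta>'\<close> is the element of \<open>\<bbbE>(C \<oplus> C', A \<oplus> A')\<close> whose components are
  \<open>(\<delta>, 0, 0, \<delta>')\<close>. Biproducts are not part of the structure, so \<open>real_zero\<close> and \<open>real_sum\<close>
  are required for every choice of them.
\<close>

locale extriangulated_category = bilinear_ext_functor +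
  assumes real_class: "\<lbrakk>C \<in> Obj K; A \<in> Obj K; \<delta> \<in> carrier (Ext K C A)\<rbrakk>
      \<Longrightarrow> Real K C A \<delta> \<in> complexes K A C // seq_equiv K A C"
    and real_zero: "biproduct K A C S i j p q \<Longrightarrow> realizes K A i S q C \<zero>\<^bsub>Ext K C A\<^esub>"
    and real_sum: "\<lbrakk>realizes K A f B g C \<delta>; realizes K A' f' B' g' C' \<delta>';
        biproduct K A A' AA iA iA' pA pA'; biproduct K B B' BB iB iB' pB pB';
        biproduct K C C' CC iC iC' pC pC'\<rbrakk>
      \<Longrightarrow> realizes K AA ((iB \<bullet> f \<bullet> pA) \<oplus>\<^bsub>Hom K AA BB\<^esub> (iB' \<bullet> f' \<bullet> pA'))
            BB ((iC \<bullet> g \<bullet> pB) \<oplus>\<^bsub>Hom K BB CC\<^esub> (iC' \<bullet> g' \<bullet> pB'))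
            CC (ExtMap K pC iA \<delta> \<oplus>\<^bsub>Ext K CC AA\<^esub> ExtMap K pC' iA' \<delta>')"
    and real_morphism: "\<lbrakk>realizes K A f B g C \<delta>; realizes K A' f' B' g' C' \<delta>';
        a \<in> arr K A A'; c \<in> arr K C C'; ext_push K C a \<delta> = ext_pull K A' c \<delta>'\<rbrakk>
      \<Longrightarrow> \<exists>b \<in> arr K B B'. b \<bullet> f = f' \<bullet> a \<and> g' \<bullet> b = c \<bullet> g"
    and ET3: "\<lbrakk>realizes K A f B g C \<delta>; realizes K A' f' B' g' C' \<delta>';
        a \<in> arr K A A'; b \<in> arr K B B'; b \<bullet> f = f' \<bullet> a\<rbrakk>
      \<Longrightarrow> \<exists>c \<in> arr K C C'. c \<bullet> g = g' \<bullet> b \<and> ext_push K C a \<delta> = ext_pull K A' c \<delta>'"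
    and ET3_op: "\<lbrakk>realizes K A f B g C \<delta>; realizes K A' f' B' g' C' \<delta>';
        b \<in> arr K B B'; c \<in> arr K C C'; c \<bullet> g = g' \<bullet> b\<rbrakk>
      \<Longrightarrow> \<exists>a \<in> arr K A A'. b \<bullet> f = f' \<bullet> a \<and> ext_push K C a \<delta> = ext_pull K A' c \<delta>'"
    and ET4: "\<lbrakk>realizes K A f B f' D \<delta>; realizes K B g C g' F \<delta>'\<rbrakk>
      \<Longrightarrow> \<exists>E \<in> Obj K. \<exists>h \<in> arr K C E. \<exists>d \<in> arr K D E. \<exists>e \<in> arr K E F. \<exists>\<delta>'' \<in> carrier (Ext K E A).
            realizes K A (g \<bullet> f) C h E \<delta>'' \<and>
            h \<bullet> g = d \<bullet> f' \<and> e \<bullet> h = g' \<and>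
            realizes K D d E e F (ext_push K F f' \<delta>') \<and>
            ext_pull K A d \<delta>'' = \<delta> \<and>
            ext_push K E f \<delta>'' = ext_pull K B e \<delta>'"
    and ET4_op: "\<lbrakk>realizes K D f' B f A \<delta>; realizes K F g' C g B \<delta>'\<rbrakk>
      \<Longrightarrow> \<exists>E \<in> Obj K. \<exists>h \<in> arr K E C. \<exists>d \<in> arr K E D. \<exists>e \<in> arr K F E. \<exists>\<delta>'' \<in> carrier (Ext K A E).
            realizes K E h C (f \<bullet> g) A \<delta>'' \<and>
            g \<bullet> h = f' \<bullet> d \<and> h \<bullet> e = g' \<and>
            realizes K F e E d D (ext_pull K F f' \<delta>') \<and>
            ext_push K A d \<delta>'' = \<delta> \<and>
            ext_pull K E f \<delta>'' = ext_push K B e \<delta>'"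

section \<open>The second extension module\<close>

definition free_module :: "('r, 'x) ring_scheme \<Rightarrow> 's set \<Rightarrow> ('r, 's \<Rightarrow> 'r) module"
  where "free_module R S =
    \<lparr>carrier = {\<phi>. (\<forall>s. \<phi> s \<in> carrier R) \<and> (\<forall>s. s \<notin> S \<longrightarrow> \<phi> s = \<zero>\<^bsub>R\<^esub>) \<and>
       finite {s. \<phi> s \<noteq> \<zero>\<^bsub>R\<^esub>}},
     mult = undefined, one = undefined,
     zero = (\<lambda>s. \<zero>\<^bsub>R\<^esub>), add = (\<lambda>\<phi> \<psi> s. \<phi> s \<oplus>\<^bsub>R\<^esub> \<psi> s),
     smult = (\<lambda>r \<phi> s. r \<otimes>\<^bsub>R\<^esub> \<phi> s)\<rparr>"

definition free_gen :: "('r, 'x) ring_scheme \<Rightarrow> 's \<Rightarrow> 's \<Rightarrow> 'r"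
  where "free_gen R s = (\<lambda>t. if t = s then \<one>\<^bsub>R\<^esub> else \<zero>\<^bsub>R\<^esub>)"

definition submodule_generated ::
    "('r, 'x) ring_scheme \<Rightarrow> ('r, 'b) module \<Rightarrow> 'b set \<Rightarrow> 'b set"
  where "submodule_generated R M G = \<Inter>{N. submodule N R M \<and> G \<subseteq> N}"

definition quotient_module :: "('r, 'b) module \<Rightarrow> 'b set \<Rightarrow> ('r, 'b set) module"
  where "quotient_module M N =
    \<lparr>carrier = a_rcosets\<^bsub>M\<^esub> N, mult = undefined, one = undefined, zero = N, add = set_add M,
     smult = (\<lambda>r U. \<Union>u\<in>U. N +>\<^bsub>M\<^esub> (r \<odot>\<^bsub>M\<^esub> u))\<rparr>"

text \<open>
  \<open>\<bbbE>\<^sup>2(C, A)\<close> is the coend over \<open>X\<close> of \<open>\<bbbE>(X, A) \<otimes>\<^sub>R \<bbbE>(C, X)\<close>, presented as the free module on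
  symbols \<open>(X, u, v)\<close>, standing for \<open>u \<otimes> v\<close> in the summand at \<open>X\<close>, modulo the relations of the
  tensor products (\<open>ext2_tensor_relations\<close>) and the relations \<open>x\<^sup>*u \<otimes> v = u \<otimes> x\<^sub>*v\<close>
  of the coend, one for each morphism \<open>x : X \<rightarrow> X'\<close> (\<open>ext2_coend_relations\<close>).
\<close>

definition ext2_symbols :: "('r, 'o, 'm, 'e) ext_cat \<Rightarrow> 'o \<Rightarrow> 'o \<Rightarrow> ('o \<times> 'e \<times> 'e) set"
  where "ext2_symbols K C A =
    {(X, u, v). X \<in> Obj K \<and> u \<in> carrier (Ext K X A) \<and> v \<in> carrier (Ext K C X)}"

definition ext2_free ::
    "('r, 'x) ring_scheme \<Rightarrow> ('r, 'o, 'm, 'e) ext_cat \<Rightarrow> 'o \<Rightarrow> 'o \<Rightarrow> ('r, 'o \<times> 'e \<times> 'e \<Rightarrow> 'r) module"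
  where "ext2_free R K C A = free_module R (ext2_symbols K C A)"

definition ext2_tensor_relations ::
    "('r, 'x) ring_scheme \<Rightarrow> ('r, 'o, 'm, 'e) ext_cat \<Rightarrow> 'o \<Rightarrow> 'o \<Rightarrow> ('o \<times> 'e \<times> 'e \<Rightarrow> 'r) set"
  where "ext2_tensor_relations R K C A =
    (let F = ext2_free R K C A; t = (\<lambda>X u v. free_gen R (X, u, v)) in
      {t X (u \<oplus>\<^bsub>Ext K X A\<^esub> u') v \<ominus>\<^bsub>F\<^esub> (t X u v \<oplus>\<^bsub>F\<^esub> t X u' v) | X u u' v.
         X \<in> Obj K \<and> u \<in> carrier (Ext K X A) \<and> u' \<in> carrier (Ext K X A) \<and> v \<in> carrier (Ext K C X)}
    \<union> {t X u (v \<oplus>\<^bsub>Ext K C X\<^esub> v') \<ominus>\<^bsub>F\<^esub> (t X u v \<oplus>\<^bsub>F\<^esub> t X u v') | X u v v'.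
         X \<in> Obj K \<and> u \<in> carrier (Ext K X A) \<and> v \<in> carrier (Ext K C X) \<and> v' \<in> carrier (Ext K C X)}
    \<union> {t X (r \<odot>\<^bsub>Ext K X A\<^esub> u) v \<ominus>\<^bsub>F\<^esub> (r \<odot>\<^bsub>F\<^esub> t X u v) | X r u v.
         X \<in> Obj K \<and> r \<in> carrier R \<and> u \<in> carrier (Ext K X A) \<and> v \<in> carrier (Ext K C X)}
    \<union> {t X u (r \<odot>\<^bsub>Ext K C X\<^esub> v) \<ominus>\<^bsub>F\<^esub> (r \<odot>\<^bsub>F\<^esub> t X u v) | X r u v.
         X \<in> Obj K \<and> r \<in> carrier R \<and> u \<in> carrier (Ext K X A) \<and> v \<in> carrier (Ext K C X)})"

definition ext2_coend_relations ::
    "('r, 'x) ring_scheme \<Rightarrow> ('r, 'o, 'm, 'e) ext_cat \<Rightarrow> 'o \<Rightarrow> 'o \<Rightarrow> ('o \<times> 'e \<times> 'e \<Rightarrow> 'r) set"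
  where "ext2_coend_relations R K C A =
    (let F = ext2_free R K C A; t = (\<lambda>X u v. free_gen R (X, u, v)) in
      {t X (ext_pull K A x u) v \<ominus>\<^bsub>F\<^esub> t X' u (ext_push K C x v) | X X' x u v.
         X \<in> Obj K \<and> X' \<in> Obj K \<and> x \<in> arr K X X' \<and>
         u \<in> carrier (Ext K X' A) \<and> v \<in> carrier (Ext K C X)})"

definition Ext2 ::
    "('r, 'x) ring_scheme \<Rightarrow> ('r, 'o, 'm, 'e) ext_cat \<Rightarrow> 'o \<Rightarrow> 'o \<Rightarrow> ('r, ('o \<times> 'e \<times> 'e \<Rightarrow> 'r) set) module"
  where "Ext2 R K C A = quotient_module (ext2_free R K C A)
    (submodule_generated R (ext2_free R K C A)
      (ext2_tensor_relations R K C A \<union> ext2_coend_relations R K C A))"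

definition ext_vanishes :: "('r, 'o, 'm, 'e) ext_cat \<Rightarrow> 'o set \<Rightarrow> 'o set \<Rightarrow> bool"
  where "ext_vanishes K \<X> \<Y> \<longleftrightarrow>
    (\<forall>X \<in> \<X>. \<forall>Y \<in> \<Y>. carrier (Ext K X Y) = {\<zero>\<^bsub>Ext K X Y\<^esub>})"

definition ext2_vanishes ::
    "('r, 'x) ring_scheme \<Rightarrow> ('r, 'o, 'm, 'e) ext_cat \<Rightarrow> 'o set \<Rightarrow> 'o set \<Rightarrow> bool"
  where "ext2_vanishes R K \<X> \<Y> \<longleftrightarrow>
    (\<forall>X \<in> \<X>. \<forall>Y \<in> \<Y>. carrier (Ext2 R K X Y) = {\<zero>\<^bsub>Ext2 R K X Y\<^esub>})"

section \<open>Subcategories\<close>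

text \<open>Full subcategories are given by their sets of objects.\<close>

definition subcategory :: "('r, 'o, 'm, 'e) ext_cat \<Rightarrow> 'o set \<Rightarrow> bool"
  where "subcategory K \<S> \<longleftrightarrow> \<S> \<subseteq> Obj K \<and>
    (\<forall>A \<in> \<S>. \<forall>B \<in> Obj K. isomorphic K A B \<longrightarrow> B \<in> \<S>) \<and>
    (\<exists>Z \<in> \<S>. zero_object K Z) \<and>
    (\<forall>A \<in> \<S>. \<forall>B \<in> \<S>. \<forall>S i j p q. biproduct K A B S i j p q \<longrightarrow> S \<in> \<S>)"

definition summand :: "('r, 'o, 'm, 'e) ext_cat \<Rightarrow> 'o \<Rightarrow> 'o \<Rightarrow> bool"
  where "summand K A M \<longleftrightarrow> (\<exists>B i j p q. biproduct K A B M i j p q)"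

definition summand_closed :: "('r, 'o, 'm, 'e) ext_cat \<Rightarrow> 'o set \<Rightarrow> bool"
  where "summand_closed K \<S> \<longleftrightarrow> (\<forall>M \<in> \<S>. \<forall>A. summand K A M \<longrightarrow> A \<in> \<S>)"

definition add_closure :: "('r, 'o, 'm, 'e) ext_cat \<Rightarrow> 'o set \<Rightarrow> 'o set"
  where "add_closure K \<X> = \<Inter>{\<S>. subcategory K \<S> \<and> summand_closed K \<S> \<and> \<X> \<subseteq> \<S>}"

definition star :: "('r, 'o, 'm, 'e) ext_cat \<Rightarrow> 'o set \<Rightarrow> 'o set \<Rightarrow> 'o set"
  where "star K \<X> \<Y> = {M. \<exists>X \<in> \<X>. \<exists>Y \<in> \<Y>. \<exists>f g. conflation K X f M g Y}"

definition Cone :: "('r, 'o, 'm, 'e) ext_cat \<Rightarrow> 'o set \<Rightarrow> 'o set \<Rightarrow> 'o set"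
  where "Cone K \<X> \<Y> = {M. \<exists>X \<in> \<X>. \<exists>Y \<in> \<Y>. \<exists>f g. conflation K X f Y g M}"

definition Cocone :: "('r, 'o, 'm, 'e) ext_cat \<Rightarrow> 'o set \<Rightarrow> 'o set \<Rightarrow> 'o set"
  where "Cocone K \<X> \<Y> = {M. \<exists>X \<in> \<X>. \<exists>Y \<in> \<Y>. \<exists>f g. conflation K M f X g Y}"

text \<open>
  The structure induced on a full subcategory. When the subcategory is closed under
  isomorphisms and extensions, each \<open>\<s>(\<delta>)\<close> with ends in it consists of sequences with middle
  term in it, so that the restriction of \<open>Real\<close> below only matters for other sets of objects.
\<close>

definition restrict_to :: "('r, 'o, 'm, 'e) ext_cat \<Rightarrow> 'o set \<Rightarrow> ('r, 'o, 'm, 'e) ext_cat"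
  where "restrict_to K \<H> =
    K\<lparr>Obj := \<H>, Real := (\<lambda>C A \<delta>. {(B, f, g) \<in> Real K C A \<delta>. B \<in> \<H>})\<rparr>"

section \<open>Cotorsion pairs\<close>

definition cotorsion_pair :: "('r, 'o, 'm, 'e) ext_cat \<Rightarrow> 'o set \<Rightarrow> 'o set \<Rightarrow> bool"
  where "cotorsion_pair K \<X> \<Y> \<longleftrightarrow>
    subcategory K \<X> \<and> subcategory K \<Y> \<and> summand_closed K \<X> \<and> summand_closed K \<Y> \<and>
    ext_vanishes K \<X> \<Y> \<and> Obj K = Cone K \<Y> \<X> \<and> Obj K = Cocone K \<Y> \<X>"

definition cotors :: "('r, 'o, 'm, 'e) ext_cat \<Rightarrow> ('o set \<times> 'o set) set"
  where "cotors K = {(\<X>, \<Y>). cotorsion_pair K \<X> \<Y>}"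

definition scotors ::
    "('r, 'x) ring_scheme \<Rightarrow> ('r, 'o, 'm, 'e) ext_cat \<Rightarrow> ('o set \<times> 'o set) set"
  where "scotors R K = {(\<X>, \<Y>). cotorsion_pair K \<X> \<Y> \<and> ext2_vanishes R K \<X> \<Y>}"

definition cotors_le :: "'o set \<times> 'o set \<Rightarrow> 'o set \<times> 'o set \<Rightarrow> bool"
  where "cotors_le x x' \<longleftrightarrow> snd x \<subseteq> snd x'"

definition cotors_interval ::
    "('r, 'o, 'm, 'e) ext_cat \<Rightarrow> 'o set \<times> 'o set \<Rightarrow> 'o set \<times> 'o set \<Rightarrow> ('o set \<times> 'o set) set"
  where "cotors_interval K x1 x2 = {x \<in> cotors K. cotors_le x1 x \<and> cotors_le x x2}"

definition scotors_interval ::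
    "('r, 'x) ring_scheme \<Rightarrow> ('r, 'o, 'm, 'e) ext_cat \<Rightarrow>
      'o set \<times> 'o set \<Rightarrow> 'o set \<times> 'o set \<Rightarrow> ('o set \<times> 'o set) set"
  where "scotors_interval R K x1 x2 = scotors R K \<inter> cotors_interval K x1 x2"

definition coheart :: "'o set \<times> 'o set \<Rightarrow> 'o set \<times> 'o set \<Rightarrow> 'o set"
  where "coheart x1 x2 = fst x1 \<inter> snd x2"

definition inverse_poset_isos ::
    "'a set \<Rightarrow> ('a \<Rightarrow> 'a \<Rightarrow> bool) \<Rightarrow> 'b set \<Rightarrow> ('b \<Rightarrow> 'b \<Rightarrow> bool) \<Rightarrow> ('a \<Rightarrow> 'b) \<Rightarrow> ('b \<Rightarrow> 'a) \<Rightarrow> bool"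
  where "inverse_poset_isos P le_P Q le_Q \<Phi> \<Psi> \<longleftrightarrow>
    \<Phi> \<in> P \<rightarrow> Q \<and> \<Psi> \<in> Q \<rightarrow> P \<and>
    (\<forall>x \<in> P. \<Psi> (\<Phi> x) = x) \<and> (\<forall>y \<in> Q. \<Phi> (\<Psi> y) = y) \<and>
    monotone_on P le_P le_Q \<Phi> \<and> monotone_on Q le_Q le_P \<Psi>"

end

theory Submission
  imports Defs
begin

text \<open>
  The proof rests on one fact about \<open>s\<close>-cotorsion pairs \<open>(\<X>, \<Y>)\<close>: they are hereditary, that is, \<open>\<X>\<close> is
  closed under kernels of deflations and \<open>\<Y>\<close> under cokernels of inflations. Granted this, everything
  else is an argument with approximating conflations.

  Let \<open>\<H> = \<X>\<^sub>1 \<inter> \<Y>\<^sub>2\<close>. For a cotorsion pair \<open>(\<X>, \<Y>)\<close> in the interval and \<open>M \<in> \<H>\<close>, take a conflation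
  \<open>Y \<rightarrow> X \<rightarrow> M\<close>. Heredity of \<open>\<X>\<^sub>1\<close> puts \<open>Y\<close> into \<open>\<X>\<^sub>1\<close>, and \<open>X\<close> lies in \<open>\<Y>\<^sub>2\<close> as an extension, so the
  approximation lives in \<open>\<H>\<close> (\<open>intersection_cone\<close>). Conversely, given a cotorsion pair \<open>(\<A>, \<B>)\<close> in \<open>\<H>\<close>
  and any object \<open>M\<close>, approximate \<open>M\<close> by \<open>Y\<^sub>1 \<rightarrow> X\<^sub>1 \<rightarrow> M\<close> for the first pair and \<open>X\<^sub>1\<close> by
  \<open>Y\<^sub>2 \<rightarrow> X\<^sub>2 \<rightarrow> X\<^sub>1\<close> for the second. By heredity \<open>Y\<^sub>2 \<in> \<H>\<close>, so there is \<open>Y\<^sub>2 \<rightarrow> B \<rightarrow> A\<close> with \<open>B \<in> \<B>\<close> and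
  \<open>A \<in> \<A>\<close>. Pushing out along it replaces \<open>X\<^sub>2\<close> by an object of \<open>\<X>\<^sub>2 * \<A>\<close> whose kernel onto \<open>M\<close> is in
  \<open>\<B> * \<Y>\<^sub>1\<close> (\<open>star_cone\<close>). Each component of a cotorsion pair is the \<open>\<bbbE>\<close>-orthogonal of the other
  (\<open>cotorsion_left_perp\<close>), and orthogonality in \<open>\<H>\<close> and in the whole category is the same condition.
  Hence the two constructions are mutually inverse.

  For heredity, consider a conflation \<open>D \<rightarrow> B \<rightarrow> C\<close> with \<open>B\<close> and \<open>C\<close> in \<open>\<X>\<close>. Exactness of
  \<open>\<bbbE>(B, A) \<rightarrow> \<bbbE>(D, A) \<rightarrow> \<bbbE>\<^sup>2(C, A)\<close> for \<open>A \<in> \<Y>\<close> gives \<open>\<bbbE>(D, A) = 0\<close>. The difficulty is that \<open>\<bbbE>\<^sup>2\<close> is a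
  coend, and one has to see that \<open>u \<otimes> \<delta> = 0\<close> forces \<open>u \<in> \<bbbE>(D, A)\<close> to extend to \<open>B\<close>. For this,
  \<open>\<bbbE>\<^sup>2(C, A)\<close> is compared with the filtered colimit, over all \<open>\<delta>' \<in> \<bbbE>(C, D')\<close> with middle term \<open>B'\<close>, of
  the cokernels of \<open>\<bbbE>(B', A) \<rightarrow> \<bbbE>(D', A)\<close>: a symbol \<open>u \<otimes> v\<close> is sent to \<open>x\<^sup>*u\<close> as soon as
  \<open>v = x\<^sub>*\<delta>'\<close>. The coend relations hold in the colimit, and the cokernel belonging to a single \<open>\<delta>\<close>
  embeds into it (\<open>extension_descends\<close>). Closure of \<open>\<Y>\<close> under cokernels then follows from closure of
  \<open>\<X>\<close> under kernels alone (\<open>cocone_closed_cone_closed\<close>).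
\<close>

section \<open>Calculus in a category with a bifunctor\<close>

text \<open>Composition and the action of \<open>\<bbbE>\<close> carry no object arguments, so the typing judgements below record
  the end terms together with their being objects; chaining them supplies all side conditions.\<close>

definition mor :: "('r, 'o, 'm, 'e) ext_cat \<Rightarrow> 'm \<Rightarrow> 'o \<Rightarrow> 'o \<Rightarrow> bool"
  where "mor K f A B \<longleftrightarrow> A \<in> Obj K \<and> B \<in> Obj K \<and> f \<in> arr K A B"

definition exten :: "('r, 'o, 'm, 'e) ext_cat \<Rightarrow> 'e \<Rightarrow> 'o \<Rightarrow> 'o \<Rightarrow> bool"
  where "exten K \<delta> C A \<longleftrightarrow> C \<in> Obj K \<and> A \<in> Obj K \<and> \<delta> \<in> carrier (Ext K C A)"

lemma mor_obj: "mor K f A B \<Longrightarrow> A \<in> Obj K" "mor K f A B \<Longrightarrow> B \<in> Obj K"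
  by (auto simp: mor_def)

context linear_category
begin

lemma hom_group: "A \<in> Obj K \<Longrightarrow> B \<in> Obj K \<Longrightarrow> abelian_group (Hom K A B)"
  using hom_module module.axioms(2) by blast

lemma mor_id: "A \<in> Obj K \<Longrightarrow> mor K (Ident K A) A A"
  by (simp add: mor_def ident_arr)

lemma mor_comp: "mor K f A B \<Longrightarrow> mor K g B C \<Longrightarrow> mor K (g \<bullet> f) A C"
  by (auto simp: mor_def intro: comp_arr)

lemma mor_zero: "A \<in> Obj K \<Longrightarrow> B \<in> Obj K \<Longrightarrow> mor K \<zero>\<^bsub>Hom K A B\<^esub> A B"
  by (simp add: mor_def abelian_groupE(2)[OF hom_group])

lemma mor_add: "mor K f A B \<Longrightarrow> mor K g A B \<Longrightarrow> mor K (f \<oplus>\<^bsub>Hom K A B\<^esub> g) A B"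
  by (simp add: mor_def abelian_groupE(1)[OF hom_group])

lemma mor_minus: "mor K f A B \<Longrightarrow> mor K g A B \<Longrightarrow> mor K (f \<ominus>\<^bsub>Hom K A B\<^esub> g) A B"
  by (simp add: mor_def abelian_group.minus_closed[OF hom_group])

lemma assoc: "mor K f A B \<Longrightarrow> mor K g B C \<Longrightarrow> mor K h C D \<Longrightarrow> (h \<bullet> g) \<bullet> f = h \<bullet> (g \<bullet> f)"
  by (auto simp: mor_def intro: comp_assoc)

lemma id_right: "mor K f A B \<Longrightarrow> f \<bullet> Ident K A = f"
  and id_left: "mor K f A B \<Longrightarrow> Ident K B \<bullet> f = f"
  by (auto simp: mor_def comp_ident_right comp_ident_left)

lemma distrib_right: "mor K f A B \<Longrightarrow> mor K f' A B \<Longrightarrow> mor K g B C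
    \<Longrightarrow> g \<bullet> (f \<oplus>\<^bsub>Hom K A B\<^esub> f') = (g \<bullet> f) \<oplus>\<^bsub>Hom K A C\<^esub> (g \<bullet> f')"
  and distrib_left: "mor K f A B \<Longrightarrow> mor K g B C \<Longrightarrow> mor K g' B C
    \<Longrightarrow> (g \<oplus>\<^bsub>Hom K B C\<^esub> g') \<bullet> f = (g \<bullet> f) \<oplus>\<^bsub>Hom K A C\<^esub> (g' \<bullet> f)"
  by (auto simp: mor_def intro: comp_add_right comp_add_left)

end

text \<open>Composition, push-forward and pull-back are additive in each argument; this transfers \<open>0\<close> and
  differences along them.\<close>

lemma additive_map:
  assumes "abelian_group G" "abelian_group H" "h \<in> carrier G \<rightarrow> carrier H"
    and "\<And>x y. x \<in> carrier G \<Longrightarrow> y \<in> carrier G \<Longrightarrow> h (x \<oplus>\<^bsub>G\<^esub> y) = h x \<oplus>\<^bsub>H\<^esub> h y"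
  shows "h \<zero>\<^bsub>G\<^esub> = \<zero>\<^bsub>H\<^esub>"
    and "x \<in> carrier G \<Longrightarrow> y \<in> carrier G \<Longrightarrow> h (x \<ominus>\<^bsub>G\<^esub> y) = h x \<ominus>\<^bsub>H\<^esub> h y"
proof -
  interpret G: abelian_group G by fact
  interpret H: abelian_group H by fact
  interpret abelian_group_hom G H h
    by (rule abelian_group_homI) (auto intro!: assms group_hom.intro G.a_group H.a_group 
      simp: group_hom_axioms_def hom_def assms)
  show "h \<zero>\<^bsub>G\<^esub> = \<zero>\<^bsub>H\<^esub>" by simp
  show "h (x \<ominus>\<^bsub>G\<^esub> y) = h x \<ominus>\<^bsub>H\<^esub> h y" if "x \<in> carrier G" "y \<in> carrier G"
    using that by (simp add: a_minus_def)
qed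

context linear_category
begin

lemma comp_zero_right:
  assumes "A \<in> Obj K" "mor K g B C" shows "g \<bullet> \<zero>\<^bsub>Hom K A B\<^esub> = \<zero>\<^bsub>Hom K A C\<^esub>"
  using assms by (intro additive_map(1)[where h = "\<lambda>f. g \<bullet> f"])
    (auto simp: mor_def intro: hom_group comp_arr comp_add_right)

lemma comp_zero_left:
  assumes "C \<in> Obj K" "mor K f A B" shows "\<zero>\<^bsub>Hom K B C\<^esub> \<bullet> f = \<zero>\<^bsub>Hom K A C\<^esub>"
  using assms by (intro additive_map(1)[where h = "\<lambda>g. g \<bullet> f"])
    (auto simp: mor_def intro: hom_group comp_arr comp_add_left)

lemma diff_left:
  assumes "mor K f A B" "mor K g B C" "mor K g' B C"
  shows "(g \<ominus>\<^bsub>Hom K B C\<^esub> g') \<bullet> f = (g \<bullet> f) \<ominus>\<^bsub>Hom K A C\<^esub> (g' \<bullet> f)"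
  using assms by (intro additive_map(2)[where h = "\<lambda>g. g \<bullet> f"])
    (auto simp: mor_def intro: hom_group comp_arr comp_add_left)

lemma iso_arrD: 
  assumes "iso_arr K A B f" "A \<in> Obj K" "B \<in> Obj K"
  shows "\<exists>g. mor K f A B \<and> mor K g B A \<and> g \<bullet> f = Ident K A \<and> f \<bullet> g = Ident K B"
  using assms by (auto simp: iso_arr_def mor_def)

lemma iso_arrI:
  "mor K f A B \<Longrightarrow> mor K g B A \<Longrightarrow> g \<bullet> f = Ident K A \<Longrightarrow> f \<bullet> g = Ident K B \<Longrightarrow> iso_arr K A B f"
  by (auto simp: iso_arr_def mor_def)

lemma iso_arr_id: "A \<in> Obj K \<Longrightarrow> iso_arr K A A (Ident K A)"
  using id_right mor_id by (blast intro: iso_arrI)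

lemma iso_arr_comp:
  assumes "iso_arr K A B f" "iso_arr K B C g" "A \<in> Obj K" "B \<in> Obj K" "C \<in> Obj K"
  shows "iso_arr K A C (g \<bullet> f)"
proof -
  obtain f' where f: "mor K f A B" "mor K f' B A" "f' \<bullet> f = Ident K A" "f \<bullet> f' = Ident K B"
    using iso_arrD assms by metis
  obtain g' where g: "mor K g B C" "mor K g' C B" "g' \<bullet> g = Ident K B" "g \<bullet> g' = Ident K C"
    using iso_arrD assms by metis
  show ?thesis
  proof (rule iso_arrI)
    show "mor K (g \<bullet> f) A C" "mor K (f' \<bullet> g') C A"
      using f g by (auto intro: mor_comp)
    have "(f' \<bullet> g') \<bullet> (g \<bullet> f) = f' \<bullet> ((g' \<bullet> g) \<bullet> f)"
      using assoc[OF mor_comp[OF f(1) g(1)] g(2) f(2)] assoc[OF f(1) g(1,2)] by simp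
    then show "(f' \<bullet> g') \<bullet> (g \<bullet> f) = Ident K A" using f g id_left[OF f(1)] by simp
    have "(g \<bullet> f) \<bullet> (f' \<bullet> g') = g \<bullet> ((f \<bullet> f') \<bullet> g')"
      using assoc[OF mor_comp[OF g(2) f(2)] f(1) g(1)] assoc[OF g(2) f(2,1)] by simp
    then show "(g \<bullet> f) \<bullet> (f' \<bullet> g') = Ident K C" using f g id_left[OF g(2)] by simp
  qed
qed

lemma seq_equiv_equiv: 
  assumes "A \<in> Obj K" "C \<in> Obj K"
  shows "equiv (complexes K A C) (seq_equiv K A C)"
proof (rule equivI)
  show "refl_on (complexes K A C) (seq_equiv K A C)"
  proof (rule refl_onI, clarify)
    fix B f g assume "(B, f, g) \<in> complexes K A C"
    then show "((B, f, g), B, f, g) \<in> seq_equiv K A C"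
      using iso_arr_id[of B] assms
      by (auto simp: seq_equiv_def complexes_def comp_ident_right comp_ident_left intro!: exI[of _ "Ident K B"])
  qed
  show "sym (seq_equiv K A C)"
  proof (rule symI, clarify)
    fix B f g B' f' g' assume *: "((B, f, g), B', f', g') \<in> seq_equiv K A C"
    then obtain b where b: "iso_arr K B B' b" "b \<bullet> f = f'" "g' \<bullet> b = g"
      and c: "(B, f, g) \<in> complexes K A C" "(B', f', g') \<in> complexes K A C"
      by (auto simp: seq_equiv_def)
    have m: "mor K f A B" "mor K g B C" "mor K f' A B'" "mor K g' B' C"
      using c assms by (auto simp: complexes_def mor_def)
    obtain b' where b': "mor K b B B'" "mor K b' B' B" "b' \<bullet> b = Ident K B" "b \<bullet> b' = Ident K B'"
      using iso_arrD b m by (metis mor_obj)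
    have "b' \<bullet> f' = f"
      using assoc[OF m(1) b'(1,2)] b b' m by (metis id_left)
    moreover have "g \<bullet> b' = g'"
      using assoc[OF b'(2,1) m(4)] b b' m by (metis id_right)
    moreover have "iso_arr K B' B b'" using b' by (blast intro: iso_arrI)
    ultimately show "((B', f', g'), B, f, g) \<in> seq_equiv K A C"
      using c by (auto simp: seq_equiv_def)
  qed
  show "trans (seq_equiv K A C)"
  proof (rule transI, clarify)
    fix B f g B' f' g' B'' f'' g''
    assume *: "((B, f, g), B', f', g') \<in> seq_equiv K A C"
      "((B', f', g'), B'', f'', g'') \<in> seq_equiv K A C"
    then obtain b b' where b: "iso_arr K B B' b" "b \<bullet> f = f'" "g' \<bullet> b = g"
      and b': "iso_arr K B' B'' b'" "b' \<bullet> f' = f''" "g'' \<bullet> b' = g'"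
      and c: "(B, f, g) \<in> complexes K A C" "(B', f', g') \<in> complexes K A C"
         "(B'', f'', g'') \<in> complexes K A C"
      by (auto simp: seq_equiv_def)
    have m: "mor K f A B" "mor K g'' B'' C" "mor K b B B'" "mor K b' B' B''"
      using c assms b b' by (auto simp: complexes_def mor_def iso_arr_def)
    have "iso_arr K B B'' (b' \<bullet> b)" using b b' m mor_obj iso_arr_comp by metis
    moreover have "(b' \<bullet> b) \<bullet> f = f''" "g'' \<bullet> (b' \<bullet> b) = g"
      using assoc[OF m(1,3,4)] assoc[OF m(3,4,2)] b b' by auto
    ultimately show "((B, f, g), B'', f'', g'') \<in> seq_equiv K A C"
      using c by (auto simp: seq_equiv_def)
  qed
  show "seq_equiv K A C \<subseteq> complexes K A C \<times> complexes K A C"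
    by (auto simp: seq_equiv_def)
qed

end

context bilinear_ext_functor
begin

lemma ext_group: "C \<in> Obj K \<Longrightarrow> A \<in> Obj K \<Longrightarrow> abelian_group (Ext K C A)"
  using ext_module module.axioms(2) by blast

lemma exten_zero: "C \<in> Obj K \<Longrightarrow> A \<in> Obj K \<Longrightarrow> exten K \<zero>\<^bsub>Ext K C A\<^esub> C A"
  by (simp add: exten_def abelian_groupE(2)[OF ext_group])

lemma exten_add: "exten K \<delta> C A \<Longrightarrow> exten K \<epsilon> C A \<Longrightarrow> exten K (\<delta> \<oplus>\<^bsub>Ext K C A\<^esub> \<epsilon>) C A"
  by (simp add: exten_def abelian_groupE(1)[OF ext_group])

lemma exten_minus: "exten K \<delta> C A \<Longrightarrow> exten K \<epsilon> C A \<Longrightarrow> exten K (\<delta> \<ominus>\<^bsub>Ext K C A\<^esub> \<epsilon>) C A"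
  by (simp add: exten_def abelian_group.minus_closed[OF ext_group])

lemma push_exten: "exten K \<delta> C A \<Longrightarrow> mor K a A A' \<Longrightarrow> exten K (ext_push K C a \<delta>) C A'"
  by (auto simp: exten_def mor_def ext_push_def intro: ext_map_closed ident_arr)

lemma pull_exten: "exten K \<delta> C A \<Longrightarrow> mor K c C' C \<Longrightarrow> exten K (ext_pull K A c \<delta>) C' A"
  by (auto simp: exten_def mor_def ext_pull_def intro: ext_map_closed ident_arr)

lemma push_id: "exten K \<delta> C A \<Longrightarrow> ext_push K C (Ident K A) \<delta> = \<delta>"
  and pull_id: "exten K \<delta> C A \<Longrightarrow> ext_pull K A (Ident K C) \<delta> = \<delta>"
  by (auto simp: exten_def ext_push_def ext_pull_def ext_map_ident)

lemma push_push:
  assumes "exten K \<delta> C A" "mor K a A A'" "mor K a' A' A''"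
  shows "ext_push K C a' (ext_push K C a \<delta>) = ext_push K C (a' \<bullet> a) \<delta>"
  using assms ext_map_comp[of C C C A A' A'' "Ident K C" "Ident K C" a a' \<delta>]
  by (auto simp: exten_def mor_def ext_push_def ident_arr comp_ident_left)

lemma pull_pull:
  assumes "exten K \<delta> C A" "mor K c C' C" "mor K c' C'' C'"
  shows "ext_pull K A c' (ext_pull K A c \<delta>) = ext_pull K A (c \<bullet> c') \<delta>"
  using assms ext_map_comp[of C C' C'' A A A c c' "Ident K A" "Ident K A" \<delta>]
  by (auto simp: exten_def mor_def ext_pull_def ident_arr comp_ident_left)

lemma push_pull:
  assumes "exten K \<delta> C A" "mor K a A A'" "mor K c C' C"
  shows "ext_push K C' a (ext_pull K A c \<delta>) = ext_pull K A' c (ext_push K C a \<delta>)"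
  using assms ext_map_comp[of C C' C' A A A' c "Ident K C'" "Ident K A" a \<delta>]
    ext_map_comp[of C C C' A A' A' "Ident K C" c a "Ident K A'" \<delta>]
  by (auto simp: exten_def mor_def ext_pull_def ext_push_def ident_arr comp_ident_left comp_ident_right)

lemma push_add:
  assumes "exten K \<delta> C A" "exten K \<epsilon> C A" "mor K a A A'"
  shows "ext_push K C a (\<delta> \<oplus>\<^bsub>Ext K C A\<^esub> \<epsilon>) = ext_push K C a \<delta> \<oplus>\<^bsub>Ext K C A'\<^esub> ext_push K C a \<epsilon>"
  using assms by (auto simp: exten_def mor_def ext_push_def intro: ext_map_add ident_arr)

lemma pull_add:
  assumes "exten K \<delta> C A" "exten K \<epsilon> C A" "mor K c C' C"
  shows "ext_pull K A c (\<delta> \<oplus>\<^bsub>Ext K C A\<^esub> \<epsilon>) = ext_pull K A c \<delta> \<oplus>\<^bsub>Ext K C' A\<^esub> ext_pull K A c \<epsilon>"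
  using assms by (auto simp: exten_def mor_def ext_pull_def intro: ext_map_add ident_arr)

lemma push_add_mor:
  assumes "exten K \<delta> C A" "mor K a A A'" "mor K b A A'"
  shows "ext_push K C (a \<oplus>\<^bsub>Hom K A A'\<^esub> b) \<delta> = ext_push K C a \<delta> \<oplus>\<^bsub>Ext K C A'\<^esub> ext_push K C b \<delta>"
  using assms by (auto simp: exten_def mor_def ext_push_def intro: ext_map_add_right ident_arr)

lemma pull_add_mor:
  assumes "exten K \<delta> C A" "mor K c C' C" "mor K d C' C"
  shows "ext_pull K A (c \<oplus>\<^bsub>Hom K C' C\<^esub> d) \<delta> = ext_pull K A c \<delta> \<oplus>\<^bsub>Ext K C' A\<^esub> ext_pull K A d \<delta>"
  using assms by (auto simp: exten_def mor_def ext_pull_def intro: ext_map_add_left ident_arr)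

lemma push_smult_mor:
  assumes "exten K \<delta> C A" "mor K a A A'" "r \<in> carrier R"
  shows "ext_push K C (r \<odot>\<^bsub>Hom K A A'\<^esub> a) \<delta> = r \<odot>\<^bsub>Ext K C A'\<^esub> ext_push K C a \<delta>"
  using assms by (auto simp: exten_def mor_def ext_push_def intro: ext_map_smult_right ident_arr)

lemma pull_smult_mor:
  assumes "exten K \<delta> C A" "mor K c C' C" "r \<in> carrier R"
  shows "ext_pull K A (r \<odot>\<^bsub>Hom K C' C\<^esub> c) \<delta> = r \<odot>\<^bsub>Ext K C' A\<^esub> ext_pull K A c \<delta>"
  using assms by (auto simp: exten_def mor_def ext_pull_def intro: ext_map_smult_left ident_arr)

lemma pull_smult:
  assumes "exten K \<delta> C A" "mor K c C' C" "r \<in> carrier R"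
  shows "ext_pull K A c (r \<odot>\<^bsub>Ext K C A\<^esub> \<delta>) = r \<odot>\<^bsub>Ext K C' A\<^esub> ext_pull K A c \<delta>"
  using assms by (auto simp: exten_def mor_def ext_pull_def intro: ext_map_smult ident_arr)

lemma push_zero:
  assumes "C \<in> Obj K" "mor K a A A'"
  shows "ext_push K C a \<zero>\<^bsub>Ext K C A\<^esub> = \<zero>\<^bsub>Ext K C A'\<^esub>"
  using assms push_exten[of _ C A a A'] push_add[of _ C A _ a A']
  by (intro additive_map(1)) (auto simp: mor_def exten_def ext_group)

lemma pull_zero:
  assumes "A \<in> Obj K" "mor K c C' C"
  shows "ext_pull K A c \<zero>\<^bsub>Ext K C A\<^esub> = \<zero>\<^bsub>Ext K C' A\<^esub>"
  using assms pull_exten[of _ C A c C'] pull_add[of _ C A _ c C']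
  by (intro additive_map(1)) (auto simp: mor_def exten_def ext_group)

lemma pull_diff:
  assumes "exten K \<delta> C A" "exten K \<epsilon> C A" "mor K c C' C"
  shows "ext_pull K A c (\<delta> \<ominus>\<^bsub>Ext K C A\<^esub> \<epsilon>) = ext_pull K A c \<delta> \<ominus>\<^bsub>Ext K C' A\<^esub> ext_pull K A c \<epsilon>"
  using assms pull_exten[of _ C A c C'] pull_add[of _ C A _ c C']
  by (intro additive_map(2)[where G = "Ext K C A"]) (auto simp: mor_def exten_def ext_group)

lemma push_zero_mor:
  assumes "exten K \<delta> C A" "A' \<in> Obj K"
  shows "ext_push K C \<zero>\<^bsub>Hom K A A'\<^esub> \<delta> = \<zero>\<^bsub>Ext K C A'\<^esub>"
  using assms push_exten[of \<delta> C A _ A'] push_add_mor[of \<delta> C A _ A']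
  by (intro additive_map(1)[where h = "\<lambda>a. ext_push K C a \<delta>"])
     (auto simp: mor_def exten_def ext_group hom_group)

lemma push_diff_mor:
  assumes "exten K \<delta> C A" "mor K a A A'" "mor K b A A'"
  shows "ext_push K C (a \<ominus>\<^bsub>Hom K A A'\<^esub> b) \<delta> = ext_push K C a \<delta> \<ominus>\<^bsub>Ext K C A'\<^esub> ext_push K C b \<delta>"
  using assms push_exten[of \<delta> C A _ A'] push_add_mor[of \<delta> C A _ A']
  by (intro additive_map(2)[where h = "\<lambda>a. ext_push K C a \<delta>" and G = "Hom K A A'"])
     (auto simp: mor_def exten_def ext_group hom_group)

lemma pull_diff_mor:
  assumes "exten K \<delta> C A" "mor K c C' C" "mor K d C' C"
  shows "ext_pull K A (c \<ominus>\<^bsub>Hom K C' C\<^esub> d) \<delta> = ext_pull K A c \<delta> \<ominus>\<^bsub>Ext K C' A\<^esub> ext_pull K A d \<delta>"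
  using assms pull_exten[of \<delta> C A _ C'] pull_add_mor[of \<delta> C A _ C']
  by (intro additive_map(2)[where h = "\<lambda>a. ext_pull K A a \<delta>" and G = "Hom K C' C"])
     (auto simp: mor_def exten_def ext_group hom_group)

lemma pull_zero_mor:
  assumes "exten K \<delta> C A" "C' \<in> Obj K"
  shows "ext_pull K A \<zero>\<^bsub>Hom K C' C\<^esub> \<delta> = \<zero>\<^bsub>Ext K C' A\<^esub>"
  using assms pull_exten[of \<delta> C A _ C'] pull_add_mor[of \<delta> C A _ C']
  by (intro additive_map(1)[where h = "\<lambda>c. ext_pull K A c \<delta>"])
     (auto simp: mor_def exten_def ext_group hom_group)

lemma exten_diff_zero:
  assumes "exten K \<delta> C A" "exten K \<epsilon> C A" 
  shows "\<delta> \<ominus>\<^bsub>Ext K C A\<^esub> \<epsilon> = \<zero>\<^bsub>Ext K C A\<^esub> \<longleftrightarrow> \<delta> = \<epsilon>"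
proof -
  interpret abelian_group "Ext K C A" using assms by (auto simp: exten_def ext_group)
  show ?thesis using assms minus_equality[of \<delta> "\<ominus>\<^bsub>Ext K C A\<^esub> \<epsilon>"]
    by (auto simp: exten_def a_minus_def r_neg)
qed

end

section \<open>Realizations and duality\<close>

context extriangulated_category
begin

lemma realizesD:
  assumes "realizes K A f B g C \<delta>"
  shows "mor K f A B" "mor K g B C" "exten K \<delta> C A" "g \<bullet> f = \<zero>\<^bsub>Hom K A C\<^esub>"
  using assms by (auto simp: realizes_def mor_def exten_def complexes_def)

text \<open>Equivalence classes are disjoint, so one representative determines the whole class \<open>\<s>(\<delta>)\<close>.\<close>

lemma realizes_iff:
  assumes "exten K \<delta> C A"
  shows "realizes K A f B g C \<delta> \<longleftrightarrow> (B, f, g) \<in> Real K C A \<delta>"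
proof -
  have o: "C \<in> Obj K" "A \<in> Obj K" "\<delta> \<in> carrier (Ext K C A)" using assms by (auto simp: exten_def)
  note e = seq_equiv_equiv[OF o(2,1)] and r = real_class[OF o]
  show ?thesis
  proof
    assume l: "realizes K A f B g C \<delta>"
    then show "(B, f, g) \<in> Real K C A \<delta>"
      using equiv_class_self[OF e, of "(B, f, g)"] by (simp add: realizes_def)
  next
    assume *: "(B, f, g) \<in> Real K C A \<delta>"
    obtain x where x: "x \<in> complexes K A C" "Real K C A \<delta> = seq_equiv K A C `` {x}"
      using r by (rule quotientE)
    have xs: "(x, B, f, g) \<in> seq_equiv K A C" using * x(2) by blast
    then have "(B, f, g) \<in> complexes K A C" by (auto simp: seq_equiv_def)
    then show "realizes K A f B g C \<delta>"
      using o x(2) equiv_class_eq[OF e xs] by (simp add: realizes_def)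
  qed
qed

lemma realization_exists:
  assumes "exten K \<delta> C A"
  obtains f B g where "realizes K A f B g C \<delta>"
proof -
  have o: "C \<in> Obj K" "A \<in> Obj K" "\<delta> \<in> carrier (Ext K C A)" using assms by (auto simp: exten_def)
  have "Real K C A \<delta> \<noteq> {}"
    using in_quotient_imp_non_empty[OF seq_equiv_equiv[OF o(2,1)] real_class[OF o]] .
  then show ?thesis using that realizes_iff[OF assms] by auto
qed

lemma realizes_iso:
  assumes "realizes K A f B g C \<delta>" "realizes K A f' B' g' C \<delta>"
  obtains b b' where "mor K b B B'" "mor K b' B' B" "b' \<bullet> b = Ident K B" "b \<bullet> b' = Ident K B'"
    "b \<bullet> f = f'" "g' \<bullet> b = g" "b' \<bullet> f' = f" "g \<bullet> b' = g'"
proof -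
  note d = realizesD[OF assms(1)] and d' = realizesD[OF assms(2)]
  have "(B', f', g') \<in> seq_equiv K A C `` {(B, f, g)}"
    using assms realizes_iff[OF d(3)] by (metis realizes_def)
  then obtain b where b: "iso_arr K B B' b" "b \<bullet> f = f'" "g' \<bullet> b = g"
    by (auto simp: seq_equiv_def)
  then obtain b' where b': "mor K b B B'" "mor K b' B' B" "b' \<bullet> b = Ident K B" "b \<bullet> b' = Ident K B'"
    using iso_arrD d d' mor_obj by metis
  have "b' \<bullet> f' = f" using assoc[OF d(1) b'(1,2)] b b' d by (metis id_left)
  moreover have "g \<bullet> b' = g'" using assoc[OF b'(2,1) d'(2)] b b' d' by (metis id_right)
  ultimately show ?thesis using that b b' by blast
qed

lemma fill_middle:
  assumes "realizes K A f B g C \<delta>" "realizes K A' f' B' g' C' \<delta>'"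
    "mor K a A A'" "mor K c C C'" "ext_push K C a \<delta> = ext_pull K A' c \<delta>'"
  obtains b where "mor K b B B'" "b \<bullet> f = f' \<bullet> a" "g' \<bullet> b = c \<bullet> g"
  using real_morphism[OF assms(1,2) _ _ assms(5)] assms realizesD[OF assms(1)] realizesD[OF assms(2)]
  by (auto simp: mor_def)

lemma fill_right:
  assumes "realizes K A f B g C \<delta>" "realizes K A' f' B' g' C' \<delta>'"
    "mor K a A A'" "mor K b B B'" "b \<bullet> f = f' \<bullet> a"
  obtains c where "mor K c C C'" "c \<bullet> g = g' \<bullet> b" "ext_push K C a \<delta> = ext_pull K A' c \<delta>'"
  using ET3[OF assms(1,2) _ _ assms(5)] assms realizesD[OF assms(1)] realizesD[OF assms(2)]
  by (auto simp: mor_def)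

lemma ET4_mor:
  assumes "realizes K A f B f' D \<delta>" "realizes K B g C g' F \<delta>'"
  obtains E h d e \<delta>'' where "mor K h C E" "mor K d D E" "mor K e E F"
    "realizes K A (g \<bullet> f) C h E \<delta>''" "h \<bullet> g = d \<bullet> f'" "e \<bullet> h = g'"
    "realizes K D d E e F (ext_push K F f' \<delta>')" "ext_pull K A d \<delta>'' = \<delta>"
    "ext_push K E f \<delta>'' = ext_pull K B e \<delta>'"
  using ET4[OF assms] realizesD[OF assms(1)] realizesD[OF assms(2)]
  by (metis mor_def)

end

text \<open>The axioms of an extriangulated category are self-dual. A statement about \<open>K\<close> applied to the
  opposite category yields the dual statement about \<open>K\<close>, with inflations and deflations, push-forward
  and pull-back, and the two sides of a cotorsion pair exchanged.\<close>

definition op_cat :: "('r, 'o, 'm, 'e) ext_cat \<Rightarrow> ('r, 'o, 'm, 'e) ext_cat"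
  where "op_cat K = \<lparr>Obj = Obj K, Hom = (\<lambda>A B. Hom K B A), Comp = (\<lambda>g f. f \<bullet>\<^bsub>K\<^esub> g), Ident = Ident K,
    Ext = (\<lambda>C A. Ext K A C), ExtMap = (\<lambda>c a. ExtMap K a c),
    Real = (\<lambda>C A \<delta>. {(B, f, g). (B, g, f) \<in> Real K A C \<delta>})\<rparr>"

lemma op_cat_simps:
  "Obj (op_cat K) = Obj K" "Hom (op_cat K) A B = Hom K B A" "g \<bullet>\<^bsub>op_cat K\<^esub> f = f \<bullet>\<^bsub>K\<^esub> g"
  "Ident (op_cat K) = Ident K" "Ext (op_cat K) C A = Ext K A C" "ExtMap (op_cat K) c a = ExtMap K a c"
  "Real (op_cat K) C A \<delta> = {(B, f, g). (B, g, f) \<in> Real K A C \<delta>}"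
  by (simp_all add: op_cat_def)

lemma op_push_pull: "ext_push (op_cat K) C a \<delta> = ext_pull K C a \<delta>"
  "ext_pull (op_cat K) A c \<delta> = ext_push K A c \<delta>"
  by (simp_all add: ext_push_def ext_pull_def op_cat_simps)

lemma op_mor: "mor (op_cat K) f A B = mor K f B A" "exten (op_cat K) \<delta> C A = exten K \<delta> A C"
  by (auto simp: mor_def exten_def op_cat_simps)

lemma op_biproduct: "biproduct (op_cat K) A B S i j p q = biproduct K A B S p q i j"
  by (auto simp: biproduct_def op_cat_simps)

lemma op_zero_object: "zero_object (op_cat K) Z = zero_object K Z"
  by (auto simp: zero_object_def op_cat_simps)

lemma op_complexes: "(B, f, g) \<in> complexes (op_cat K) A C \<longleftrightarrow> (B, g, f) \<in> complexes K C A"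
  by (auto simp: complexes_def op_cat_simps)

lemma op_iso_arr: 
  assumes "A \<in> Obj K" "B \<in> Obj K" shows "iso_arr (op_cat K) A B f = iso_arr K B A f"
  using assms by (auto simp: iso_arr_def op_cat_simps)

lemma (in linear_category) op_seq_equiv:
  assumes "A \<in> Obj K" "C \<in> Obj K"
  shows "((B, f, g), (B', f', g')) \<in> seq_equiv (op_cat K) A C \<longleftrightarrow>
    ((B, g, f), (B', g', f')) \<in> seq_equiv K C A"
proof -
  have "((B, f, g), (B', f', g')) \<in> seq_equiv (op_cat K) A C \<longleftrightarrow> 
    ((B', g', f'), (B, g, f)) \<in> seq_equiv K C A"
    by (auto simp: seq_equiv_def op_complexes op_iso_arr op_cat_simps)
       (auto simp: complexes_def op_cat_simps op_iso_arr)
  then show ?thesis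
    using seq_equiv_equiv[OF assms(2,1)] by (meson equiv_def symE)
qed

context extriangulated_category
begin

lemma op_realizes: "realizes (op_cat K) C g B f A \<delta> = realizes K A f B g C \<delta>"
proof -
  let ?sw = "\<lambda>(B, f, g). (B, g, f)"
  have "Real (op_cat K) A C \<delta> = ?sw ` Real K C A \<delta>"
    by (force simp: op_cat_simps)
  moreover have "seq_equiv (op_cat K) C A `` {(B, g, f)} = ?sw ` (seq_equiv K A C `` {(B, f, g)})"
    if "A \<in> Obj K" "C \<in> Obj K"
    using that by (force simp: op_seq_equiv image_iff)
  moreover have "?sw ` X = ?sw ` Y \<longleftrightarrow> X = Y" for X Y :: "('o \<times> 'm \<times> 'm) set"
    by (rule inj_image_eq_iff) (auto intro: injI)
  ultimately have "Real (op_cat K) A C \<delta> = seq_equiv (op_cat K) C A `` {(B, g, f)} \<longleftrightarrow>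
     Real K C A \<delta> = seq_equiv K A C `` {(B, f, g)}" if "A \<in> Obj K" "C \<in> Obj K"
    using that by simp
  then show ?thesis
    by (auto simp: realizes_def op_complexes op_cat_simps(1,5))
qed

text \<open>Additivity of \<open>\<s>\<close> in the opposite category differs from that in \<open>K\<close> by the bracketing of
  the triple composites.\<close>

lemma realizes_sum_op:
  assumes "realizes (op_cat K) A f B g C \<delta>" "realizes (op_cat K) A' f' B' g' C' \<delta>'"
    "biproduct (op_cat K) A A' AA iA iA' pA pA'" "biproduct (op_cat K) B B' BB iB iB' pB pB'"
    "biproduct (op_cat K) C C' CC iC iC' pC pC'"
  shows "realizes (op_cat K) AA
     ((iB \<bullet>\<^bsub>op_cat K\<^esub> f \<bullet>\<^bsub>op_cat K\<^esub> pA) \<oplus>\<^bsub>Hom (op_cat K) AA BB\<^esub> (iB' \<bullet>\<^bsub>op_cat K\<^esub> f' \<bullet>\<^bsub>op_cat K\<^esub> pA'))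
     BB ((iC \<bullet>\<^bsub>op_cat K\<^esub> g \<bullet>\<^bsub>op_cat K\<^esub> pB) \<oplus>\<^bsub>Hom (op_cat K) BB CC\<^esub> (iC' \<bullet>\<^bsub>op_cat K\<^esub> g' \<bullet>\<^bsub>op_cat K\<^esub> pB'))
     CC (ExtMap (op_cat K) pC iA \<delta> \<oplus>\<^bsub>Ext (op_cat K) CC AA\<^esub> ExtMap (op_cat K) pC' iA' \<delta>')"
proof -
  note r = assms(1,2)[unfolded op_realizes] and b = assms(3-5)[unfolded op_biproduct]
  note d = realizesD[OF r(1)] realizesD[OF r(2)]
  have m: "mor K iC CC C" "mor K pB B BB" "mor K iB BB B" "mor K pA A AA"
     "mor K iC' CC C'" "mor K pB' B' BB" "mor K iB' BB B'" "mor K pA' A' AA"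
    using b by (auto simp: biproduct_def mor_def)
  have "pB \<bullet> (g \<bullet> iC) = (pB \<bullet> g) \<bullet> iC" "pB' \<bullet> (g' \<bullet> iC') = (pB' \<bullet> g') \<bullet> iC'"
    "pA \<bullet> (f \<bullet> iB) = (pA \<bullet> f) \<bullet> iB" "pA' \<bullet> (f' \<bullet> iB') = (pA' \<bullet> f') \<bullet> iB'"
    using assoc[OF m(1) d(1) m(2)] assoc[OF m(5) d(5) m(6)] assoc[OF m(3) d(2) m(4)] 
      assoc[OF m(7) d(6) m(8)] by simp_all
  with real_sum[OF r b(3,2,1)] show ?thesis
    unfolding op_realizes op_cat_simps by simp
qed

lemma extriangulated_op: "extriangulated_category R (op_cat K)"
proof (intro extriangulated_category.intro bilinear_ext_functor.intro additive_category.intro)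
  show "linear_category R (op_cat K)"
    by (unfold linear_category_def op_cat_simps, intro conjI allI impI)
       (rule ring_R hom_module ident_arr comp_arr comp_ident_right comp_ident_left comp_assoc[symmetric]
         comp_add_right comp_add_left comp_smult_right comp_smult_left; assumption)+
  show "additive_category_axioms (op_cat K)"
  proof
    show "\<exists>Z. zero_object (op_cat K) Z" using zero_object_exists by (simp add: op_zero_object)
    show "A \<in> Obj (op_cat K) \<Longrightarrow> B \<in> Obj (op_cat K) \<Longrightarrow> \<exists>S i j p q. biproduct (op_cat K) A B S i j p q" for A B
      using biproduct_exists[of A B] by (simp add: op_biproduct op_cat_simps) blast
  qed
  show "bilinear_ext_functor_axioms R (op_cat K)"
    by (unfold bilinear_ext_functor_axioms_def op_cat_simps, intro conjI allI impI)
       (rule ext_module ext_map_closed ext_map_add ext_map_smult ext_map_ident ext_map_comp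
         ext_map_add_left ext_map_smult_left ext_map_add_right ext_map_smult_right; assumption)+
  show "extriangulated_category_axioms (op_cat K)"
  proof
    show "Real (op_cat K) C A \<delta> \<in> complexes (op_cat K) A C // seq_equiv (op_cat K) A C"
      if "C \<in> Obj (op_cat K)" "A \<in> Obj (op_cat K)" "\<delta> \<in> carrier (Ext (op_cat K) C A)" for A C \<delta>
    proof -
      have e: "exten K \<delta> A C" using that by (simp add: exten_def op_cat_simps)
      obtain f B g where "realizes K C f B g A \<delta>" by (rule realization_exists[OF e])
      then have "realizes (op_cat K) A g B f C \<delta>" by (simp add: op_realizes)
      then show ?thesis unfolding realizes_def by (auto intro: quotientI)
    qed
    show "biproduct (op_cat K) A C S i j p q \<Longrightarrow> realizes (op_cat K) A i S q C \<zero>\<^bsub>Ext (op_cat K) C A\<^esub>" for A C S i j p q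
    proof -
      assume "biproduct (op_cat K) A C S i j p q"
      then have "biproduct K C A S q p j i" 
        unfolding op_biproduct
        by (auto simp: biproduct_def abelian_groupE(4)[OF hom_group] comp_arr)
      then show "realizes (op_cat K) A i S q C \<zero>\<^bsub>Ext (op_cat K) C A\<^esub>"
        unfolding op_realizes op_cat_simps by (rule real_zero)
    qed
  next
    fix A f B g C \<delta> A' f' B' g' C' \<delta>' a c
    assume "realizes (op_cat K) A f B g C \<delta>" "realizes (op_cat K) A' f' B' g' C' \<delta>'"
      "a \<in> arr (op_cat K) A A'" "c \<in> arr (op_cat K) C C'"
      "ext_push (op_cat K) C a \<delta> = ext_pull (op_cat K) A' c \<delta>'"
    then show "\<exists>b\<in>arr (op_cat K) B B'. b \<bullet>\<^bsub>op_cat K\<^esub> f = f' \<bullet>\<^bsub>op_cat K\<^esub> a \<and> g' \<bullet>\<^bsub>op_cat K\<^esub> b = c \<bullet>\<^bsub>op_cat K\<^esub> g"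
      using real_morphism[of C' g' B' f' A' \<delta>' C g B f A \<delta> c a]
      unfolding op_realizes op_cat_simps op_push_pull by metis
  next
    fix A f B g C \<delta> A' f' B' g' C' \<delta>' a b
    assume "realizes (op_cat K) A f B g C \<delta>" "realizes (op_cat K) A' f' B' g' C' \<delta>'"
      "a \<in> arr (op_cat K) A A'" "b \<in> arr (op_cat K) B B'" "b \<bullet>\<^bsub>op_cat K\<^esub> f = f' \<bullet>\<^bsub>op_cat K\<^esub> a"
    then show "\<exists>c\<in>arr (op_cat K) C C'. c \<bullet>\<^bsub>op_cat K\<^esub> g = g' \<bullet>\<^bsub>op_cat K\<^esub> b \<and>
      ext_push (op_cat K) C a \<delta> = ext_pull (op_cat K) A' c \<delta>'"
      using ET3_op[of C' g' B' f' A' \<delta>' C g B f A \<delta> b a]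
      unfolding op_realizes op_cat_simps op_push_pull by metis
  next
    fix A f B g C \<delta> A' f' B' g' C' \<delta>' b c
    assume "realizes (op_cat K) A f B g C \<delta>" "realizes (op_cat K) A' f' B' g' C' \<delta>'"
      "b \<in> arr (op_cat K) B B'" "c \<in> arr (op_cat K) C C'" "c \<bullet>\<^bsub>op_cat K\<^esub> g = g' \<bullet>\<^bsub>op_cat K\<^esub> b"
    then show "\<exists>a\<in>arr (op_cat K) A A'. b \<bullet>\<^bsub>op_cat K\<^esub> f = f' \<bullet>\<^bsub>op_cat K\<^esub> a \<and>
      ext_push (op_cat K) C a \<delta> = ext_pull (op_cat K) A' c \<delta>'"
      using ET3[of C' g' B' f' A' \<delta>' C g B f A \<delta> c b]
      unfolding op_realizes op_cat_simps op_push_pull by metis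
  next
    fix A f B f' D \<delta> g C g' F \<delta>'
    assume "realizes (op_cat K) A f B f' D \<delta>" "realizes (op_cat K) B g C g' F \<delta>'"
    then show "\<exists>E\<in>Obj (op_cat K). \<exists>h\<in>arr (op_cat K) C E. \<exists>d\<in>arr (op_cat K) D E. \<exists>e\<in>arr (op_cat K) E F.
      \<exists>\<delta>''\<in>carrier (Ext (op_cat K) E A).
      realizes (op_cat K) A (g \<bullet>\<^bsub>op_cat K\<^esub> f) C h E \<delta>'' \<and>
      h \<bullet>\<^bsub>op_cat K\<^esub> g = d \<bullet>\<^bsub>op_cat K\<^esub> f' \<and> e \<bullet>\<^bsub>op_cat K\<^esub> h = g' \<and>
      realizes (op_cat K) D d E e F (ext_push (op_cat K) F f' \<delta>') \<and>
      ext_pull (op_cat K) A d \<delta>'' = \<delta> \<and> ext_push (op_cat K) E f \<delta>'' = ext_pull (op_cat K) B e \<delta>'"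
      using ET4_op[of D f' B f A \<delta> F g' C g \<delta>']
      unfolding op_realizes op_cat_simps op_push_pull by metis
  next
    fix D f' B f A \<delta> F g' C g \<delta>'
    assume "realizes (op_cat K) D f' B f A \<delta>" "realizes (op_cat K) F g' C g B \<delta>'"
    then show "\<exists>E\<in>Obj (op_cat K). \<exists>h\<in>arr (op_cat K) E C. \<exists>d\<in>arr (op_cat K) E D. \<exists>e\<in>arr (op_cat K) F E.
      \<exists>\<delta>''\<in>carrier (Ext (op_cat K) A E).
      realizes (op_cat K) E h C (f \<bullet>\<^bsub>op_cat K\<^esub> g) A \<delta>'' \<and>
      g \<bullet>\<^bsub>op_cat K\<^esub> h = f' \<bullet>\<^bsub>op_cat K\<^esub> d \<and> h \<bullet>\<^bsub>op_cat K\<^esub> e = g' \<and>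
      realizes (op_cat K) F e E d D (ext_pull (op_cat K) F f' \<delta>') \<and>
      ext_push (op_cat K) A d \<delta>'' = \<delta> \<and> ext_pull (op_cat K) E f \<delta>'' = ext_push (op_cat K) B e \<delta>'"
      using ET4[of A f B f' D \<delta> g C g' F \<delta>']
      unfolding op_realizes op_cat_simps op_push_pull by metis
  qed (rule realizes_sum_op)
qed

end

section \<open>Exact sequences of a conflation\<close>

context linear_category
begin

lemma diff_right:
  assumes "mor K f A B" "mor K f' A B" "mor K g B C"
  shows "g \<bullet> (f \<ominus>\<^bsub>Hom K A B\<^esub> f') = (g \<bullet> f) \<ominus>\<^bsub>Hom K A C\<^esub> (g \<bullet> f')"
  using assms by (intro additive_map(2)[where h = "\<lambda>f. g \<bullet> f"])
    (auto simp: mor_def intro: hom_group comp_arr comp_add_right)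

lemma biproductD:
  assumes "biproduct K A B S i j p q"
  shows "mor K i A S" "mor K j B S" "mor K p S A" "mor K q S B"
    "p \<bullet> i = Ident K A" "q \<bullet> j = Ident K B" "q \<bullet> i = \<zero>\<^bsub>Hom K A B\<^esub>" "p \<bullet> j = \<zero>\<^bsub>Hom K B A\<^esub>"
    "(i \<bullet> p) \<oplus>\<^bsub>Hom K S S\<^esub> (j \<bullet> q) = Ident K S"
  using assms by (auto simp: biproduct_def mor_def)

lemma biproductI:
  assumes "mor K i A S" "mor K j B S" "mor K p S A" "mor K q S B"
    "p \<bullet> i = Ident K A" "q \<bullet> j = Ident K B" "q \<bullet> i = \<zero>\<^bsub>Hom K A B\<^esub>" "p \<bullet> j = \<zero>\<^bsub>Hom K B A\<^esub>"
    "(i \<bullet> p) \<oplus>\<^bsub>Hom K S S\<^esub> (j \<bullet> q) = Ident K S"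
  shows "biproduct K A B S i j p q"
  using assms by (auto simp: biproduct_def mor_def)

lemma biproduct_swap: 
  assumes "biproduct K A B S i j p q" shows "biproduct K B A S j i q p"
proof -
  note b = biproductD[OF assms]
  interpret abelian_group "Hom K S S" using b(3) by (simp add: mor_def hom_group)
  have "j \<bullet> q \<oplus>\<^bsub>Hom K S S\<^esub> i \<bullet> p = i \<bullet> p \<oplus>\<^bsub>Hom K S S\<^esub> j \<bullet> q"
    by (rule a_comm) (use mor_comp[OF b(3,1)] mor_comp[OF b(4,2)] in \<open>simp_all add: mor_def\<close>)
  with b(9) show ?thesis by (intro biproductI b(1-8)) simp
qed

lemma biproduct_zero_right:
  assumes "zero_object K Z" "B \<in> Obj K"
  shows "biproduct K B Z B (Ident K B) \<zero>\<^bsub>Hom K Z B\<^esub> (Ident K B) \<zero>\<^bsub>Hom K B Z\<^esub>"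
proof (rule biproductI)
  have Z: "Z \<in> Obj K" using assms by (simp add: zero_object_def)
  show m: "mor K (Ident K B) B B" "mor K (Ident K B) B B" "mor K \<zero>\<^bsub>Hom K Z B\<^esub> Z B"
    "mor K \<zero>\<^bsub>Hom K B Z\<^esub> B Z"
    using assms Z by (auto intro: mor_id mor_zero)
  show "\<zero>\<^bsub>Hom K B Z\<^esub> \<bullet> \<zero>\<^bsub>Hom K Z B\<^esub> = Ident K Z"
    using assms(1) Z mor_comp[OF m(3,4)] mor_id[OF Z] by (auto simp: zero_object_def mor_def)
  show "Ident K B \<bullet> Ident K B = Ident K B" "\<zero>\<^bsub>Hom K B Z\<^esub> \<bullet> Ident K B = \<zero>\<^bsub>Hom K B Z\<^esub>"
    "Ident K B \<bullet> \<zero>\<^bsub>Hom K Z B\<^esub> = \<zero>\<^bsub>Hom K Z B\<^esub>"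
    using m id_right id_left by blast+
  interpret abelian_group "Hom K B B" using assms hom_group by blast
  show "Ident K B \<bullet> Ident K B \<oplus>\<^bsub>Hom K B B\<^esub> \<zero>\<^bsub>Hom K Z B\<^esub> \<bullet> \<zero>\<^bsub>Hom K B Z\<^esub> = Ident K B"
    using m id_right[OF m(1)] comp_zero_left[OF _ m(4), of B] assms by (simp add: mor_def)
qed

text \<open>Shearing a biproduct by a morphism \<open>x\<close> between its summands: this changes a retraction
  \<open>p\<close> of \<open>i\<close> into any other one.\<close>

lemma biproduct_shear:
  assumes "biproduct K A B S i j p q" and x: "mor K x B A"
  shows "biproduct K A B S i (j \<oplus>\<^bsub>Hom K B S\<^esub> i \<bullet> x) (p \<ominus>\<^bsub>Hom K S A\<^esub> x \<bullet> q) q"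
proof (rule biproductI)
  note b = biproductD[OF assms(1)]
  have o: "A \<in> Obj K" "B \<in> Obj K" "S \<in> Obj K" using b(1,2) by (simp_all add: mor_def)
  note ix = mor_comp[OF x b(1)] and xq = mor_comp[OF b(4) x]
  show j: "mor K (j \<oplus>\<^bsub>Hom K B S\<^esub> i \<bullet> x) B S" using b ix by (intro mor_add)
  show p: "mor K (p \<ominus>\<^bsub>Hom K S A\<^esub> x \<bullet> q) S A" using b xq by (intro mor_minus)
  show "mor K i A S" "mor K q S B" "q \<bullet> i = \<zero>\<^bsub>Hom K A B\<^esub>" by (rule b)+
  interpret AA: abelian_group "Hom K A A" using o by (simp add: hom_group)
  interpret BB: abelian_group "Hom K B B" using o by (simp add: hom_group)
  interpret BA: abelian_group "Hom K B A" using o by (simp add: hom_group)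
  interpret SS: abelian_group "Hom K S S" using o by (simp add: hom_group)
  have "(p \<ominus>\<^bsub>Hom K S A\<^esub> x \<bullet> q) \<bullet> i = Ident K A \<ominus>\<^bsub>Hom K A A\<^esub> \<zero>\<^bsub>Hom K A A\<^esub>"
    using diff_left[OF b(1,3) xq] assoc[OF b(1,4) x] comp_zero_right[OF o(1) x] b by simp
  then show "(p \<ominus>\<^bsub>Hom K S A\<^esub> x \<bullet> q) \<bullet> i = Ident K A"
    using mor_id[OF o(1)] by (simp add: a_minus_def mor_def)
  have "q \<bullet> (j \<oplus>\<^bsub>Hom K B S\<^esub> i \<bullet> x) = Ident K B \<oplus>\<^bsub>Hom K B B\<^esub> \<zero>\<^bsub>Hom K B B\<^esub>"
    using distrib_right[OF b(2) ix b(4)] assoc[OF x b(1,4)] comp_zero_left[OF o(2) x] b by simp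
  then show qj: "q \<bullet> (j \<oplus>\<^bsub>Hom K B S\<^esub> i \<bullet> x) = Ident K B"
    using mor_id[OF o(2)] by (simp add: mor_def)
  have "p \<bullet> (j \<oplus>\<^bsub>Hom K B S\<^esub> i \<bullet> x) = \<zero>\<^bsub>Hom K B A\<^esub> \<oplus>\<^bsub>Hom K B A\<^esub> x"
    using distrib_right[OF b(2) ix b(3)] assoc[OF x b(1,3)] b id_left[OF x] by simp
  then have pj: "p \<bullet> (j \<oplus>\<^bsub>Hom K B S\<^esub> i \<bullet> x) = x" using x by (simp add: mor_def)
  then show "(p \<ominus>\<^bsub>Hom K S A\<^esub> x \<bullet> q) \<bullet> (j \<oplus>\<^bsub>Hom K B S\<^esub> i \<bullet> x) = \<zero>\<^bsub>Hom K B A\<^esub>"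
    using diff_left[OF j b(3) xq] assoc[OF j b(4) x] qj id_right[OF x] x
    by (simp add: mor_def a_minus_def BA.r_neg)
  have "i \<bullet> (p \<ominus>\<^bsub>Hom K S A\<^esub> x \<bullet> q) \<oplus>\<^bsub>Hom K S S\<^esub> (j \<oplus>\<^bsub>Hom K B S\<^esub> i \<bullet> x) \<bullet> q
     = (i \<bullet> p \<ominus>\<^bsub>Hom K S S\<^esub> i \<bullet> (x \<bullet> q)) \<oplus>\<^bsub>Hom K S S\<^esub> (j \<bullet> q \<oplus>\<^bsub>Hom K S S\<^esub> i \<bullet> (x \<bullet> q))"
    using diff_right[OF b(3) xq b(1)] distrib_left[OF b(4,2) ix] assoc[OF b(4) x b(1)] by simp
  also have "\<dots> = i \<bullet> p \<oplus>\<^bsub>Hom K S S\<^esub> j \<bullet> q"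
    using mor_comp[OF b(3,1)] mor_comp[OF b(4,2)] mor_comp[OF xq b(1)]
    by (simp add: mor_def a_minus_def SS.a_ac SS.r_neg SS.r_neg2)
  finally show "i \<bullet> (p \<ominus>\<^bsub>Hom K S A\<^esub> x \<bullet> q) \<oplus>\<^bsub>Hom K S S\<^esub> (j \<oplus>\<^bsub>Hom K B S\<^esub> i \<bullet> x) \<bullet> q = Ident K S"
    using b by simp
qed

end

context extriangulated_category
begin

lemmas op_unfold = op_realizes op_mor op_push_pull op_cat_simps op_biproduct

lemma ET4_op_mor:
  assumes "realizes K D f' B f A \<delta>" "realizes K F g' C g B \<delta>'"
  obtains E h d e \<delta>'' where "mor K h E C" "mor K d E D" "mor K e F E"
    "realizes K E h C (f \<bullet> g) A \<delta>''" "g \<bullet> h = f' \<bullet> d" "h \<bullet> e = g'"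
    "realizes K F e E d D (ext_pull K F f' \<delta>')" "ext_push K A d \<delta>'' = \<delta>"
    "ext_pull K E f \<delta>'' = ext_push K B e \<delta>'"
  using extriangulated_category.ET4_mor[OF extriangulated_op, of A f B f' D \<delta> g C g' F \<delta>'] assms unfolding op_unfold by metis

text \<open>If \<open>x\<^sup>*\<delta> = 0\<close> then \<open>x\<close> and the identity of \<open>A\<close> are the ends of a morphism from the split
  conflation \<open>A \<rightarrow> A \<oplus> M \<rightarrow> M\<close> to \<open>\<delta>\<close>; its middle component restricted to \<open>M\<close> is the lift.\<close>

lemma lift_through_deflation:
  assumes r: "realizes K A f B g C \<delta>" and x: "mor K x M C" and "ext_pull K A x \<delta> = \<zero>\<^bsub>Ext K M A\<^esub>"
  obtains b where "mor K b M B" "g \<bullet> b = x"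
proof -
  have o: "A \<in> Obj K" "M \<in> Obj K" using r x by (auto simp: mor_def realizes_def)
  obtain S i j p q where bi: "biproduct K A M S i j p q" using biproduct_exists[OF o] by blast
  note b = biproductD[OF bi]
  obtain b' where b': "mor K b' S B" "g \<bullet> b' = x \<bullet> q"
    by (rule fill_middle[OF real_zero[OF bi] r mor_id[OF o(1)] x])
       (use push_id[OF exten_zero[OF o(2,1)]] assms(3) in auto)
  have "g \<bullet> (b' \<bullet> j) = x"
    using assoc[OF b(2) b'(1)] assoc[OF b(2,4) x] realizesD[OF r] b' b id_right[OF x] by metis
  then show ?thesis using that mor_comp[OF b(2) b'(1)] by blast
qed

lemma extend_along_inflation:
  assumes "realizes K A f B g C \<delta>" "mor K x A M" "ext_push K C x \<delta> = \<zero>\<^bsub>Ext K C M\<^esub>"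
  obtains b where "mor K b B M" "b \<bullet> f = x"
  using extriangulated_category.lift_through_deflation[OF extriangulated_op, of C g B f A \<delta> x M] assms unfolding op_unfold by metis

text \<open>As \<open>f\<^sub>*y = 0\<close>, the inflation \<open>f\<close> extends to the middle term of \<open>y\<close>; the morphism induced on the
  right-hand ends is the required \<open>x\<close>.\<close>

lemma ext_killed_by_inflation:
  assumes "realizes K A f B g C \<delta>" "exten K y M A" "ext_push K M f y = \<zero>\<^bsub>Ext K M B\<^esub>"
  obtains x where "mor K x M C" "y = ext_pull K A x \<delta>"
proof -
  note d = realizesD[OF assms(1)]
  obtain k N l where r: "realizes K A k N l M y" by (rule realization_exists[OF assms(2)])
  obtain n where n: "mor K n N B" "n \<bullet> k = f"
    by (rule extend_along_inflation[OF r d(1) assms(3)])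
  have A: "A \<in> Obj K" using d(1) by (simp add: mor_def)
  show ?thesis
    by (rule fill_right[OF r assms(1) mor_id[OF A] n(1)])
       (use that n push_id[OF assms(2)] id_right[OF d(1)] in auto)
qed

lemma ext_killed_by_deflation:
  assumes "realizes K A f B g C \<delta>" "exten K y C M" "ext_pull K M g y = \<zero>\<^bsub>Ext K B M\<^esub>"
  obtains x where "mor K x A M" "y = ext_push K C x \<delta>"
  using extriangulated_category.ext_killed_by_inflation[OF extriangulated_op, of C g B f A \<delta> y M] assms unfolding op_unfold by metis

text \<open>Compose \<open>f\<close> with the inflation of \<open>z\<close> by (ET4). The cokernel \<open>E\<close> of the composite is an extension of
  \<open>M\<close> by \<open>C\<close> with class \<open>g\<^sub>*z = 0\<close>, and pulling the class of the composite back along a section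
  \<open>M \<rightarrow> E\<close> gives the preimage of \<open>z\<close>.\<close>

lemma ext_exact_middle:
  assumes r: "realizes K A f B g C \<delta>" and z: "exten K z M B" and "ext_push K M g z = \<zero>\<^bsub>Ext K M C\<^esub>"
  obtains y where "exten K y M A" "z = ext_push K M f y"
proof -
  note d = realizesD[OF r]
  obtain k N l where k: "realizes K B k N l M z" by (rule realization_exists[OF z])
  have M: "M \<in> Obj K" using z by (simp add: exten_def)
  obtain E h d e \<epsilon> where E: "realizes K A (k \<bullet> f) N h E \<epsilon>" "mor K e E M"
     "realizes K C d E e M (ext_push K M g z)" "ext_push K E f \<epsilon> = ext_pull K B e z"
    by (rule ET4_mor[OF r k])
  note split = E(3)[unfolded assms(3)]
  obtain s where s: "mor K s M E" "e \<bullet> s = Ident K M"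
    by (rule lift_through_deflation[OF split mor_id[OF M]])
       (use pull_zero[OF _ mor_id[OF M]] d mor_obj in metis)
  note ed = realizesD(3)[OF E(1)]
  have "ext_push K M f (ext_pull K A s \<epsilon>) = ext_pull K B s (ext_pull K B e z)"
    using push_pull[OF ed d(1) s(1)] E by simp
  also have "\<dots> = z" using pull_pull[OF z E(2) s(1)] s pull_id[OF z] by simp
  finally show ?thesis using that pull_exten[OF ed s(1)] by metis
qed

lemma ext_exact_middle_op:
  assumes "realizes K A f B g C \<delta>" "exten K z B M" "ext_pull K M f z = \<zero>\<^bsub>Ext K A M\<^esub>"
  obtains y where "exten K y C M" "z = ext_pull K M g y"
  using extriangulated_category.ext_exact_middle[OF extriangulated_op, of C g B f A \<delta> z M] assms unfolding op_unfold by metis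

lemma realizes_zero_split:
  assumes r: "realizes K A f B g C \<zero>\<^bsub>Ext K C A\<^esub>"
  obtains j p where "biproduct K A C B f j p g"
proof -
  have o: "A \<in> Obj K" "C \<in> Obj K" using r by (auto simp: realizes_def)
  note d = realizesD[OF r]
  obtain S i j p q where bi: "biproduct K A C S i j p q" using biproduct_exists[OF o] by blast
  note b = biproductD[OF bi]
  obtain c c' where c: "mor K c S B" "mor K c' B S" "c' \<bullet> c = Ident K S" "c \<bullet> c' = Ident K B"
    "c \<bullet> i = f" "g \<bullet> c = q" "c' \<bullet> f = i" "q \<bullet> c' = g"
    by (rule realizes_iso[OF real_zero[OF bi] r])
  note pc = mor_comp[OF c(2) b(3)] and cj = mor_comp[OF b(2) c(1)]
  have "biproduct K A C B f (c \<bullet> j) (p \<bullet> c') g"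
  proof (rule biproductI)
    show "mor K f A B" "mor K g B C" "mor K (c \<bullet> j) C B" "mor K (p \<bullet> c') B A"
      "g \<bullet> f = \<zero>\<^bsub>Hom K A C\<^esub>" by (rule d pc cj)+
    show "(p \<bullet> c') \<bullet> f = Ident K A" using assoc[OF d(1) c(2) b(3)] b c by simp
    show "g \<bullet> (c \<bullet> j) = Ident K C" using assoc[OF b(2) c(1) d(2)] b c by simp
    have "c' \<bullet> (c \<bullet> j) = j" using assoc[OF b(2) c(1,2)] c id_left[OF b(2)] by simp
    then show "(p \<bullet> c') \<bullet> (c \<bullet> j) = \<zero>\<^bsub>Hom K C A\<^esub>" using assoc[OF cj c(2) b(3)] b by simp
    have "f \<bullet> (p \<bullet> c') \<oplus>\<^bsub>Hom K B B\<^esub> (c \<bullet> j) \<bullet> g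
        = ((c \<bullet> (i \<bullet> p)) \<bullet> c') \<oplus>\<^bsub>Hom K B B\<^esub> ((c \<bullet> (j \<bullet> q)) \<bullet> c')"
      using c assoc[OF pc b(1) c(1)] assoc[OF c(2) b(4) cj] assoc[OF b(4,2) c(1)]
        assoc[OF c(2) mor_comp[OF b(3,1)] c(1)] assoc[OF c(2) b(3,1)] by simp
    also have "\<dots> = (c \<bullet> (i \<bullet> p \<oplus>\<^bsub>Hom K S S\<^esub> j \<bullet> q)) \<bullet> c'"
      using distrib_right[OF mor_comp[OF b(3,1)] mor_comp[OF b(4,2)] c(1)]
        distrib_left[OF c(2) mor_comp[OF mor_comp[OF b(3,1)] c(1)] mor_comp[OF mor_comp[OF b(4,2)] c(1)]] 
      by simp
    also have "\<dots> = Ident K B" using b c id_right[OF c(1)] by simp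
    finally show "f \<bullet> (p \<bullet> c') \<oplus>\<^bsub>Hom K B B\<^esub> (c \<bullet> j) \<bullet> g = Ident K B" .
  qed
  then show ?thesis using that by blast
qed

text \<open>The square completion of two deflations \<open>B\<^sub>1 \<rightarrow> C \<leftarrow> B\<^sub>2\<close>. Pulling \<open>\<delta>\<^sub>1\<close> back along \<open>g\<^sub>2\<close> gives
  \<open>M\<close>, and the kernel \<open>E\<close> of \<open>M \<rightarrow> B\<^sub>2 \<rightarrow> C\<close> is an extension of \<open>A\<^sub>2\<close> by \<open>A\<^sub>1\<close> that splits because
  \<open>g\<^sub>2 \<bullet> f\<^sub>2 = 0\<close>. After a shear, the projection \<open>E \<rightarrow> A\<^sub>1\<close> sends the class of \<open>E \<rightarrow> M \<rightarrow> C\<close> to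
  \<open>\<delta>\<^sub>1\<close> itself, so that dividing \<open>M\<close> by the complement \<open>A\<^sub>2\<close> leaves a copy of \<open>B\<^sub>1\<close>.\<close>

lemma pullback_conflations:
  assumes r1: "realizes K A\<^sub>1 f\<^sub>1 B\<^sub>1 g\<^sub>1 C \<delta>\<^sub>1" and r2: "realizes K A\<^sub>2 f\<^sub>2 B\<^sub>2 g\<^sub>2 C \<delta>\<^sub>2"
  obtains M k l k' l' B' where "conflation K A\<^sub>1 k M l B\<^sub>2" "conflation K A\<^sub>2 k' M l' B'"
    "isomorphic K B\<^sub>1 B'"
proof -
  note d1 = realizesD[OF r1] and d2 = realizesD[OF r2]
  have o: "A\<^sub>1 \<in> Obj K" "A\<^sub>2 \<in> Obj K" "B\<^sub>2 \<in> Obj K" "C \<in> Obj K" using d1(3) d2(1,2,3) by (simp_all add: mor_def exten_def)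
  obtain k M l where k: "realizes K A\<^sub>1 k M l B\<^sub>2 (ext_pull K A\<^sub>1 g\<^sub>2 \<delta>\<^sub>1)"
    using realization_exists[OF pull_exten[OF d1(3) d2(2)]] by blast
  obtain E h d e \<epsilon> where E: "realizes K E h M (g\<^sub>2 \<bullet> l) C \<epsilon>"
    "realizes K A\<^sub>1 e E d A\<^sub>2 (ext_pull K A\<^sub>1 f\<^sub>2 (ext_pull K A\<^sub>1 g\<^sub>2 \<delta>\<^sub>1))"
    "ext_push K C d \<epsilon> = \<delta>\<^sub>2" "ext_pull K E g\<^sub>2 \<epsilon> = ext_push K B\<^sub>2 e (ext_pull K A\<^sub>1 g\<^sub>2 \<delta>\<^sub>1)"
    by (rule ET4_op_mor[OF r2 k])
  have "ext_pull K A\<^sub>1 f\<^sub>2 (ext_pull K A\<^sub>1 g\<^sub>2 \<delta>\<^sub>1) = \<zero>\<^bsub>Ext K A\<^sub>2 A\<^sub>1\<^esub>"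
    using pull_pull[OF d1(3) d2(2,1)] d2(4) pull_zero_mor[OF d1(3) o(2)] by simp
  then obtain j p where bi: "biproduct K A\<^sub>1 A\<^sub>2 E e j p d"
    using realizes_zero_split E(2) by metis
  note b = biproductD[OF bi] and \<epsilon> = realizesD(3)[OF E(1)]
  \<comment> \<open>\<open>\<eta>\<close> measures how far \<open>p\<close> is from sending \<open>\<epsilon>\<close> to \<open>\<delta>\<^sub>1\<close>; it dies on \<open>B\<^sub>2\<close> and so comes from \<open>\<delta>\<^sub>2\<close>.\<close>
  define \<eta> where "\<eta> = ext_push K C p \<epsilon> \<ominus>\<^bsub>Ext K C A\<^sub>1\<^esub> \<delta>\<^sub>1"
  have p\<epsilon>: "exten K (ext_push K C p \<epsilon>) C A\<^sub>1" by (rule push_exten[OF \<epsilon> b(3)])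
  have \<eta>: "exten K \<eta> C A\<^sub>1" unfolding \<eta>_def using p\<epsilon> d1(3) by (rule exten_minus)
  have g1: "exten K (ext_pull K A\<^sub>1 g\<^sub>2 \<delta>\<^sub>1) B\<^sub>2 A\<^sub>1" by (rule pull_exten[OF d1(3) d2(2)])
  have "ext_pull K A\<^sub>1 g\<^sub>2 (ext_push K C p \<epsilon>) = ext_push K B\<^sub>2 p (ext_push K B\<^sub>2 e (ext_pull K A\<^sub>1 g\<^sub>2 \<delta>\<^sub>1))"
    using push_pull[OF \<epsilon> b(3) d2(2)] E by simp
  also have "\<dots> = ext_pull K A\<^sub>1 g\<^sub>2 \<delta>\<^sub>1" using push_push[OF g1 b(1,3)] b push_id[OF g1] by simp
  finally have "ext_pull K A\<^sub>1 g\<^sub>2 \<eta> = \<zero>\<^bsub>Ext K B\<^sub>2 A\<^sub>1\<^esub>"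
    unfolding \<eta>_def using pull_diff[OF p\<epsilon> d1(3) d2(2)] exten_diff_zero[OF g1 g1] by simp
  then obtain x where x: "mor K x A\<^sub>2 A\<^sub>1" "\<eta> = ext_push K C x \<delta>\<^sub>2"
    using ext_killed_by_deflation[OF r2 \<eta>] by metis
  define p' j' where "p' = p \<ominus>\<^bsub>Hom K E A\<^sub>1\<^esub> x \<bullet> d" and "j' = j \<oplus>\<^bsub>Hom K A\<^sub>2 E\<^esub> e \<bullet> x"
  have bi': "biproduct K A\<^sub>1 A\<^sub>2 E e j' p' d"
    unfolding p'_def j'_def using bi x(1) by (rule biproduct_shear)
  interpret abelian_group "Ext K C A\<^sub>1" using o ext_group by blast
  have "ext_push K C p' \<epsilon> = ext_push K C p \<epsilon> \<ominus>\<^bsub>Ext K C A\<^sub>1\<^esub> \<eta>"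
    unfolding p'_def using push_diff_mor[OF \<epsilon> b(3) mor_comp[OF b(4) x(1)]] 
      push_push[OF \<epsilon> b(4) x(1)] E x by simp
  also have "\<dots> = \<delta>\<^sub>1"
    unfolding \<eta>_def using p\<epsilon> d1(3) by (simp add: exten_def a_minus_def minus_add r_neg1 a_assoc[symmetric] r_neg)
  finally have p': "ext_push K C p' \<epsilon> = \<delta>\<^sub>1" .
  note s = real_zero[OF biproduct_swap[OF bi']]
  obtain B' h' d' e' \<epsilon>' where B': "realizes K A\<^sub>2 (h \<bullet> j') M h' B' \<epsilon>'"
     "realizes K A\<^sub>1 d' B' e' C (ext_push K C p' \<epsilon>)"
    by (rule ET4_mor[OF s E(1)])
  obtain b b' where "mor K b B\<^sub>1 B'" "mor K b' B' B\<^sub>1" "b' \<bullet> b = Ident K B\<^sub>1" "b \<bullet> b' = Ident K B'"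
    using realizes_iso[OF r1 B'(2)[unfolded p']] by metis
  then have "isomorphic K B\<^sub>1 B'" by (auto simp: isomorphic_def intro: iso_arrI)
  then show ?thesis using that k B'(1) unfolding conflation_def by blast
qed

end

lemma op_isomorphic: "A \<in> Obj K \<Longrightarrow> B \<in> Obj K \<Longrightarrow> isomorphic (op_cat K) A B \<longleftrightarrow> isomorphic K A B"
  by (auto simp: isomorphic_def op_iso_arr) (auto simp: iso_arr_def)

section \<open>Exactness at the second extension module\<close>

text \<open>The linear extension of a map \<open>\<theta>\<close> on generators to the free module.\<close>

definition free_lift :: "('r, 'x) ring_scheme \<Rightarrow> ('r, 'b) module \<Rightarrow> ('s \<Rightarrow> 'b) \<Rightarrow> ('s \<Rightarrow> 'r) \<Rightarrow> 'b"
  where "free_lift R M \<theta> \<phi> = (\<Oplus>\<^bsub>M\<^esub>s\<in>{s. \<phi> s \<noteq> \<zero>\<^bsub>R\<^esub>}. \<phi> s \<odot>\<^bsub>M\<^esub> \<theta> s)"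

lemma free_module_module:
  assumes "cring R" shows "module R (free_module R S)"
proof -
  interpret cring R by fact
  let ?F = "free_module R S"
  have fin: "finite {s. \<phi> s \<noteq> \<zero>\<^bsub>R\<^esub>} \<Longrightarrow> finite {s. \<psi> s \<noteq> \<zero>\<^bsub>R\<^esub>} \<Longrightarrow> finite {s. \<phi> s \<oplus>\<^bsub>R\<^esub> \<psi> s \<noteq> \<zero>\<^bsub>R\<^esub>}" for \<phi> \<psi>
    by (rule finite_subset[of _ "{s. \<phi> s \<noteq> \<zero>\<^bsub>R\<^esub>} \<union> {s. \<psi> s \<noteq> \<zero>\<^bsub>R\<^esub>}"]) auto
  have fin2: "finite {s. \<phi> s \<noteq> \<zero>\<^bsub>R\<^esub>} \<Longrightarrow> (\<And>s. h \<zero>\<^bsub>R\<^esub> = \<zero>\<^bsub>R\<^esub>) \<Longrightarrow> finite {s. h (\<phi> s) \<noteq> \<zero>\<^bsub>R\<^esub>}" for \<phi> h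
    by (rule finite_subset[of _ "{s. \<phi> s \<noteq> \<zero>\<^bsub>R\<^esub>}"]) auto
  have "abelian_group ?F"
  proof (rule abelian_groupI)
    show "\<exists>y\<in>carrier ?F. y \<oplus>\<^bsub>?F\<^esub> x = \<zero>\<^bsub>?F\<^esub>" if "x \<in> carrier ?F" for x
      using that fin2[of x "\<lambda>r. \<ominus>\<^bsub>R\<^esub> r"]
      by (intro bexI[of _ "\<lambda>s. \<ominus>\<^bsub>R\<^esub> x s"]) (auto simp: free_module_def l_neg)
  qed (auto simp: free_module_def a_assoc fin intro: a_comm)
  moreover have "r \<odot>\<^bsub>?F\<^esub> x \<in> carrier ?F" if "r \<in> carrier R" "x \<in> carrier ?F" for r x
    using that fin2[of x "\<lambda>t. r \<otimes>\<^bsub>R\<^esub> t"] by (auto simp: free_module_def)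
  ultimately show ?thesis
    by (intro moduleI) (auto simp: free_module_def fun_eq_iff l_distr r_distr m_assoc assms)
qed

lemma free_gen_carrier: "cring R \<Longrightarrow> s \<in> S \<Longrightarrow> free_gen R s \<in> carrier (free_module R S)"
proof -
  assume "cring R" then interpret cring R .
  have "finite {t. free_gen R s t \<noteq> \<zero>\<^bsub>R\<^esub>}" 
    by (rule finite_subset[of _ "{s}"]) (auto simp: free_gen_def)
  then show "s \<in> S \<Longrightarrow> ?thesis" by (auto simp: free_gen_def free_module_def)
qed

locale free_module_map = module R M for R :: "('r, 'x) ring_scheme" and M :: "('r, 'b) module" +
  fixes S :: "'s set" and \<theta> :: "'s \<Rightarrow> 'b"
  assumes \<theta>: "\<theta> \<in> S \<rightarrow> carrier M"
begin

abbreviation "F \<equiv> free_module R S"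

sublocale F: module R "free_module R S" 
  by (rule free_module_module) (rule R.is_cring)

lemma free_lift_eq:
  assumes "\<phi> \<in> carrier F" "finite T" "T \<subseteq> S" "{s. \<phi> s \<noteq> \<zero>\<^bsub>R\<^esub>} \<subseteq> T"
  shows "free_lift R M \<theta> \<phi> = (\<Oplus>\<^bsub>M\<^esub>s\<in>T. \<phi> s \<odot>\<^bsub>M\<^esub> \<theta> s)"
  unfolding free_lift_def
  using assms \<theta> by (intro M.add.finprod_mono_neutral_cong_left) (auto simp: free_module_def Pi_iff)

lemma support:
  assumes "\<phi> \<in> carrier F" 
  shows "finite {s. \<phi> s \<noteq> \<zero>\<^bsub>R\<^esub>}" "{s. \<phi> s \<noteq> \<zero>\<^bsub>R\<^esub>} \<subseteq> S" "\<phi> s \<in> carrier R"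
  using assms by (auto simp: free_module_def)

lemma free_lift_closed:
  assumes "\<phi> \<in> carrier F" shows "free_lift R M \<theta> \<phi> \<in> carrier M"
  unfolding free_lift_def using support[OF assms] \<theta> by (intro M.finsum_closed) (auto simp: Pi_iff)

lemma free_lift_add:
  assumes "\<phi> \<in> carrier F" "\<psi> \<in> carrier F"
  shows "free_lift R M \<theta> (\<phi> \<oplus>\<^bsub>F\<^esub> \<psi>) = free_lift R M \<theta> \<phi> \<oplus>\<^bsub>M\<^esub> free_lift R M \<theta> \<psi>"
proof -
  define T where "T = {s. \<phi> s \<noteq> \<zero>\<^bsub>R\<^esub>} \<union> {s. \<psi> s \<noteq> \<zero>\<^bsub>R\<^esub>}"
  note s = support[OF assms(1)] support[OF assms(2)]
  have T: "finite T" "T \<subseteq> S" using s by (auto simp: T_def)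
  have t: "\<theta> x \<in> carrier M" if "x \<in> T" for x using that T \<theta> by auto
  have *: "(\<phi> \<oplus>\<^bsub>F\<^esub> \<psi>) s = \<phi> s \<oplus>\<^bsub>R\<^esub> \<psi> s" for s by (simp add: free_module_def)
  have "free_lift R M \<theta> (\<phi> \<oplus>\<^bsub>F\<^esub> \<psi>) = (\<Oplus>\<^bsub>M\<^esub>s\<in>T. (\<phi> \<oplus>\<^bsub>F\<^esub> \<psi>) s \<odot>\<^bsub>M\<^esub> \<theta> s)"
    using T F.a_closed[OF assms] by (intro free_lift_eq) (auto simp: * T_def)
  also have "\<dots> = (\<Oplus>\<^bsub>M\<^esub>s\<in>T. \<phi> s \<odot>\<^bsub>M\<^esub> \<theta> s \<oplus>\<^bsub>M\<^esub> \<psi> s \<odot>\<^bsub>M\<^esub> \<theta> s)"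
    using t s(3,6) by (intro M.finsum_cong') (auto simp: * smult_l_distr)
  also have "\<dots> = free_lift R M \<theta> \<phi> \<oplus>\<^bsub>M\<^esub> free_lift R M \<theta> \<psi>"
    using t s(3,6) T assms
    by (subst M.finsum_addf) (auto simp: Pi_iff free_lift_eq[OF _ T] T_def)
  finally show ?thesis .
qed

lemma free_lift_smult:
  assumes "r \<in> carrier R" "\<phi> \<in> carrier F"
  shows "free_lift R M \<theta> (r \<odot>\<^bsub>F\<^esub> \<phi>) = r \<odot>\<^bsub>M\<^esub> free_lift R M \<theta> \<phi>"
proof -
  define T where "T = {s. \<phi> s \<noteq> \<zero>\<^bsub>R\<^esub>}"
  note s = support[OF assms(2)]
  have T: "finite T" "T \<subseteq> S" using s by (auto simp: T_def)
  have t: "\<theta> x \<in> carrier M" if "x \<in> T" for x using that T \<theta> by auto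
  have *: "(r \<odot>\<^bsub>F\<^esub> \<phi>) s = r \<otimes>\<^bsub>R\<^esub> \<phi> s" for s by (simp add: free_module_def)
  have "free_lift R M \<theta> (r \<odot>\<^bsub>F\<^esub> \<phi>) = (\<Oplus>\<^bsub>M\<^esub>s\<in>T. (r \<odot>\<^bsub>F\<^esub> \<phi>) s \<odot>\<^bsub>M\<^esub> \<theta> s)"
    using T F.smult_closed[OF assms] assms by (intro free_lift_eq) (auto simp: * T_def)
  also have "\<dots> = (\<Oplus>\<^bsub>M\<^esub>s\<in>T. r \<odot>\<^bsub>M\<^esub> (\<phi> s \<odot>\<^bsub>M\<^esub> \<theta> s))"
    using t s(3) assms by (intro M.finsum_cong') (auto simp: * smult_assoc1)
  also have "\<dots> = r \<odot>\<^bsub>M\<^esub> (\<Oplus>\<^bsub>M\<^esub>s\<in>T. \<phi> s \<odot>\<^bsub>M\<^esub> \<theta> s)"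
    using t s(3) T assms by (intro finsum_smult_ldistr[symmetric]) auto
  finally show ?thesis by (simp add: free_lift_def T_def)
qed

lemma free_lift_diff:
  assumes "\<phi> \<in> carrier F" "\<psi> \<in> carrier F"
  shows "free_lift R M \<theta> (\<phi> \<ominus>\<^bsub>F\<^esub> \<psi>) = free_lift R M \<theta> \<phi> \<ominus>\<^bsub>M\<^esub> free_lift R M \<theta> \<psi>"
  using assms free_lift_closed free_lift_add 
  by (intro additive_map(2)[of F M "free_lift R M \<theta>"])
     (auto intro: F.abelian_group_axioms M.abelian_group_axioms)

lemma free_lift_gen:
  assumes "s \<in> S" shows "free_lift R M \<theta> (free_gen R s) = \<theta> s"
proof -
  have "free_lift R M \<theta> (free_gen R s) = (\<Oplus>\<^bsub>M\<^esub>t\<in>{s}. free_gen R s t \<odot>\<^bsub>M\<^esub> \<theta> t)"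
    using assms free_gen_carrier[OF R.is_cring assms] by (intro free_lift_eq) (auto simp: free_gen_def)
  also have "\<dots> = \<theta> s" using assms \<theta> by (auto simp: free_gen_def Pi_iff)
  finally show ?thesis .
qed

lemma submodule_preimage:
  assumes I: "submodule I R M"
  shows "submodule {\<phi> \<in> carrier F. free_lift R M \<theta> \<phi> \<in> I} R F"
proof -
  note s = submoduleE[OF I]
  have z: "\<zero>\<^bsub>M\<^esub> \<in> I" using s(1,2,3,5) by (metis ex_in_conv M.r_neg subsetD)
  have n: "free_lift R M \<theta> \<zero>\<^bsub>F\<^esub> = \<zero>\<^bsub>M\<^esub>" by (simp add: free_lift_def free_module_def)
  show ?thesis
  proof (rule F.submoduleI)
    fix a assume a: "a \<in> {\<phi> \<in> carrier F. free_lift R M \<theta> \<phi> \<in> I}"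
    then have "free_lift R M \<theta> (\<zero>\<^bsub>F\<^esub> \<ominus>\<^bsub>F\<^esub> a) = \<zero>\<^bsub>M\<^esub> \<ominus>\<^bsub>M\<^esub> free_lift R M \<theta> a"
      using free_lift_diff[of "\<zero>\<^bsub>F\<^esub>" a] n by simp
    then have "free_lift R M \<theta> (\<ominus>\<^bsub>F\<^esub> a) = \<ominus>\<^bsub>M\<^esub> free_lift R M \<theta> a"
      using a free_lift_closed by (simp add: a_minus_def)
    then show "\<ominus>\<^bsub>F\<^esub> a \<in> {\<phi> \<in> carrier F. free_lift R M \<theta> \<phi> \<in> I}" using a s by simp
  qed (use s z n free_lift_add free_lift_smult in auto)
qed

end

text \<open>A vanishing coend means that the relations generate the free module. Any linear condition that
  the relations satisfy is therefore satisfied by every element.\<close>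

lemma ext2_vanishesD:
  assumes "cring R" "ext2_vanishes R K {C} {A}" "submodule N R (ext2_free R K C A)"
    "ext2_tensor_relations R K C A \<union> ext2_coend_relations R K C A \<subseteq> N"
    and \<phi>: "\<phi> \<in> carrier (ext2_free R K C A)"
  shows "\<phi> \<in> N"
proof -
  let ?F = "ext2_free R K C A"
  interpret F: module R ?F unfolding ext2_free_def using assms(1) by (rule free_module_module)
  define G where "G = submodule_generated R ?F (ext2_tensor_relations R K C A \<union> ext2_coend_relations R K C A)"
  have "carrier (Ext2 R K C A) = a_rcosets\<^bsub>?F\<^esub> G" "\<zero>\<^bsub>Ext2 R K C A\<^esub> = G"
    by (simp_all add: Ext2_def G_def quotient_module_def)
  then have "a_rcosets\<^bsub>?F\<^esub> G = {G}" using assms(2) by (simp add: ext2_vanishes_def)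
  moreover have "G +>\<^bsub>?F\<^esub> \<phi> \<in> a_rcosets\<^bsub>?F\<^esub> G" using \<phi> by (auto simp: A_RCOSETS_def')
  ultimately have "G +>\<^bsub>?F\<^esub> \<phi> = G" by simp
  moreover have "\<zero>\<^bsub>?F\<^esub> \<in> G"
    unfolding G_def submodule_generated_def
    using subgroup.one_closed[OF submodule.axioms(1)] by fastforce
  then have "\<phi> \<in> G +>\<^bsub>?F\<^esub> \<phi>" using \<phi> by (force simp: a_r_coset_def')
  ultimately have "\<phi> \<in> G" by simp
  then show ?thesis using assms(3,4) by (auto simp: G_def submodule_generated_def)
qed

text \<open>The image of \<open>u \<otimes> v\<close> at the stage \<open>\<delta> \<in> \<bbbE>(C, D)\<close> of the colimit is \<open>x\<^sup>*u\<close> for a lift \<open>x\<close> of \<open>v\<close>.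
  Choosing the lift in terms of \<open>v\<close> alone makes the value linear in \<open>u\<close> on the nose, and the default
  value \<open>0\<close> keeps this so where \<open>v\<close> has no lift.\<close>

definition symbol_value :: "('r, 'o, 'm, 'e) ext_cat \<Rightarrow> 'o \<Rightarrow> 'o \<Rightarrow> 'o \<Rightarrow> 'e \<Rightarrow> 'o \<times> 'e \<times> 'e \<Rightarrow> 'e"
  where "symbol_value K C A D \<delta> = (\<lambda>(X, u, v).
    if \<exists>x. mor K x D X \<and> ext_push K C x \<delta> = v
    then ext_pull K A (SOME x. mor K x D X \<and> ext_push K C x \<delta> = v) u
    else \<zero>\<^bsub>Ext K D A\<^esub>)"

definition restrictions :: "('r, 'o, 'm, 'e) ext_cat \<Rightarrow> 'o \<Rightarrow> 'm \<Rightarrow> 'o \<Rightarrow> 'e set"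
  where "restrictions K A f B = ext_pull K A f ` carrier (Ext K B A)"

text \<open>The elements of the free module that vanish in the colimit: from some stage \<open>\<delta>\<close> on, their value lies
  in the image of \<open>\<bbbE>(B, A) \<rightarrow> \<bbbE>(D', A)\<close>.\<close>

definition eventually_extends ::
    "('r, 'x) ring_scheme \<Rightarrow> ('r, 'o, 'm, 'e) ext_cat \<Rightarrow> 'o \<Rightarrow> 'o \<Rightarrow> ('o \<times> 'e \<times> 'e \<Rightarrow> 'r) set"
  where "eventually_extends R K C A = {\<phi> \<in> carrier (ext2_free R K C A).
    \<exists>D \<delta>. exten K \<delta> C D \<and> (\<forall>D' f B g \<delta>' d.
      realizes K D' f B g C \<delta>' \<longrightarrow> mor K d D' D \<longrightarrow> ext_push K C d \<delta>' = \<delta> \<longrightarrow>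
      free_lift R (Ext K D' A) (symbol_value K C A D' \<delta>') \<phi> \<in> restrictions K A f B)}"

lemma (in module) submodule_diff:
  assumes "submodule I R M" "a \<in> I" "b \<in> I" shows "a \<ominus>\<^bsub>M\<^esub> b \<in> I" "a \<oplus>\<^bsub>M\<^esub> b \<in> I"
  using submoduleE[OF assms(1)] assms(2,3) by (auto simp: a_minus_def)

lemma (in abelian_group) add_diff_cancel:
  assumes "x \<in> carrier G" "y \<in> carrier G" shows "x \<oplus> (y \<ominus> x) = y"
  using assms a_lcomm[of x y "\<ominus> x"] by (simp add: a_minus_def r_neg)

lemma (in abelian_group) add_minus_cancel:
  assumes "x \<in> carrier G" "y \<in> carrier G" shows "(x \<oplus> y) \<ominus> y = x"
  using assms by (simp add: a_minus_def r_neg a_assoc)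

context extriangulated_category
begin

lemma exten_smult: "exten K u C A \<Longrightarrow> r \<in> carrier R \<Longrightarrow> exten K (r \<odot>\<^bsub>Ext K C A\<^esub> u) C A"
  using module.smult_closed[OF ext_module] by (auto simp: exten_def)

text \<open>The stages are directed: the element of \<open>\<bbbE>(C, D\<^sub>1 \<oplus> D\<^sub>2)\<close> with components \<open>\<delta>\<^sub>1\<close> and \<open>\<delta>\<^sub>2\<close> refines
  both.\<close>

lemma common_refinement:
  assumes "exten K \<delta>\<^sub>1 C D\<^sub>1" "exten K \<delta>\<^sub>2 C D\<^sub>2"
  obtains D \<delta> d\<^sub>1 d\<^sub>2 where "exten K \<delta> C D" "mor K d\<^sub>1 D D\<^sub>1" "mor K d\<^sub>2 D D\<^sub>2"
    "ext_push K C d\<^sub>1 \<delta> = \<delta>\<^sub>1" "ext_push K C d\<^sub>2 \<delta> = \<delta>\<^sub>2"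
proof -
  have o: "D\<^sub>1 \<in> Obj K" "D\<^sub>2 \<in> Obj K" "C \<in> Obj K" using assms by (simp_all add: exten_def)
  obtain S i j p q where "biproduct K D\<^sub>1 D\<^sub>2 S i j p q" using biproduct_exists[OF o(1,2)] by blast
  note b = biproductD[OF this]
  define \<delta> where "\<delta> = ext_push K C i \<delta>\<^sub>1 \<oplus>\<^bsub>Ext K C S\<^esub> ext_push K C j \<delta>\<^sub>2"
  note e = push_exten[OF assms(1) b(1)] push_exten[OF assms(2) b(2)]
  interpret D1: abelian_group "Ext K C D\<^sub>1" using o by (simp add: ext_group)
  interpret D2: abelian_group "Ext K C D\<^sub>2" using o by (simp add: ext_group)
  have "ext_push K C p \<delta> = \<delta>\<^sub>1 \<oplus>\<^bsub>Ext K C D\<^sub>1\<^esub> \<zero>\<^bsub>Ext K C D\<^sub>1\<^esub>"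
    unfolding \<delta>_def using push_add[OF e b(3)] push_push[OF assms(1) b(1,3)] push_push[OF assms(2) b(2,3)]
      b push_id[OF assms(1)] push_zero_mor[OF assms(2) o(1)] by simp
  moreover have "ext_push K C q \<delta> = \<zero>\<^bsub>Ext K C D\<^sub>2\<^esub> \<oplus>\<^bsub>Ext K C D\<^sub>2\<^esub> \<delta>\<^sub>2"
    unfolding \<delta>_def using push_add[OF e b(4)] push_push[OF assms(1) b(1,4)] push_push[OF assms(2) b(2,4)]
      b push_id[OF assms(2)] push_zero_mor[OF assms(1) o(2)] by simp
  moreover have "exten K \<delta> C S" unfolding \<delta>_def using e by (rule exten_add)
  ultimately show ?thesis using that[of \<delta> S p q] b(3,4) assms by (simp add: exten_def)
qed

lemma restrictions_submodule:
  assumes "mor K f D B" "A \<in> Obj K" 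
  shows "submodule (restrictions K A f B) R (Ext K D A)"
proof -
  have o: "B \<in> Obj K" "D \<in> Obj K" using assms by (simp_all add: mor_def)
  interpret D: module R "Ext K D A" using o assms by (simp add: ext_module)
  interpret B: module R "Ext K B A" using o assms by (simp add: ext_module)
  have e: "exten K w B A \<longleftrightarrow> w \<in> carrier (Ext K B A)" for w using o assms by (simp add: exten_def)
  note z = pull_zero[OF assms(2,1)]
  show ?thesis unfolding restrictions_def
  proof (rule D.submoduleI)
    fix a assume "a \<in> ext_pull K A f ` carrier (Ext K B A)"
    then obtain w where w: "exten K w B A" "a = ext_pull K A f w" by (auto simp: e)
    have "ext_pull K A f (\<zero>\<^bsub>Ext K B A\<^esub> \<ominus>\<^bsub>Ext K B A\<^esub> w) = \<ominus>\<^bsub>Ext K D A\<^esub> a"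
      using pull_diff[OF exten_zero[OF o(1) assms(2)] w(1) assms(1)] w z pull_exten[OF w(1) assms(1)]
      by (simp add: a_minus_def exten_def)
    moreover have "\<zero>\<^bsub>Ext K B A\<^esub> \<ominus>\<^bsub>Ext K B A\<^esub> w \<in> carrier (Ext K B A)" using w e by simp
    ultimately show "\<ominus>\<^bsub>Ext K D A\<^esub> a \<in> ext_pull K A f ` carrier (Ext K B A)" by (metis imageI)
  next
    fix a b assume "a \<in> ext_pull K A f ` carrier (Ext K B A)" "b \<in> ext_pull K A f ` carrier (Ext K B A)"
    then obtain v w where w: "exten K v B A" "a = ext_pull K A f v" "exten K w B A" "b = ext_pull K A f w"
      by (auto simp: e)
    then have "a \<oplus>\<^bsub>Ext K D A\<^esub> b = ext_pull K A f (v \<oplus>\<^bsub>Ext K B A\<^esub> w)"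
      using pull_add[OF w(1,3) assms(1)] by simp
    then show "a \<oplus>\<^bsub>Ext K D A\<^esub> b \<in> ext_pull K A f ` carrier (Ext K B A)"
      using w e by (metis imageI B.a_closed)
  next
    fix r a assume r: "r \<in> carrier R" and "a \<in> ext_pull K A f ` carrier (Ext K B A)"
    then obtain w where w: "exten K w B A" "a = ext_pull K A f w" by (auto simp: e)
    then show "r \<odot>\<^bsub>Ext K D A\<^esub> a \<in> ext_pull K A f ` carrier (Ext K B A)"
      using pull_smult[OF w(1) assms(1) r] r e by (metis imageI B.smult_closed)
  next
    show "\<zero>\<^bsub>Ext K D A\<^esub> \<in> ext_pull K A f ` carrier (Ext K B A)"
      using z by (metis imageI B.zero_closed)
    show "ext_pull K A f ` carrier (Ext K B A) \<subseteq> carrier (Ext K D A)"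
      using pull_exten[OF _ assms(1)] e by (auto simp: exten_def)
  qed
qed

lemma symbol_value_closed:
  assumes "D \<in> Obj K" "A \<in> Obj K"
  shows "symbol_value K C A D \<delta> \<in> ext2_symbols K C A \<rightarrow> carrier (Ext K D A)"
proof (clarsimp simp: ext2_symbols_def)
  fix X u v assume *: "X \<in> Obj K" "u \<in> carrier (Ext K X A)" "v \<in> carrier (Ext K C X)"
  show "symbol_value K C A D \<delta> (X, u, v) \<in> carrier (Ext K D A)"
  proof (cases "\<exists>x. mor K x D X \<and> ext_push K C x \<delta> = v")
    case True
    have "exten K u X A" using * assms by (simp add: exten_def)
    from pull_exten[OF this] show ?thesis using True someI_ex[OF True] 
      by (simp add: symbol_value_def exten_def)
  next
    case False
    then show ?thesis using exten_zero[OF assms] by (auto simp: symbol_value_def exten_def)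
  qed
qed

text \<open>Two lifts differ by a morphism that extends along the inflation, so that modulo restrictions
  the chosen lift may be replaced by any other one.\<close>

lemma symbol_value_lift:
  assumes r: "realizes K D f B g C \<delta>" and x: "mor K x D X" "ext_push K C x \<delta> = v" and u: "exten K u X A"
  obtains m where "m \<in> restrictions K A f B" "symbol_value K C A D \<delta> (X, u, v) = ext_pull K A x u \<oplus>\<^bsub>Ext K D A\<^esub> m"
proof -
  define y where "y = (SOME x. mor K x D X \<and> ext_push K C x \<delta> = v)"
  have y: "mor K y D X" "ext_push K C y \<delta> = v"
    using someI[of "\<lambda>x. mor K x D X \<and> ext_push K C x \<delta> = v" x] x unfolding y_def by auto
  have val: "symbol_value K C A D \<delta> (X, u, v) = ext_pull K A y u"
    using x by (auto simp: symbol_value_def y_def)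
  note d = realizesD[OF r]
  have "ext_push K C (y \<ominus>\<^bsub>Hom K D X\<^esub> x) \<delta> = \<zero>\<^bsub>Ext K C X\<^esub>"
    using push_diff_mor[OF d(3) y(1) x(1)] y x push_exten[OF d(3) x(1)] exten_diff_zero by simp
  then obtain b where b: "mor K b B X" "b \<bullet> f = y \<ominus>\<^bsub>Hom K D X\<^esub> x"
    using extend_along_inflation[OF r mor_minus[OF y(1) x(1)]] by metis
  have e: "exten K (ext_pull K A y u) D A" "exten K (ext_pull K A x u) D A"
    using pull_exten u y x by blast+
  interpret abelian_group "Ext K D A" using e by (simp add: exten_def ext_group)
  have "ext_pull K A f (ext_pull K A b u) = ext_pull K A y u \<ominus>\<^bsub>Ext K D A\<^esub> ext_pull K A x u"
    using pull_pull[OF u b(1) d(1)] b(2) pull_diff_mor[OF u y(1) x(1)] by simp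
  then have "ext_pull K A y u = ext_pull K A x u \<oplus>\<^bsub>Ext K D A\<^esub> ext_pull K A f (ext_pull K A b u)"
    using e add_diff_cancel by (simp add: exten_def)
  moreover have "ext_pull K A f (ext_pull K A b u) \<in> restrictions K A f B"
    using pull_exten[OF u b(1)] by (auto simp: restrictions_def exten_def)
  ultimately show ?thesis using that val by metis
qed

text \<open>At each stage the condition defines a submodule, as the preimage of one under a linear map.
  Directedness makes the union over the stages closed under sums.\<close>

lemma eventually_extends_submodule:
  assumes o: "C \<in> Obj K" "A \<in> Obj K"
  shows "submodule (eventually_extends R K C A) R (ext2_free R K C A)"
proof -
  let ?F = "ext2_free R K C A"
  let ?N = "eventually_extends R K C A"
  interpret F: module R ?F unfolding ext2_free_def using ring_R by (rule free_module_module)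
  define P where "P D' f B \<delta>' = {\<phi> \<in> carrier ?F.
    free_lift R (Ext K D' A) (symbol_value K C A D' \<delta>') \<phi> \<in> restrictions K A f B}" for D' f B \<delta>'
  have P: "submodule (P D' f B \<delta>') R ?F" if "realizes K D' f B g C \<delta>'" for D' f B g \<delta>'
  proof -
    note d = realizesD[OF that]
    have D': "D' \<in> Obj K" using d by (simp add: mor_def)
    interpret free_module_map R "Ext K D' A" "ext2_symbols K C A" "symbol_value K C A D' \<delta>'"
      using D' o by (intro free_module_map.intro free_module_map_axioms.intro ext_module symbol_value_closed)
    show ?thesis unfolding P_def ext2_free_def
      by (rule submodule_preimage[OF restrictions_submodule[OF d(1) o(2)]])
  qed
  have N: "\<phi> \<in> ?N \<longleftrightarrow> \<phi> \<in> carrier ?F \<and> (\<exists>D \<delta>. exten K \<delta> C D \<and> (\<forall>D' f B g \<delta>' d.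
      realizes K D' f B g C \<delta>' \<longrightarrow> mor K d D' D \<longrightarrow> ext_push K C d \<delta>' = \<delta> \<longrightarrow> \<phi> \<in> P D' f B \<delta>'))" for \<phi>
    by (cases "\<phi> \<in> carrier ?F") (simp_all add: eventually_extends_def P_def)
  show ?thesis
  proof (rule F.submoduleI)
    show "?N \<subseteq> carrier ?F" by (auto simp: eventually_extends_def)
    have "\<zero>\<^bsub>?F\<^esub> \<in> P D' f B \<delta>'" if "realizes K D' f B g C \<delta>'" for D' f B g \<delta>'
      using subgroup.one_closed[OF submodule.axioms(1)[OF P[OF that]]] by simp
    then show "\<zero>\<^bsub>?F\<^esub> \<in> ?N" using exten_zero[OF o(1) o(1)] by (auto simp: N)
  next
    fix a assume "a \<in> ?N"
    then show "\<ominus>\<^bsub>?F\<^esub> a \<in> ?N" using F.submoduleE(3)[OF P] F.a_inv_closed unfolding N by metis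
  next
    fix r a assume "r \<in> carrier R" "a \<in> ?N"
    then show "r \<odot>\<^bsub>?F\<^esub> a \<in> ?N" using F.submoduleE(4)[OF P] F.smult_closed unfolding N by metis
  next
    fix a b assume a: "a \<in> ?N" and b: "b \<in> ?N"
    obtain D\<^sub>1 \<delta>\<^sub>1 where 1: "exten K \<delta>\<^sub>1 C D\<^sub>1" and a': "\<And>D' f B g \<delta>' d. realizes K D' f B g C \<delta>' \<Longrightarrow>
      mor K d D' D\<^sub>1 \<Longrightarrow> ext_push K C d \<delta>' = \<delta>\<^sub>1 \<Longrightarrow> a \<in> P D' f B \<delta>'" using a unfolding N by blast
    obtain D\<^sub>2 \<delta>\<^sub>2 where 2: "exten K \<delta>\<^sub>2 C D\<^sub>2" and b': "\<And>D' f B g \<delta>' d. realizes K D' f B g C \<delta>' \<Longrightarrow>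
      mor K d D' D\<^sub>2 \<Longrightarrow> ext_push K C d \<delta>' = \<delta>\<^sub>2 \<Longrightarrow> b \<in> P D' f B \<delta>'" using b unfolding N by blast
    obtain D \<delta> d\<^sub>1 d\<^sub>2 where D: "exten K \<delta> C D" "mor K d\<^sub>1 D D\<^sub>1" "mor K d\<^sub>2 D D\<^sub>2"
      "ext_push K C d\<^sub>1 \<delta> = \<delta>\<^sub>1" "ext_push K C d\<^sub>2 \<delta> = \<delta>\<^sub>2"
      by (rule common_refinement[OF 1 2])
    have "a \<oplus>\<^bsub>?F\<^esub> b \<in> P D' f B \<delta>'" if r: "realizes K D' f B g C \<delta>'" and d: "mor K d D' D" "ext_push K C d \<delta>' = \<delta>"
      for D' f B g \<delta>' d
    proof -
      note e = realizesD(3)[OF r]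
      have "a \<in> P D' f B \<delta>'"
        using a'[OF r mor_comp[OF d(1) D(2)]] push_push[OF e d(1) D(2)] d D by simp
      moreover have "b \<in> P D' f B \<delta>'"
        using b'[OF r mor_comp[OF d(1) D(3)]] push_push[OF e d(1) D(3)] d D by simp
      ultimately show ?thesis using F.submoduleE(5)[OF P[OF r]] by blast
    qed
    then show "a \<oplus>\<^bsub>?F\<^esub> b \<in> ?N" using D(1) a b unfolding N by blast
  qed
qed

lemma symbols_carrier:
  assumes "exten K u X A" "exten K v C X"
  shows "(X, u, v) \<in> ext2_symbols K C A" "free_gen R (X, u, v) \<in> carrier (ext2_free R K C A)"
proof -
  show "(X, u, v) \<in> ext2_symbols K C A" using assms by (simp add: exten_def ext2_symbols_def)
  then show "free_gen R (X, u, v) \<in> carrier (ext2_free R K C A)"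
    unfolding ext2_free_def by (rule free_gen_carrier[OF ring_R])
qed

lemma eventually_extendsI:
  assumes o: "C \<in> Obj K" "A \<in> Obj K" and \<phi>: "\<phi> \<in> carrier (ext2_free R K C A)" and \<delta>: "exten K \<delta> C D"
    and *: "\<And>D' f B g \<delta>' d. realizes K D' f B g C \<delta>' \<Longrightarrow> mor K d D' D \<Longrightarrow> ext_push K C d \<delta>' = \<delta> \<Longrightarrow>
      free_module_map R (Ext K D' A) (ext2_symbols K C A) (symbol_value K C A D' \<delta>') \<Longrightarrow>
      submodule (restrictions K A f B) R (Ext K D' A) \<Longrightarrow>
      free_lift R (Ext K D' A) (symbol_value K C A D' \<delta>') \<phi> \<in> restrictions K A f B"
  shows "\<phi> \<in> eventually_extends R K C A"
  unfolding eventually_extends_def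
proof (intro CollectI conjI exI allI impI)
  fix D' f B g \<delta>' d assume r: "realizes K D' f B g C \<delta>'" and d: "mor K d D' D" "ext_push K C d \<delta>' = \<delta>"
  have D': "D' \<in> Obj K" using d by (simp add: mor_def)
  show "free_lift R (Ext K D' A) (symbol_value K C A D' \<delta>') \<phi> \<in> restrictions K A f B"
    using D' o by (intro *[OF r d] free_module_map.intro free_module_map_axioms.intro ext_module 
      symbol_value_closed restrictions_submodule realizesD(1)[OF r])
qed (rule \<phi> \<delta>)+

lemma symbol_value_linear:
  assumes "exten K u X A" "exten K u' X A" "D \<in> Obj K"
  shows "symbol_value K C A D \<delta> (X, u \<oplus>\<^bsub>Ext K X A\<^esub> u', v)
    = symbol_value K C A D \<delta> (X, u, v) \<oplus>\<^bsub>Ext K D A\<^esub> symbol_value K C A D \<delta> (X, u', v)"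
    "r \<in> carrier R \<Longrightarrow> symbol_value K C A D \<delta> (X, r \<odot>\<^bsub>Ext K X A\<^esub> u, v)
    = r \<odot>\<^bsub>Ext K D A\<^esub> symbol_value K C A D \<delta> (X, u, v)"
proof -
  interpret module R "Ext K D A" using assms by (simp add: exten_def ext_module)
  let ?P = "\<lambda>x. mor K x D X \<and> ext_push K C x \<delta> = v"
  have "\<exists>y. mor K y D X \<and> (\<forall>u. symbol_value K C A D \<delta> (X, u, v) = ext_pull K A y u)"
    if "\<exists>x. ?P x"
    using someI_ex[OF that] that by (auto simp: symbol_value_def)
  then consider y where "mor K y D X" "\<And>u. symbol_value K C A D \<delta> (X, u, v) = ext_pull K A y u"
    | "\<And>u. symbol_value K C A D \<delta> (X, u, v) = \<zero>\<^bsub>Ext K D A\<^esub>"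
    by (cases "\<exists>x. ?P x") (auto simp: symbol_value_def)
  note cases = this
  show "symbol_value K C A D \<delta> (X, u \<oplus>\<^bsub>Ext K X A\<^esub> u', v)
    = symbol_value K C A D \<delta> (X, u, v) \<oplus>\<^bsub>Ext K D A\<^esub> symbol_value K C A D \<delta> (X, u', v)"
    by (rule cases) (use pull_add[OF assms(1,2)] in auto)
  show "symbol_value K C A D \<delta> (X, r \<odot>\<^bsub>Ext K X A\<^esub> u, v)
    = r \<odot>\<^bsub>Ext K D A\<^esub> symbol_value K C A D \<delta> (X, u, v)" if "r \<in> carrier R"
    by (rule cases) (use pull_smult[OF assms(1) _ that] that in auto)
qed

text \<open>Relations in \<open>u\<close> hold at every stage. Those that involve several \<open>v\<close>, and the coend relations, hold
  once the \<open>v\<close> have lifts: \<open>x + x'\<close> lifts \<open>v + v'\<close>, \<open>r x\<close> lifts \<open>r v\<close>, and \<open>x \<circ> y\<close> lifts \<open>x\<^sub>*v\<close> if \<open>y\<close>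
  lifts \<open>v\<close>. By \<open>symbol_value_lift\<close> these may replace the chosen lifts.\<close>

lemma ext2_relations_eventually_extend:
  assumes o: "C \<in> Obj K" "A \<in> Obj K"
  shows "ext2_tensor_relations R K C A \<union> ext2_coend_relations R K C A \<subseteq> eventually_extends R K C A"
proof -
  let ?F = "ext2_free R K C A"
  let ?t = "\<lambda>X u v. free_gen R (X, u, v)"
  let ?N = "eventually_extends R K C A"
  interpret F: module R ?F unfolding ext2_free_def using ring_R by (rule free_module_module)
  have "?t X (u \<oplus>\<^bsub>Ext K X A\<^esub> u') v \<ominus>\<^bsub>?F\<^esub> (?t X u v \<oplus>\<^bsub>?F\<^esub> ?t X u' v) \<in> ?N"
    if u: "exten K u X A" "exten K u' X A" and v: "exten K v C X" for X u u' v
  proof (rule eventually_extendsI[OF o _ v])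
    note s = symbols_carrier[OF exten_add[OF u] v] symbols_carrier[OF u(1) v] symbols_carrier[OF u(2) v]
    show "?t X (u \<oplus>\<^bsub>Ext K X A\<^esub> u') v \<ominus>\<^bsub>?F\<^esub> (?t X u v \<oplus>\<^bsub>?F\<^esub> ?t X u' v) \<in> carrier ?F"
      using s by simp
    fix D f B g \<delta> d assume "realizes K D f B g C \<delta>" and d: "mor K d D X"
      and "free_module_map R (Ext K D A) (ext2_symbols K C A) (symbol_value K C A D \<delta>)"
      and I: "submodule (restrictions K A f B) R (Ext K D A)"
    then interpret free_module_map R "Ext K D A" "ext2_symbols K C A" "symbol_value K C A D \<delta>" by simp
    have "D \<in> Obj K" using d by (simp add: mor_def)
    then have "free_lift R (Ext K D A) (symbol_value K C A D \<delta>)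
       (?t X (u \<oplus>\<^bsub>Ext K X A\<^esub> u') v \<ominus>\<^bsub>?F\<^esub> (?t X u v \<oplus>\<^bsub>?F\<^esub> ?t X u' v)) =
       symbol_value K C A D \<delta> (X, u \<oplus>\<^bsub>Ext K X A\<^esub> u', v) \<ominus>\<^bsub>Ext K D A\<^esub>
       symbol_value K C A D \<delta> (X, u \<oplus>\<^bsub>Ext K X A\<^esub> u', v)"
      using s symbol_value_linear(1)[OF u]
      unfolding ext2_free_def by (simp add: free_lift_diff free_lift_add free_lift_gen)
    also have "\<dots> = \<zero>\<^bsub>Ext K D A\<^esub>" using s(1) \<theta> by (simp add: Pi_iff a_minus_def M.r_neg)
    also have "\<dots> \<in> restrictions K A f B" using subgroup.one_closed[OF submodule.axioms(1)[OF I]] by simp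
    finally show "free_lift R (Ext K D A) (symbol_value K C A D \<delta>)
       (?t X (u \<oplus>\<^bsub>Ext K X A\<^esub> u') v \<ominus>\<^bsub>?F\<^esub> (?t X u v \<oplus>\<^bsub>?F\<^esub> ?t X u' v)) \<in> restrictions K A f B" .
  qed
  moreover have "?t X (r \<odot>\<^bsub>Ext K X A\<^esub> u) v \<ominus>\<^bsub>?F\<^esub> (r \<odot>\<^bsub>?F\<^esub> ?t X u v) \<in> ?N"
    if u: "exten K u X A" and v: "exten K v C X" and r: "r \<in> carrier R" for X r u v
  proof (rule eventually_extendsI[OF o _ v])
    note s = symbols_carrier[OF exten_smult[OF u r] v] symbols_carrier[OF u v]
    show "?t X (r \<odot>\<^bsub>Ext K X A\<^esub> u) v \<ominus>\<^bsub>?F\<^esub> (r \<odot>\<^bsub>?F\<^esub> ?t X u v) \<in> carrier ?F"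
      using s r by simp
    fix D f B g \<delta> d assume "realizes K D f B g C \<delta>" and d: "mor K d D X"
      and "free_module_map R (Ext K D A) (ext2_symbols K C A) (symbol_value K C A D \<delta>)"
      and I: "submodule (restrictions K A f B) R (Ext K D A)"
    then interpret free_module_map R "Ext K D A" "ext2_symbols K C A" "symbol_value K C A D \<delta>" by simp
    have "D \<in> Obj K" using d by (simp add: mor_def)
    then have "free_lift R (Ext K D A) (symbol_value K C A D \<delta>)
       (?t X (r \<odot>\<^bsub>Ext K X A\<^esub> u) v \<ominus>\<^bsub>?F\<^esub> (r \<odot>\<^bsub>?F\<^esub> ?t X u v)) =
       symbol_value K C A D \<delta> (X, r \<odot>\<^bsub>Ext K X A\<^esub> u, v) \<ominus>\<^bsub>Ext K D A\<^esub>
       symbol_value K C A D \<delta> (X, r \<odot>\<^bsub>Ext K X A\<^esub> u, v)"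
      using s r symbol_value_linear(2)[OF u u]
      unfolding ext2_free_def by (simp add: free_lift_diff free_lift_smult free_lift_gen)
    also have "\<dots> = \<zero>\<^bsub>Ext K D A\<^esub>" using s(1) \<theta> by (simp add: Pi_iff a_minus_def M.r_neg)
    also have "\<dots> \<in> restrictions K A f B" using subgroup.one_closed[OF submodule.axioms(1)[OF I]] by simp
    finally show "free_lift R (Ext K D A) (symbol_value K C A D \<delta>)
       (?t X (r \<odot>\<^bsub>Ext K X A\<^esub> u) v \<ominus>\<^bsub>?F\<^esub> (r \<odot>\<^bsub>?F\<^esub> ?t X u v)) \<in> restrictions K A f B" .
  qed
  moreover have "?t X u (v \<oplus>\<^bsub>Ext K C X\<^esub> v') \<ominus>\<^bsub>?F\<^esub> (?t X u v \<oplus>\<^bsub>?F\<^esub> ?t X u v') \<in> ?N"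
    if u: "exten K u X A" and v: "exten K v C X" "exten K v' C X" for X u v v'
  proof -
    obtain D\<^sub>0 \<delta>\<^sub>0 d\<^sub>1 d\<^sub>2 where D: "exten K \<delta>\<^sub>0 C D\<^sub>0" "mor K d\<^sub>1 D\<^sub>0 X" "mor K d\<^sub>2 D\<^sub>0 X"
      "ext_push K C d\<^sub>1 \<delta>\<^sub>0 = v" "ext_push K C d\<^sub>2 \<delta>\<^sub>0 = v'"
      by (rule common_refinement[OF v])
    show ?thesis
    proof (rule eventually_extendsI[OF o _ D(1)])
      note s = symbols_carrier[OF u exten_add[OF v]] symbols_carrier[OF u v(1)] symbols_carrier[OF u v(2)]
      show "?t X u (v \<oplus>\<^bsub>Ext K C X\<^esub> v') \<ominus>\<^bsub>?F\<^esub> (?t X u v \<oplus>\<^bsub>?F\<^esub> ?t X u v') \<in> carrier ?F"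
        using s by simp
      fix D f B g \<delta> d assume r: "realizes K D f B g C \<delta>" and d: "mor K d D D\<^sub>0" "ext_push K C d \<delta> = \<delta>\<^sub>0"
        and "free_module_map R (Ext K D A) (ext2_symbols K C A) (symbol_value K C A D \<delta>)"
        and I: "submodule (restrictions K A f B) R (Ext K D A)"
      then interpret free_module_map R "Ext K D A" "ext2_symbols K C A" "symbol_value K C A D \<delta>" by simp
      define x y where "x = d\<^sub>1 \<bullet> d" and "y = d\<^sub>2 \<bullet> d"
      note e = realizesD(3)[OF r]
      have x: "mor K x D X" "ext_push K C x \<delta> = v"
        using mor_comp[OF d(1) D(2)] push_push[OF e d(1) D(2)] d D by (simp_all add: x_def)
      have y: "mor K y D X" "ext_push K C y \<delta> = v'"
        using mor_comp[OF d(1) D(3)] push_push[OF e d(1) D(3)] d D by (simp_all add: y_def)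
      have xy: "mor K (x \<oplus>\<^bsub>Hom K D X\<^esub> y) D X" "ext_push K C (x \<oplus>\<^bsub>Hom K D X\<^esub> y) \<delta> = v \<oplus>\<^bsub>Ext K C X\<^esub> v'"
        using mor_add[OF x(1) y(1)] push_add_mor[OF e x(1) y(1)] x y by simp_all
      obtain m\<^sub>1 where m1: "m\<^sub>1 \<in> restrictions K A f B"
        "symbol_value K C A D \<delta> (X, u, v) = ext_pull K A x u \<oplus>\<^bsub>Ext K D A\<^esub> m\<^sub>1"
        by (rule symbol_value_lift[OF r x u])
      obtain m\<^sub>2 where m2: "m\<^sub>2 \<in> restrictions K A f B"
        "symbol_value K C A D \<delta> (X, u, v') = ext_pull K A y u \<oplus>\<^bsub>Ext K D A\<^esub> m\<^sub>2"
        by (rule symbol_value_lift[OF r y u])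
      obtain m where m: "m \<in> restrictions K A f B"
        "symbol_value K C A D \<delta> (X, u, v \<oplus>\<^bsub>Ext K C X\<^esub> v') =
          (ext_pull K A x u \<oplus>\<^bsub>Ext K D A\<^esub> ext_pull K A y u) \<oplus>\<^bsub>Ext K D A\<^esub> m"
        using symbol_value_lift[OF r xy u] pull_add_mor[OF u x(1) y(1)] by metis
      have c: "m \<in> carrier (Ext K D A)" "m\<^sub>1 \<in> carrier (Ext K D A)" "m\<^sub>2 \<in> carrier (Ext K D A)"
        "ext_pull K A x u \<in> carrier (Ext K D A)" "ext_pull K A y u \<in> carrier (Ext K D A)"
        using submoduleE(1)[OF I] m m1 m2 pull_exten[OF u x(1)] pull_exten[OF u y(1)] by (auto simp: exten_def)
      have "free_lift R (Ext K D A) (symbol_value K C A D \<delta>)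
         (?t X u (v \<oplus>\<^bsub>Ext K C X\<^esub> v') \<ominus>\<^bsub>?F\<^esub> (?t X u v \<oplus>\<^bsub>?F\<^esub> ?t X u v')) =
         symbol_value K C A D \<delta> (X, u, v \<oplus>\<^bsub>Ext K C X\<^esub> v') \<ominus>\<^bsub>Ext K D A\<^esub>
         (symbol_value K C A D \<delta> (X, u, v) \<oplus>\<^bsub>Ext K D A\<^esub> symbol_value K C A D \<delta> (X, u, v'))"
        using s unfolding ext2_free_def by (simp add: free_lift_diff free_lift_add free_lift_gen)
      also have "\<dots> = m \<ominus>\<^bsub>Ext K D A\<^esub> (m\<^sub>1 \<oplus>\<^bsub>Ext K D A\<^esub> m\<^sub>2)"
        unfolding m1(2) m2(2) m(2) using c
        by (simp add: a_minus_def M.minus_add M.a_ac M.r_neg2 M.r_neg1 M.r_neg)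
      also have "\<dots> \<in> restrictions K A f B" using m m1 m2 by (intro submodule_diff[OF I])
      finally show "free_lift R (Ext K D A) (symbol_value K C A D \<delta>)
         (?t X u (v \<oplus>\<^bsub>Ext K C X\<^esub> v') \<ominus>\<^bsub>?F\<^esub> (?t X u v \<oplus>\<^bsub>?F\<^esub> ?t X u v')) \<in> restrictions K A f B" .
    qed
  qed
  moreover have "?t X u (r \<odot>\<^bsub>Ext K C X\<^esub> v) \<ominus>\<^bsub>?F\<^esub> (r \<odot>\<^bsub>?F\<^esub> ?t X u v) \<in> ?N"
    if u: "exten K u X A" and v: "exten K v C X" and r: "r \<in> carrier R" for X r u v
  proof (rule eventually_extendsI[OF o _ v])
    note s = symbols_carrier[OF u exten_smult[OF v r]] symbols_carrier[OF u v]
    show "?t X u (r \<odot>\<^bsub>Ext K C X\<^esub> v) \<ominus>\<^bsub>?F\<^esub> (r \<odot>\<^bsub>?F\<^esub> ?t X u v) \<in> carrier ?F"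
      using s r by simp
    fix D f B g \<delta> x assume rl: "realizes K D f B g C \<delta>" and x: "mor K x D X" "ext_push K C x \<delta> = v"
      and "free_module_map R (Ext K D A) (ext2_symbols K C A) (symbol_value K C A D \<delta>)"
      and I: "submodule (restrictions K A f B) R (Ext K D A)"
    then interpret free_module_map R "Ext K D A" "ext2_symbols K C A" "symbol_value K C A D \<delta>" by simp
    note e = realizesD(3)[OF rl]
    interpret H: module R "Hom K D X" using x by (simp add: mor_def hom_module)
    have rx: "mor K (r \<odot>\<^bsub>Hom K D X\<^esub> x) D X" "ext_push K C (r \<odot>\<^bsub>Hom K D X\<^esub> x) \<delta> = r \<odot>\<^bsub>Ext K C X\<^esub> v"
      using x r push_smult_mor[OF e x(1) r] by (simp_all add: mor_def)
    obtain m\<^sub>1 where m1: "m\<^sub>1 \<in> restrictions K A f B"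
      "symbol_value K C A D \<delta> (X, u, v) = ext_pull K A x u \<oplus>\<^bsub>Ext K D A\<^esub> m\<^sub>1"
      by (rule symbol_value_lift[OF rl x u])
    obtain m where m: "m \<in> restrictions K A f B"
      "symbol_value K C A D \<delta> (X, u, r \<odot>\<^bsub>Ext K C X\<^esub> v) = r \<odot>\<^bsub>Ext K D A\<^esub> ext_pull K A x u \<oplus>\<^bsub>Ext K D A\<^esub> m"
      using symbol_value_lift[OF rl rx u] pull_smult_mor[OF u x(1) r] by metis
    have c: "m \<in> carrier (Ext K D A)" "m\<^sub>1 \<in> carrier (Ext K D A)" "ext_pull K A x u \<in> carrier (Ext K D A)"
      using submoduleE(1)[OF I] m m1 pull_exten[OF u x(1)] by (auto simp: exten_def)
    have "free_lift R (Ext K D A) (symbol_value K C A D \<delta>)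
       (?t X u (r \<odot>\<^bsub>Ext K C X\<^esub> v) \<ominus>\<^bsub>?F\<^esub> (r \<odot>\<^bsub>?F\<^esub> ?t X u v)) =
       symbol_value K C A D \<delta> (X, u, r \<odot>\<^bsub>Ext K C X\<^esub> v) \<ominus>\<^bsub>Ext K D A\<^esub>
       r \<odot>\<^bsub>Ext K D A\<^esub> symbol_value K C A D \<delta> (X, u, v)"
      using s r unfolding ext2_free_def by (simp add: free_lift_diff free_lift_smult free_lift_gen)
    also have "\<dots> = m \<ominus>\<^bsub>Ext K D A\<^esub> r \<odot>\<^bsub>Ext K D A\<^esub> m\<^sub>1"
      unfolding m1(2) m(2) using c r
      by (simp add: a_minus_def smult_r_distr M.minus_add M.a_ac M.r_neg2 M.r_neg1 M.r_neg)
    also have "\<dots> \<in> restrictions K A f B"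
      using m m1 r submoduleE(4)[OF I] by (intro submodule_diff[OF I]) auto
    finally show "free_lift R (Ext K D A) (symbol_value K C A D \<delta>)
       (?t X u (r \<odot>\<^bsub>Ext K C X\<^esub> v) \<ominus>\<^bsub>?F\<^esub> (r \<odot>\<^bsub>?F\<^esub> ?t X u v)) \<in> restrictions K A f B" .
  qed
  moreover have "?t X (ext_pull K A x u) v \<ominus>\<^bsub>?F\<^esub> ?t X' u (ext_push K C x v) \<in> ?N"
    if x: "mor K x X X'" and u: "exten K u X' A" and v: "exten K v C X" for X X' x u v
  proof (rule eventually_extendsI[OF o _ v])
    note xu = pull_exten[OF u x] and xv = push_exten[OF v x]
    note s = symbols_carrier[OF xu v] symbols_carrier[OF u xv]
    show "?t X (ext_pull K A x u) v \<ominus>\<^bsub>?F\<^esub> ?t X' u (ext_push K C x v) \<in> carrier ?F"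
      using s by simp
    fix D f B g \<delta> y assume rl: "realizes K D f B g C \<delta>" and y: "mor K y D X" "ext_push K C y \<delta> = v"
      and "free_module_map R (Ext K D A) (ext2_symbols K C A) (symbol_value K C A D \<delta>)"
      and I: "submodule (restrictions K A f B) R (Ext K D A)"
    then interpret free_module_map R "Ext K D A" "ext2_symbols K C A" "symbol_value K C A D \<delta>" by simp
    note e = realizesD(3)[OF rl]
    have xy: "mor K (x \<bullet> y) D X'" "ext_push K C (x \<bullet> y) \<delta> = ext_push K C x v"
      using mor_comp[OF y(1) x] push_push[OF e y(1) x] y by simp_all
    obtain m\<^sub>1 where m1: "m\<^sub>1 \<in> restrictions K A f B"
      "symbol_value K C A D \<delta> (X, ext_pull K A x u, v) = ext_pull K A (x \<bullet> y) u \<oplus>\<^bsub>Ext K D A\<^esub> m\<^sub>1"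
      using symbol_value_lift[OF rl y xu] pull_pull[OF u x y(1)] by metis
    obtain m where m: "m \<in> restrictions K A f B"
      "symbol_value K C A D \<delta> (X', u, ext_push K C x v) = ext_pull K A (x \<bullet> y) u \<oplus>\<^bsub>Ext K D A\<^esub> m"
      by (rule symbol_value_lift[OF rl xy u])
    have c: "m \<in> carrier (Ext K D A)" "m\<^sub>1 \<in> carrier (Ext K D A)" "ext_pull K A (x \<bullet> y) u \<in> carrier (Ext K D A)"
      using submoduleE(1)[OF I] m m1 pull_exten[OF u xy(1)] by (auto simp: exten_def)
    have "free_lift R (Ext K D A) (symbol_value K C A D \<delta>)
       (?t X (ext_pull K A x u) v \<ominus>\<^bsub>?F\<^esub> ?t X' u (ext_push K C x v)) =
       symbol_value K C A D \<delta> (X, ext_pull K A x u, v) \<ominus>\<^bsub>Ext K D A\<^esub>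
       symbol_value K C A D \<delta> (X', u, ext_push K C x v)"
      using s unfolding ext2_free_def by (simp add: free_lift_diff free_lift_gen)
    also have "\<dots> = m\<^sub>1 \<ominus>\<^bsub>Ext K D A\<^esub> m"
      unfolding m1(2) m(2) using c
      by (simp add: a_minus_def M.minus_add M.a_ac M.r_neg2 M.r_neg1 M.r_neg)
    also have "\<dots> \<in> restrictions K A f B" using m m1 by (intro submodule_diff[OF I])
    finally show "free_lift R (Ext K D A) (symbol_value K C A D \<delta>)
       (?t X (ext_pull K A x u) v \<ominus>\<^bsub>?F\<^esub> ?t X' u (ext_push K C x v)) \<in> restrictions K A f B" .
  qed
  ultimately show ?thesis
    using o unfolding ext2_tensor_relations_def ext2_coend_relations_def Let_def exten_def mor_def
    by auto
qed

text \<open>Injectivity of a cokernel into the colimit: if \<open>u\<close> becomes extendable after a refinement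
  \<open>a : D' \<rightarrow> D\<close>, it is already extendable. The kernel \<open>E\<close> of \<open>W \<rightarrow> B' \<rightarrow> C\<close>, where \<open>W\<close> is the middle term of
  \<open>w\<close>, has class \<open>f'\<^sup>*w = a\<^sup>*u\<close> as an extension of \<open>D'\<close> by \<open>A\<close>, so that \<open>E\<close> maps to the middle term
  \<open>U\<close> of \<open>u\<close> over \<open>a\<close>. Pushing \<open>E \<rightarrow> W \<rightarrow> C\<close> forward to \<open>U\<close> gives a lift of \<open>\<delta>\<close> along
  \<open>U \<rightarrow> D\<close>, and (ET4) turns such a lift into an extension of \<open>u\<close> to \<open>B\<close>.\<close>

lemma extension_descends:
  assumes r: "realizes K D f B g C \<delta>" and r': "realizes K D' f' B' g' C \<delta>'"
    and a: "mor K a D' D" "ext_push K C a \<delta>' = \<delta>"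
    and u: "exten K u D A" and w: "exten K w B' A" and uw: "ext_pull K A a u = ext_pull K A f' w"
  obtains w' where "exten K w' B A" "u = ext_pull K A f w'"
proof -
  have A: "A \<in> Obj K" using u by (simp add: exten_def)
  note d' = realizesD[OF r']
  obtain k W l where W: "realizes K A k W l B' w" by (rule realization_exists[OF w])
  obtain m U t where U: "realizes K A m U t D u" by (rule realization_exists[OF u])
  obtain E h d e \<epsilon> where E: "mor K d E D'" "realizes K E h W (g' \<bullet> l) C \<epsilon>"
    "realizes K A e E d D' (ext_pull K A f' w)" "ext_push K C d \<epsilon> = \<delta>'"
    by (rule ET4_op_mor[OF r' W])
  note eps = realizesD(3)[OF E(2)]
  obtain n where n: "mor K n E U" "t \<bullet> n = a \<bullet> d"
    by (rule fill_middle[OF E(3) U mor_id[OF A] a(1)])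
       (use push_id[OF pull_exten[OF w d'(1)]] uw in auto)
  have t: "mor K t U D" using realizesD[OF U] by simp
  have push: "ext_push K C t (ext_push K C n \<epsilon>) = \<delta>"
    using push_push[OF eps n(1) t] push_push[OF eps E(1) a(1)] n E a by simp
  obtain k' W' l' where W': "realizes K U k' W' l' C (ext_push K C n \<epsilon>)"
    by (rule realization_exists[OF push_exten[OF eps n(1)]])
  obtain E' h' d'' e' \<eta> where E': "realizes K A (k' \<bullet> m) W' h' E' \<eta>"
    "realizes K D d'' E' e' C (ext_push K C t (ext_push K C n \<epsilon>))" "ext_pull K A d'' \<eta> = u"
    by (rule ET4_mor[OF U W'])
  note eta = realizesD(3)[OF E'(1)]
  obtain b where b: "mor K b B E'" "b \<bullet> f = d''"
    using realizes_iso[OF r E'(2)[unfolded push]] by metis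
  have "u = ext_pull K A f (ext_pull K A b \<eta>)"
    using pull_pull[OF eta b(1) realizesD(1)[OF r]] b E' by simp
  then show ?thesis using that pull_exten[OF eta b(1)] by blast
qed

text \<open>Since \<open>u \<otimes> \<delta>\<close> is zero, its value is a restriction at some stage. On a common refinement of that stage
  with \<open>\<delta>\<close> the value is \<open>a\<^sup>*u\<close> up to restrictions, and extendability descends to \<open>\<delta>\<close>.\<close>

lemma ext2_vanishing_extends:
  assumes van: "ext2_vanishes R K {C} {A}" and A: "A \<in> Obj K"
    and r: "realizes K D f B g C \<delta>" and u: "exten K u D A"
  obtains w where "exten K w B A" "u = ext_pull K A f w"
proof -
  note d = realizesD[OF r]
  have o: "C \<in> Obj K" using d by (simp add: mor_def)
  have "free_gen R (D, u, \<delta>) \<in> eventually_extends R K C A"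
    by (rule ext2_vanishesD[OF ring_R van eventually_extends_submodule[OF o A]
        ext2_relations_eventually_extend[OF o A] symbols_carrier(2)[OF u d(3)]])
  then obtain D\<^sub>1 \<delta>\<^sub>1 where 1: "exten K \<delta>\<^sub>1 C D\<^sub>1" and *: "\<And>D' f' B' g' \<delta>' d'. realizes K D' f' B' g' C \<delta>' \<Longrightarrow>
     mor K d' D' D\<^sub>1 \<Longrightarrow> ext_push K C d' \<delta>' = \<delta>\<^sub>1 \<Longrightarrow>
     free_lift R (Ext K D' A) (symbol_value K C A D' \<delta>') (free_gen R (D, u, \<delta>)) \<in> restrictions K A f' B'"
    unfolding eventually_extends_def by blast
  obtain D' \<delta>' a d' where D': "exten K \<delta>' C D'" "mor K a D' D" "mor K d' D' D\<^sub>1"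
      "ext_push K C a \<delta>' = \<delta>" "ext_push K C d' \<delta>' = \<delta>\<^sub>1"
    by (rule common_refinement[OF d(3) 1])
  obtain f' B' g' where r': "realizes K D' f' B' g' C \<delta>'" by (rule realization_exists[OF D'(1)])
  note d1 = realizesD[OF r']
  have D'o: "D' \<in> Obj K" using D' by (simp add: exten_def)
  interpret free_module_map R "Ext K D' A" "ext2_symbols K C A" "symbol_value K C A D' \<delta>'"
    using D'o A by (intro free_module_map.intro free_module_map_axioms.intro ext_module symbol_value_closed)
  note I = restrictions_submodule[OF d1(1) A]
  have val: "symbol_value K C A D' \<delta>' (D, u, \<delta>) \<in> restrictions K A f' B'"
    using *[OF r' D'(3,5)] free_lift_gen[OF symbols_carrier(1)[OF u d(3)]] by simp
  obtain m where m: "m \<in> restrictions K A f' B'"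
    "symbol_value K C A D' \<delta>' (D, u, \<delta>) = ext_pull K A a u \<oplus>\<^bsub>Ext K D' A\<^esub> m"
    by (rule symbol_value_lift[OF r' D'(2,4) u])
  have "ext_pull K A a u = symbol_value K C A D' \<delta>' (D, u, \<delta>) \<ominus>\<^bsub>Ext K D' A\<^esub> m"
    using m submoduleE(1)[OF I] pull_exten[OF u D'(2)]
    by (auto simp: M.add_minus_cancel exten_def)
  then have "ext_pull K A a u \<in> restrictions K A f' B'"
    using submodule_diff(1)[OF I val m(1)] by simp
  then obtain w where "exten K w B' A" "ext_pull K A a u = ext_pull K A f' w"
    using d1(1) A by (auto simp: restrictions_def exten_def mor_def)
  then show ?thesis using extension_descends[OF r r' D'(2,4) u] that by metis
qed

end

section \<open>Perpendicular subcategories and cotorsion pairs\<close>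

definition left_perp :: "('r, 'o, 'm, 'e) ext_cat \<Rightarrow> 'o set \<Rightarrow> 'o set"
  where "left_perp K \<Y> = {M \<in> Obj K. ext_vanishes K {M} \<Y>}"

definition cocone_closed :: "('r, 'o, 'm, 'e) ext_cat \<Rightarrow> 'o set \<Rightarrow> bool"
  where "cocone_closed K \<X> \<longleftrightarrow> (\<forall>A f B g C. conflation K A f B g C \<longrightarrow> B \<in> \<X> \<longrightarrow> C \<in> \<X> \<longrightarrow> A \<in> \<X>)"

lemma left_perp_antimono: "\<Y> \<subseteq> \<Y>' \<Longrightarrow> left_perp K \<Y>' \<subseteq> left_perp K \<Y>"
  by (auto simp: left_perp_def ext_vanishes_def)

lemma ext_vanishes_left_perp: "\<X> \<subseteq> Obj K \<Longrightarrow> ext_vanishes K \<X> \<Y> \<longleftrightarrow> \<X> \<subseteq> left_perp K \<Y>"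
  by (auto simp: left_perp_def ext_vanishes_def)

lemma ext_vanishesD:
  "ext_vanishes K \<X> \<Y> \<Longrightarrow> X \<in> \<X> \<Longrightarrow> Y \<in> \<Y> \<Longrightarrow> exten K z X Y \<Longrightarrow> z = \<zero>\<^bsub>Ext K X Y\<^esub>"
  by (auto simp: ext_vanishes_def exten_def)

lemma subcategoryD:
  assumes "subcategory K \<S>"
  shows "\<S> \<subseteq> Obj K" "A \<in> \<S> \<Longrightarrow> B \<in> Obj K \<Longrightarrow> isomorphic K A B \<Longrightarrow> B \<in> \<S>"
    "\<exists>Z \<in> \<S>. zero_object K Z"
    "A \<in> \<S> \<Longrightarrow> B \<in> \<S> \<Longrightarrow> biproduct K A B S i j p q \<Longrightarrow> S \<in> \<S>"
  using assms unfolding subcategory_def by blast+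

lemma cotorsion_pairD:
  assumes "cotorsion_pair K \<X> \<Y>"
  shows "subcategory K \<X>" "subcategory K \<Y>" "summand_closed K \<X>" "summand_closed K \<Y>"
    "ext_vanishes K \<X> \<Y>" "Obj K = Cone K \<Y> \<X>" "Obj K = Cocone K \<Y> \<X>"
  using assms by (auto simp: cotorsion_pair_def)

lemma op_ext_vanishes: "ext_vanishes (op_cat K) \<Y> \<X> \<longleftrightarrow> ext_vanishes K \<X> \<Y>"
  by (auto simp: ext_vanishes_def op_cat_simps)

lemma op_summand: "summand (op_cat K) A M \<longleftrightarrow> summand K A M"
  unfolding summand_def op_biproduct by blast

lemma op_summand_closed: "summand_closed (op_cat K) \<S> \<longleftrightarrow> summand_closed K \<S>"
  by (simp add: summand_closed_def op_summand)

lemma op_subcategory: "subcategory (op_cat K) \<S> \<longleftrightarrow> subcategory K \<S>"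
proof -
  have 1: "(\<forall>A\<in>\<S>. \<forall>B\<in>Obj K. isomorphic (op_cat K) A B \<longrightarrow> B \<in> \<S>) \<longleftrightarrow>
    (\<forall>A\<in>\<S>. \<forall>B\<in>Obj K. isomorphic K A B \<longrightarrow> B \<in> \<S>)" if "\<S> \<subseteq> Obj K"
    using that op_isomorphic[of _ K] by (meson subsetD)
  have 2: "(\<exists>i j p q. biproduct (op_cat K) A B S i j p q) \<longleftrightarrow> (\<exists>i j p q. biproduct K A B S i j p q)" for A B S
    unfolding op_biproduct by blast
  show ?thesis
    by (cases "\<S> \<subseteq> Obj K") (simp_all add: subcategory_def op_zero_object op_cat_simps(1) 1 2)
qed

lemma op_add_closure: "add_closure (op_cat K) \<X> = add_closure K \<X>"
  by (simp add: add_closure_def op_subcategory op_summand_closed)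

context linear_category
begin

lemma zero_object_iff:
  assumes "Z \<in> Obj K"
  shows "zero_object K Z \<longleftrightarrow> Ident K Z = \<zero>\<^bsub>Hom K Z Z\<^esub>"
proof
  show "zero_object K Z \<Longrightarrow> Ident K Z = \<zero>\<^bsub>Hom K Z Z\<^esub>"
    using assms ident_arr[OF assms] mor_zero[OF assms assms] by (auto simp: zero_object_def mor_def)
  assume id: "Ident K Z = \<zero>\<^bsub>Hom K Z Z\<^esub>"
  have "f = \<zero>\<^bsub>Hom K Z A\<^esub>" if "A \<in> Obj K" "f \<in> arr K Z A" for A f
    using id_right[of f Z A] comp_zero_right[of Z f Z A] that assms id by (simp add: mor_def)
  moreover have "f = \<zero>\<^bsub>Hom K A Z\<^esub>" if "A \<in> Obj K" "f \<in> arr K A Z" for A f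
    using id_left[of f A Z] comp_zero_left[of Z f A Z] that assms id by (simp add: mor_def)
  moreover have "\<zero>\<^bsub>Hom K Z A\<^esub> \<in> arr K Z A" "\<zero>\<^bsub>Hom K A Z\<^esub> \<in> arr K A Z" if "A \<in> Obj K" for A
    using mor_zero assms that by (simp_all add: mor_def)
  ultimately show "zero_object K Z"
    unfolding zero_object_def using assms by blast
qed

lemma zero_objects_isomorphic:
  assumes "zero_object K Z" "zero_object K Z'" shows "isomorphic K Z Z'"
proof -
  have o: "Z \<in> Obj K" "Z' \<in> Obj K" using assms by (auto simp: zero_object_def)
  have m: "mor K \<zero>\<^bsub>Hom K Z Z'\<^esub> Z Z'" "mor K \<zero>\<^bsub>Hom K Z' Z\<^esub> Z' Z" using o by (auto intro: mor_zero)
  have "iso_arr K Z Z' \<zero>\<^bsub>Hom K Z Z'\<^esub>"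
    using m comp_zero_left[OF o(1) m(1)] comp_zero_left[OF o(2) m(2)] assms o
    by (intro iso_arrI[OF m]) (simp_all add: zero_object_iff)
  then show ?thesis by (auto simp: isomorphic_def)
qed

lemma subcategory_zero: 
  assumes "subcategory K \<S>" "zero_object K Z" shows "Z \<in> \<S>"
proof -
  obtain Z' where "Z' \<in> \<S>" "zero_object K Z'" using subcategoryD(3)[OF assms(1)] by blast
  moreover have "Z \<in> Obj K" using assms(2) by (simp add: zero_object_def)
  ultimately show ?thesis
    using zero_objects_isomorphic[OF _ assms(2)] subcategoryD(2)[OF assms(1)] by blast
qed

end

context additive_category
begin

text \<open>An intersection is nonempty because every subcategory contains all zero objects.\<close>

lemma subcategory_Inter:
  assumes "F \<noteq> {}" "\<And>\<S>. \<S> \<in> F \<Longrightarrow> subcategory K \<S>" shows "subcategory K (\<Inter>F)"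
proof -
  obtain Z where Z: "zero_object K Z" using zero_object_exists by blast
  show ?thesis
    unfolding subcategory_def
  proof (intro conjI ballI allI impI)
    show "\<Inter>F \<subseteq> Obj K" using assms(1) subcategoryD(1)[OF assms(2)] by (simp add: Inf_less_eq)
    show "\<exists>Z\<in>\<Inter>F. zero_object K Z" using Z subcategory_zero[OF assms(2) Z] by blast
    show "B \<in> \<Inter>F" if "A \<in> \<Inter>F" "B \<in> Obj K" "isomorphic K A B" for A B
    proof
      fix \<S> assume "\<S> \<in> F"
      then show "B \<in> \<S>" using subcategoryD(2)[OF assms(2) _ that(2,3)] that(1) by simp
    qed
    show "S \<in> \<Inter>F" if "A \<in> \<Inter>F" "B \<in> \<Inter>F" "biproduct K A B S i j p q" for A B S i j p q
    proof
      fix \<S> assume "\<S> \<in> F"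
      then show "S \<in> \<S>" using subcategoryD(4)[OF assms(2) _ _ that(3)] that(1,2) by simp
    qed
  qed
qed

lemma subcategory_Int: "subcategory K \<S> \<Longrightarrow> subcategory K \<T> \<Longrightarrow> subcategory K (\<S> \<inter> \<T>)"
  using subcategory_Inter[of "{\<S>, \<T>}"] by auto

lemma subcategory_Obj: "subcategory K (Obj K)"
  using zero_object_exists by (auto simp: subcategory_def biproduct_def zero_object_def)

lemma add_closure:
  assumes "\<X> \<subseteq> Obj K"
  shows "subcategory K (add_closure K \<X>)" "summand_closed K (add_closure K \<X>)" "\<X> \<subseteq> add_closure K \<X>"
proof -
  have "summand_closed K (Obj K)" by (auto simp: summand_closed_def summand_def biproduct_def)
  then have "Obj K \<in> {\<S>. subcategory K \<S> \<and> summand_closed K \<S> \<and> \<X> \<subseteq> \<S>}"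
    using subcategory_Obj assms by simp
  then show "subcategory K (add_closure K \<X>)"
    unfolding add_closure_def by (intro subcategory_Inter) auto
  show "summand_closed K (add_closure K \<X>)"
    unfolding add_closure_def summand_closed_def by blast
  show "\<X> \<subseteq> add_closure K \<X>" by (auto simp: add_closure_def)
qed

lemma add_closure_least:
  "subcategory K \<S> \<Longrightarrow> summand_closed K \<S> \<Longrightarrow> \<X> \<subseteq> \<S> \<Longrightarrow> add_closure K \<X> \<subseteq> \<S>"
  by (auto simp: add_closure_def)

end

context extriangulated_category
begin

lemma ext_vanishesI:
  assumes "\<X> \<subseteq> Obj K" "\<Y> \<subseteq> Obj K"
    "\<And>X Y z. X \<in> \<X> \<Longrightarrow> Y \<in> \<Y> \<Longrightarrow> exten K z X Y \<Longrightarrow> z = \<zero>\<^bsub>Ext K X Y\<^esub>"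
  shows "ext_vanishes K \<X> \<Y>"
  using assms exten_zero unfolding ext_vanishes_def exten_def by blast

lemma op_conflation: "conflation (op_cat K) C g B f A = conflation K A f B g C"
  by (simp add: conflation_def op_realizes)

lemma op_Cone: "Cone (op_cat K) \<X> \<Y> = Cocone K \<Y> \<X>" "Cocone (op_cat K) \<X> \<Y> = Cone K \<Y> \<X>"
  "star (op_cat K) \<X> \<Y> = star K \<Y> \<X>"
  by (auto simp: Cone_def Cocone_def star_def op_conflation)

lemma op_cotorsion_pair: "cotorsion_pair (op_cat K) \<Y> \<X> \<longleftrightarrow> cotorsion_pair K \<X> \<Y>"
  by (auto simp: cotorsion_pair_def op_subcategory op_summand_closed op_ext_vanishes op_Cone op_cat_simps)

lemma conflation_obj:
  assumes "conflation K A f B g C" shows "A \<in> Obj K" "B \<in> Obj K" "C \<in> Obj K"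
  using assms realizesD by (auto simp: conflation_def mor_def)

lemma trivial_conflation:
  assumes "zero_object K Z" "M \<in> Obj K" 
  obtains f g where "conflation K Z f M g M"
  using real_zero[OF biproduct_swap[OF biproduct_zero_right[OF assms]]] unfolding conflation_def by blast

lemma left_perp_subcategory:
  assumes Y: "\<Y> \<subseteq> Obj K" shows "subcategory K (left_perp K \<Y>)"
  unfolding subcategory_def
proof (intro conjI ballI allI impI)
  show "left_perp K \<Y> \<subseteq> Obj K" by (auto simp: left_perp_def)
  show "\<exists>Z\<in>left_perp K \<Y>. zero_object K Z"
  proof -
    obtain Z where Z: "zero_object K Z" using zero_object_exists by blast
    have o: "Z \<in> Obj K" using Z by (simp add: zero_object_def)
    have "z = \<zero>\<^bsub>Ext K Z N\<^esub>" if "exten K z Z N" for N z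
      using pull_id[OF that] pull_zero_mor[OF that o] Z zero_object_iff[OF o] by simp
    then show ?thesis
      using o Z Y by (auto simp: left_perp_def intro!: bexI[of _ Z] ext_vanishesI)
  qed
  fix A B assume A: "A \<in> left_perp K \<Y>" and B: "B \<in> Obj K" "isomorphic K A B"
  have v: "ext_vanishes K {A} \<Y>" and o: "A \<in> Obj K" using A by (simp_all add: left_perp_def)
  obtain f g where f: "mor K f A B" "mor K g B A" "f \<bullet> g = Ident K B"
    using B o iso_arrD unfolding isomorphic_def by metis
  have "z = \<zero>\<^bsub>Ext K B N\<^esub>" if N: "N \<in> \<Y>" and z: "exten K z B N" for N z
  proof -
    have "z = ext_pull K N g (ext_pull K N f z)" using pull_pull[OF z f(1,2)] f pull_id[OF z] by simp
    also have "\<dots> = \<zero>\<^bsub>Ext K B N\<^esub>"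
      using ext_vanishesD[OF v _ N pull_exten[OF z f(1)]] pull_zero[OF _ f(2)] N Y by auto
    finally show ?thesis .
  qed
  then show "B \<in> left_perp K \<Y>" using B Y by (auto simp: left_perp_def intro: ext_vanishesI)
next
  fix A B S i j p q
  assume A: "A \<in> left_perp K \<Y>" "B \<in> left_perp K \<Y>" and "biproduct K A B S i j p q"
  note b = biproductD[OF this(3)]
  have S: "S \<in> Obj K" using b by (simp add: mor_def)
  have v: "ext_vanishes K {A} \<Y>" "ext_vanishes K {B} \<Y>" using A by (simp_all add: left_perp_def)
  have "z = \<zero>\<^bsub>Ext K S N\<^esub>" if N: "N \<in> \<Y>" and z: "exten K z S N" for N z
  proof -
    have No: "N \<in> Obj K" using N Y by auto
    interpret abelian_group "Ext K S N" using S No by (simp add: ext_group)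
    have "z = ext_pull K N (i \<bullet> p \<oplus>\<^bsub>Hom K S S\<^esub> j \<bullet> q) z" using b pull_id[OF z] by simp
    also have "\<dots> = ext_pull K N p (ext_pull K N i z) \<oplus>\<^bsub>Ext K S N\<^esub> ext_pull K N q (ext_pull K N j z)"
      using pull_add_mor[OF z mor_comp[OF b(3,1)] mor_comp[OF b(4,2)]] pull_pull[OF z b(1,3)] pull_pull[OF z b(2,4)]
      by simp
    also have "\<dots> = \<zero>\<^bsub>Ext K S N\<^esub>"
      using ext_vanishesD[OF v(1) _ N pull_exten[OF z b(1)]] ext_vanishesD[OF v(2) _ N pull_exten[OF z b(2)]]
        pull_zero[OF No b(3)] pull_zero[OF No b(4)] by simp
    finally show ?thesis .
  qed
  then show "S \<in> left_perp K \<Y>" using S Y by (auto simp: left_perp_def intro: ext_vanishesI)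
qed

lemma left_perp_summand_closed:
  assumes Y: "\<Y> \<subseteq> Obj K" shows "summand_closed K (left_perp K \<Y>)"
  unfolding summand_closed_def summand_def
proof (intro ballI allI impI, elim exE)
  fix M A B i j p q assume M: "M \<in> left_perp K \<Y>" and "biproduct K A B M i j p q"
  note b = biproductD[OF this(2)]
  have A: "A \<in> Obj K" using b by (simp add: mor_def)
  have v: "ext_vanishes K {M} \<Y>" using M by (simp add: left_perp_def)
  have "z = \<zero>\<^bsub>Ext K A N\<^esub>" if N: "N \<in> \<Y>" and z: "exten K z A N" for N z
  proof -
    have No: "N \<in> Obj K" using N Y by auto
    have "z = ext_pull K N i (ext_pull K N p z)" using pull_pull[OF z b(3,1)] b pull_id[OF z] by simp
    also have "\<dots> = \<zero>\<^bsub>Ext K A N\<^esub>"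
      using ext_vanishesD[OF v _ N pull_exten[OF z b(3)]] pull_zero[OF No b(1)] by simp
    finally show ?thesis .
  qed
  then show "A \<in> left_perp K \<Y>" using A Y by (auto simp: left_perp_def intro: ext_vanishesI)
qed

text \<open>Half-exactness of \<open>\<bbbE>(-, N)\<close> for each \<open>N \<in> \<Y>\<close>.\<close>

lemma left_perp_extension:
  assumes Y: "\<Y> \<subseteq> Obj K" and "conflation K A f B g C" and A: "A \<in> left_perp K \<Y>" and C: "C \<in> left_perp K \<Y>"
  shows "B \<in> left_perp K \<Y>"
proof -
  obtain \<delta> where r: "realizes K A f B g C \<delta>" using assms by (auto simp: conflation_def)
  note d = realizesD[OF r]
  have v: "ext_vanishes K {A} \<Y>" "ext_vanishes K {C} \<Y>" using A C by (simp_all add: left_perp_def)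
  have "z = \<zero>\<^bsub>Ext K B N\<^esub>" if N: "N \<in> \<Y>" and z: "exten K z B N" for N z
  proof -
    obtain y where y: "exten K y C N" "z = ext_pull K N g y"
      using ext_exact_middle_op[OF r z] ext_vanishesD[OF v(1) _ N pull_exten[OF z d(1)]] by auto
    then show ?thesis
      using ext_vanishesD[OF v(2) _ N y(1)] pull_zero[OF _ d(2)] N Y by auto
  qed
  then show ?thesis using d Y by (auto simp: left_perp_def mor_def intro: ext_vanishesI)
qed

lemma ext_vanishes_add_left:
  assumes "\<Y> \<subseteq> Obj K" "\<X> \<subseteq> Obj K" "ext_vanishes K \<X> \<Y>"
  shows "ext_vanishes K (add_closure K \<X>) \<Y>"
proof -
  have "\<X> \<subseteq> left_perp K \<Y>" using assms(3) ext_vanishes_left_perp[OF assms(2)] by simp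
  then have "add_closure K \<X> \<subseteq> left_perp K \<Y>"
    by (rule add_closure_least[OF left_perp_subcategory[OF assms(1)] left_perp_summand_closed[OF assms(1)]])
  then show ?thesis
    using ext_vanishes_left_perp[OF subcategoryD(1)[OF add_closure(1)[OF assms(2)]]] by simp
qed

lemma ext_vanishes_add_right:
  assumes "\<Y> \<subseteq> Obj K" "\<X> \<subseteq> Obj K" "ext_vanishes K \<X> \<Y>"
  shows "ext_vanishes K \<X> (add_closure K \<Y>)"
  using extriangulated_category.ext_vanishes_add_left[OF extriangulated_op, of \<X> \<Y>] assms
  by (simp add: op_cat_simps op_ext_vanishes op_add_closure)

lemma ext_vanishes_star_left:
  assumes Y: "\<Y> \<subseteq> Obj K" and "\<A> \<subseteq> Obj K" "\<B> \<subseteq> Obj K" "ext_vanishes K \<A> \<Y>" "ext_vanishes K \<B> \<Y>"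
  shows "ext_vanishes K (star K \<A> \<B>) \<Y>"
proof -
  have "star K \<A> \<B> \<subseteq> left_perp K \<Y>"
    using left_perp_extension[OF Y] ext_vanishes_left_perp[OF assms(2), of \<Y>]
      ext_vanishes_left_perp[OF assms(3), of \<Y>] assms(4,5) unfolding star_def by blast
  then show ?thesis by (auto simp: left_perp_def ext_vanishes_def)
qed

lemma ext_vanishes_star_right:
  assumes "\<X> \<subseteq> Obj K" "\<A> \<subseteq> Obj K" "\<B> \<subseteq> Obj K" "ext_vanishes K \<X> \<A>" "ext_vanishes K \<X> \<B>"
  shows "ext_vanishes K \<X> (star K \<A> \<B>)"
  using extriangulated_category.ext_vanishes_star_left[OF extriangulated_op, of \<X> \<B> \<A>] assms
  by (simp add: op_cat_simps op_ext_vanishes op_Cone)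

text \<open>The class of the conflation lies in \<open>\<bbbE>(M, Y) = 0\<close>, so the conflation splits.\<close>

lemma Cone_perp_summand:
  assumes "conflation K Y f X g M" and "ext_vanishes K {M} {Y}" shows "summand K M X"
proof -
  obtain \<delta> where r: "realizes K Y f X g M \<delta>" using assms by (auto simp: conflation_def)
  have "\<delta> = \<zero>\<^bsub>Ext K M Y\<^esub>" using ext_vanishesD[OF assms(2) _ _ realizesD(3)[OF r]] by simp
  then obtain j p where "biproduct K Y M X f j p g" using r realizes_zero_split by metis
  then show ?thesis using biproduct_swap unfolding summand_def by blast
qed

text \<open>An object \<open>M\<close> orthogonal to \<open>\<Y>\<close> splits off its approximation \<open>Y \<rightarrow> X \<rightarrow> M\<close>. Thus a cotorsion pair is
  determined by either component, and both components are closed under extensions.\<close>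

lemma cotorsion_left_perp:
  assumes c: "cotorsion_pair K \<X> \<Y>" shows "\<X> = left_perp K \<Y>"
proof
  note cd = cotorsion_pairD[OF c]
  show "\<X> \<subseteq> left_perp K \<Y>" using cd(5) ext_vanishes_left_perp[OF subcategoryD(1)[OF cd(1)]] by simp
  show "left_perp K \<Y> \<subseteq> \<X>"
  proof
    fix M assume M: "M \<in> left_perp K \<Y>"
    then have "M \<in> Cone K \<Y> \<X>" using cd(6) by (auto simp: left_perp_def)
    then obtain Y X f g where *: "Y \<in> \<Y>" "X \<in> \<X>" "conflation K Y f X g M" by (auto simp: Cone_def)
    have "ext_vanishes K {M} {Y}" using M * by (auto simp: left_perp_def ext_vanishes_def)
    then show "M \<in> \<X>" using Cone_perp_summand[OF *(3)] cd(3) *(2) by (auto simp: summand_closed_def)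
  qed
qed

lemma cotorsion_right_perp:
  assumes "cotorsion_pair K \<X> \<Y>" shows "\<Y> = left_perp (op_cat K) \<X>"
  using extriangulated_category.cotorsion_left_perp[OF extriangulated_op] assms
  by (simp add: op_cotorsion_pair)

lemma cotorsion_extension_left:
  assumes "cotorsion_pair K \<X> \<Y>" "conflation K A f B g C" "A \<in> \<X>" "C \<in> \<X>" shows "B \<in> \<X>"
  using left_perp_extension[OF subcategoryD(1)[OF cotorsion_pairD(2)[OF assms(1)]] assms(2)]
    cotorsion_left_perp[OF assms(1)] assms(3,4) by simp

lemma cotorsion_extension_right:
  assumes "cotorsion_pair K \<X> \<Y>" "conflation K A f B g C" "A \<in> \<Y>" "C \<in> \<Y>" shows "B \<in> \<Y>"
  using extriangulated_category.cotorsion_extension_left[OF extriangulated_op, of \<Y> \<X> C g B f A] assms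
  by (simp add: op_cotorsion_pair op_conflation)

text \<open>Each \<open>u \<in> \<bbbE>(D, N)\<close> with \<open>N \<in> \<Y>\<close> extends to the middle term \<open>B\<close>, where \<open>\<bbbE>(B, N) = 0\<close>.\<close>

lemma scotorsion_cocone_closed:
  assumes c: "cotorsion_pair K \<X> \<Y>" and e2: "ext2_vanishes R K \<X> \<Y>" shows "cocone_closed K \<X>"
  unfolding cocone_closed_def
proof (intro allI impI)
  fix D f B g C assume "conflation K D f B g C" and B: "B \<in> \<X>" and C: "C \<in> \<X>"
  then obtain \<delta> where r: "realizes K D f B g C \<delta>" by (auto simp: conflation_def)
  note d = realizesD[OF r] and cd = cotorsion_pairD[OF c]
  have Y: "\<Y> \<subseteq> Obj K" by (rule subcategoryD(1)[OF cd(2)])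
  have "u = \<zero>\<^bsub>Ext K D N\<^esub>" if N: "N \<in> \<Y>" and u: "exten K u D N" for N u
  proof -
    have van: "ext2_vanishes R K {C} {N}" using e2 C N by (auto simp: ext2_vanishes_def)
    have No: "N \<in> Obj K" using N Y by auto
    obtain w where "exten K w B N" "u = ext_pull K N f w"
      by (rule ext2_vanishing_extends[OF van No r u])
    then show ?thesis using ext_vanishesD[OF cd(5) B N] pull_zero[OF No d(1)] by simp
  qed
  then have "D \<in> left_perp K \<Y>" using d Y by (auto simp: left_perp_def mor_def intro: ext_vanishesI)
  then show "D \<in> \<X>" using cotorsion_left_perp[OF c] by simp
qed

text \<open>Let \<open>v \<in> \<bbbE>(N, C)\<close> with \<open>N \<in> \<X>\<close> have middle term \<open>E\<close>, and take an approximation \<open>X' \<rightarrow> E\<close>. The kernel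
  \<open>L\<close> of \<open>X' \<rightarrow> E \<rightarrow> N\<close> is in \<open>\<X>\<close> and \<open>v\<close> is a push-forward along \<open>L \<rightarrow> C\<close>. As \<open>\<bbbE>(L, A) = 0\<close>, this morphism
  factors through \<open>B\<close>, hence \<open>v\<close> comes from \<open>\<bbbE>(N, B) = 0\<close>.\<close>

lemma cocone_closed_cone_closed:
  assumes c: "cotorsion_pair K \<X> \<Y>" and cc: "cocone_closed K \<X>" shows "cocone_closed (op_cat K) \<Y>"
  unfolding cocone_closed_def op_conflation
proof (intro allI impI)
  fix C g B f A assume "conflation K A f B g C" and B: "B \<in> \<Y>" and A: "A \<in> \<Y>"
  then obtain \<delta> where r: "realizes K A f B g C \<delta>" by (auto simp: conflation_def)
  note d = realizesD[OF r] and cd = cotorsion_pairD[OF c]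
  have X: "\<X> \<subseteq> Obj K" by (rule subcategoryD(1)[OF cd(1)])
  have Co: "C \<in> Obj K" using d by (simp add: mor_def)
  have "v = \<zero>\<^bsub>Ext K N C\<^esub>" if N: "N \<in> \<X>" and v: "exten K v N C" for N v
  proof -
    have No: "N \<in> Obj K" using N X by auto
    obtain k E l where E: "realizes K C k E l N v" by (rule realization_exists[OF v])
    then have "E \<in> Cone K \<Y> \<X>" using cd(6) realizesD[OF E] by (simp add: mor_def)
    then obtain Y' y X' x where "Y' \<in> \<Y>" and X': "X' \<in> \<X>" and "conflation K Y' y X' x E"
      by (auto simp: Cone_def)
    then obtain \<rho> where rho: "realizes K Y' y X' x E \<rho>" by (auto simp: conflation_def)
    obtain L h t \<epsilon> where L: "mor K t L C" "realizes K L h X' (l \<bullet> x) N \<epsilon>" "ext_push K N t \<epsilon> = v"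
      by (rule ET4_op_mor[OF E rho])
    note eps = realizesD(3)[OF L(2)]
    have LX: "L \<in> \<X>" using cc L(2) X' N unfolding cocone_closed_def conflation_def by blast
    obtain b where b: "mor K b L B" "g \<bullet> b = t"
      using lift_through_deflation[OF r L(1)] ext_vanishesD[OF cd(5) LX A pull_exten[OF d(3) L(1)]] by metis
    have "v = ext_push K N g (ext_push K N b \<epsilon>)"
      using push_push[OF eps b(1) d(2)] b L by simp
    then show ?thesis
      using ext_vanishesD[OF cd(5) N B push_exten[OF eps b(1)]] push_zero[OF No d(2)] by simp
  qed
  then have "ext_vanishes K \<X> {C}" using X Co by (intro ext_vanishesI) auto
  then have "C \<in> left_perp (op_cat K) \<X>" using Co by (simp add: left_perp_def op_ext_vanishes op_cat_simps)
  then show "C \<in> \<Y>" using cotorsion_right_perp[OF c] by simp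
qed

lemma pushout_conflations:
  assumes "realizes K A f\<^sub>1 B\<^sub>1 g\<^sub>1 C\<^sub>1 \<delta>\<^sub>1" "realizes K A f\<^sub>2 B\<^sub>2 g\<^sub>2 C\<^sub>2 \<delta>\<^sub>2"
  obtains M k l k' l' B' where "conflation K B\<^sub>2 k M l C\<^sub>1" "conflation K B' k' M l' C\<^sub>2"
    "isomorphic K B\<^sub>1 B'"
proof -
  obtain M k l k' l' B' where *: "conflation (op_cat K) C\<^sub>1 l M k B\<^sub>2" "conflation (op_cat K) C\<^sub>2 l' M k' B'"
    "isomorphic (op_cat K) B\<^sub>1 B'"
    using extriangulated_category.pullback_conflations[OF extriangulated_op, of C\<^sub>1 g\<^sub>1 B\<^sub>1 f\<^sub>1 A \<delta>\<^sub>1 C\<^sub>2 g\<^sub>2 B\<^sub>2 f\<^sub>2 \<delta>\<^sub>2] assms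
    unfolding op_realizes by metis
  have "B\<^sub>1 \<in> Obj K" "B' \<in> Obj K"
    using realizesD[OF assms(1)] conflation_obj *(2) by (auto simp: mor_def op_conflation)
  then show ?thesis using that * by (simp add: op_conflation op_isomorphic)
qed

end

section \<open>Cotorsion pairs in an extension-closed subcategory\<close>

text \<open>Cotorsion pairs in \<open>\<H>\<close> expressed by conflations of the ambient category, where all results above
  are available and where the condition is visibly self-dual.\<close>

definition relative_cotorsion_pair :: "('r, 'o, 'm, 'e) ext_cat \<Rightarrow> 'o set \<Rightarrow> 'o set \<Rightarrow> 'o set \<Rightarrow> bool"
  where "relative_cotorsion_pair K \<H> \<A> \<B> \<longleftrightarrow>
    \<A> \<subseteq> \<H> \<and> \<B> \<subseteq> \<H> \<and> subcategory K \<A> \<and> subcategory K \<B> \<and> summand_closed K \<A> \<and> summand_closed K \<B> \<and>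
    ext_vanishes K \<A> \<B> \<and> \<H> \<subseteq> Cone K \<B> \<A> \<and> \<H> \<subseteq> Cocone K \<B> \<A>"

lemma relative_cotorsion_pairD:
  assumes "relative_cotorsion_pair K \<H> \<A> \<B>"
  shows "\<A> \<subseteq> \<H>" "\<B> \<subseteq> \<H>" "subcategory K \<A>" "subcategory K \<B>" "summand_closed K \<A>" "summand_closed K \<B>"
    "ext_vanishes K \<A> \<B>" "\<H> \<subseteq> Cone K \<B> \<A>" "\<H> \<subseteq> Cocone K \<B> \<A>"
  using assms by (auto simp: relative_cotorsion_pair_def)

lemma conflationI: "realizes K A f B g C \<delta> \<Longrightarrow> conflation K A f B g C"
  and starI: "X \<in> \<X> \<Longrightarrow> Y \<in> \<Y> \<Longrightarrow> conflation K X f M g Y \<Longrightarrow> M \<in> star K \<X> \<Y>"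
  and ConeI: "X \<in> \<X> \<Longrightarrow> Y \<in> \<Y> \<Longrightarrow> conflation K X f Y g M \<Longrightarrow> M \<in> Cone K \<X> \<Y>"
  unfolding conflation_def star_def Cone_def by blast+

lemma restrict_to_simps:
  "Obj (restrict_to K \<H>) = \<H>" "Hom (restrict_to K \<H>) = Hom K" "Comp (restrict_to K \<H>) = Comp K"
  "Ident (restrict_to K \<H>) = Ident K" "Ext (restrict_to K \<H>) = Ext K"
  "Real (restrict_to K \<H>) C A \<delta> = {(B, f, g) \<in> Real K C A \<delta>. B \<in> \<H>}"
  by (simp_all add: restrict_to_def)

lemma restrict_isomorphic: "iso_arr (restrict_to K \<H>) = iso_arr K" "isomorphic (restrict_to K \<H>) = isomorphic K"
  by (simp_all add: iso_arr_def isomorphic_def restrict_to_simps fun_eq_iff)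

lemma restrict_ext_vanishes: "ext_vanishes (restrict_to K \<H>) \<X> \<Y> = ext_vanishes K \<X> \<Y>"
  by (simp add: ext_vanishes_def restrict_to_simps)

lemma restrict_biproduct:
  "\<H> \<subseteq> Obj K \<Longrightarrow> biproduct (restrict_to K \<H>) A B S i j p q \<longleftrightarrow>
    A \<in> \<H> \<and> B \<in> \<H> \<and> S \<in> \<H> \<and> biproduct K A B S i j p q"
  by (auto simp: biproduct_def restrict_to_simps)

context extriangulated_category
begin

lemma op_relative_cotorsion_pair:
  "relative_cotorsion_pair (op_cat K) \<H> \<B> \<A> \<longleftrightarrow> relative_cotorsion_pair K \<H> \<A> \<B>"
  by (auto simp: relative_cotorsion_pair_def op_subcategory op_summand_closed op_ext_vanishes op_Cone)

lemma restrict_realizes: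
  assumes H: "\<H> \<subseteq> Obj K"
  shows "realizes (restrict_to K \<H>) A f B g C \<delta> \<longleftrightarrow> A \<in> \<H> \<and> B \<in> \<H> \<and> C \<in> \<H> \<and> realizes K A f B g C \<delta>"
proof -
  let ?K = "restrict_to K \<H>"
  have c: "(B, f, g) \<in> complexes ?K A C \<longleftrightarrow> B \<in> \<H> \<and> (B, f, g) \<in> complexes K A C" for A B C f g
    using H by (auto simp: complexes_def restrict_to_simps)
  have s: "((B, f, g), (B', f', g')) \<in> seq_equiv ?K A C \<longleftrightarrow>
      B \<in> \<H> \<and> B' \<in> \<H> \<and> ((B, f, g), (B', f', g')) \<in> seq_equiv K A C" for A B C f g B' f' g'
    by (auto simp: seq_equiv_def c restrict_isomorphic restrict_to_simps)
  show ?thesis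
  proof
    assume r: "realizes ?K A f B g C \<delta>"
    then have d: "A \<in> \<H>" "C \<in> \<H>" "\<delta> \<in> carrier (Ext K C A)" "B \<in> \<H>" "(B, f, g) \<in> complexes K A C"
      by (simp_all add: realizes_def restrict_to_simps c)
    then have "((B, f, g), (B, f, g)) \<in> seq_equiv ?K A C"
      using equiv_class_self[OF seq_equiv_equiv, of A C "(B, f, g)"] H by (auto simp: s)
    then have "(B, f, g) \<in> Real ?K C A \<delta>" using r by (simp add: realizes_def)
    then have "(B, f, g) \<in> Real K C A \<delta>" by (simp add: restrict_to_simps)
    moreover have "exten K \<delta> C A" using d H by (auto simp: exten_def)
    ultimately show "A \<in> \<H> \<and> B \<in> \<H> \<and> C \<in> \<H> \<and> realizes K A f B g C \<delta>"
      using realizes_iff d by blast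
  next
    assume r: "A \<in> \<H> \<and> B \<in> \<H> \<and> C \<in> \<H> \<and> realizes K A f B g C \<delta>"
    then have "Real K C A \<delta> = seq_equiv K A C `` {(B, f, g)}" by (simp add: realizes_def)
    then have "Real ?K C A \<delta> = seq_equiv ?K A C `` {(B, f, g)}"
      using r by (simp add: restrict_to_simps(6) set_eq_iff s conj_commute)
    then show "realizes ?K A f B g C \<delta>"
      using r by (simp add: realizes_def restrict_to_simps c)
  qed
qed

lemma restrict_conflation:
  "\<H> \<subseteq> Obj K \<Longrightarrow> conflation (restrict_to K \<H>) A f B g C \<longleftrightarrow>
    A \<in> \<H> \<and> B \<in> \<H> \<and> C \<in> \<H> \<and> conflation K A f B g C"
  by (auto simp: conflation_def restrict_realizes)

lemma restrict_Cone:
  assumes "\<H> \<subseteq> Obj K" "\<A> \<subseteq> \<H>" "\<B> \<subseteq> \<H>"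
  shows "Cone (restrict_to K \<H>) \<B> \<A> = \<H> \<inter> Cone K \<B> \<A>"
    "Cocone (restrict_to K \<H>) \<B> \<A> = \<H> \<inter> Cocone K \<B> \<A>"
  using assms by (auto simp: Cone_def Cocone_def restrict_conflation)

text \<open>Being a zero object means that the identity vanishes, and this does not depend on the ambient
  category.\<close>

lemma restrict_zero_object:
  assumes "subcategory K \<H>"
  shows "zero_object (restrict_to K \<H>) Z \<longleftrightarrow> Z \<in> \<H> \<and> zero_object K Z"
proof
  assume z: "zero_object (restrict_to K \<H>) Z"
  then have Z: "Z \<in> \<H>" "Z \<in> Obj K" using subcategoryD(1)[OF assms] by (auto simp: zero_object_def restrict_to_simps)
  have "Ident K Z = \<zero>\<^bsub>Hom K Z Z\<^esub>"
    using z Z mor_id[OF Z(2)] mor_zero[OF Z(2,2)] by (auto simp: zero_object_def restrict_to_simps mor_def)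
  then show "Z \<in> \<H> \<and> zero_object K Z" using Z zero_object_iff by simp
next
  assume "Z \<in> \<H> \<and> zero_object K Z"
  then show "zero_object (restrict_to K \<H>) Z"
    using subcategoryD(1)[OF assms] by (auto simp: zero_object_def restrict_to_simps subset_iff)
qed

lemma restrict_subcategory:
  assumes H: "subcategory K \<H>"
  shows "subcategory (restrict_to K \<H>) \<S> \<longleftrightarrow> \<S> \<subseteq> \<H> \<and> subcategory K \<S>"
proof (cases "\<S> \<subseteq> \<H>")
  case True
  note h = subcategoryD[OF H]
  have S: "\<S> \<subseteq> Obj K" using True h(1) by blast
  have 1: "(\<forall>A\<in>\<S>. \<forall>B\<in>\<H>. isomorphic K A B \<longrightarrow> B \<in> \<S>) \<longleftrightarrow>
    (\<forall>A\<in>\<S>. \<forall>B\<in>Obj K. isomorphic K A B \<longrightarrow> B \<in> \<S>)"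
    using h(2) True h(1) by (meson subsetD)
  have 2: "(\<exists>Z\<in>\<S>. zero_object (restrict_to K \<H>) Z) \<longleftrightarrow> (\<exists>Z\<in>\<S>. zero_object K Z)"
    using restrict_zero_object[OF H] True by blast
  have 3: "(\<exists>i j p q. biproduct (restrict_to K \<H>) A B S i j p q) \<longleftrightarrow> (\<exists>i j p q. biproduct K A B S i j p q)"
    if "A \<in> \<S>" "B \<in> \<S>" for A B S
    using restrict_biproduct[OF h(1)] h(4)[of A B] True that by (meson subsetD)
  show ?thesis
    unfolding subcategory_def restrict_to_simps restrict_isomorphic 1 2
    using 3 True S by (auto 0 3)
qed (simp add: subcategory_def restrict_to_simps)

text \<open>The complement of a summand of an object of \<open>\<H>\<close> is again in \<open>\<H>\<close>, so the decomposition takes place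
  in \<open>\<H>\<close>.\<close>

lemma restrict_summand_closed:
  assumes H: "subcategory K \<H>" "summand_closed K \<H>" and S: "\<S> \<subseteq> \<H>"
  shows "summand_closed (restrict_to K \<H>) \<S> \<longleftrightarrow> summand_closed K \<S>"
proof -
  have "summand (restrict_to K \<H>) A M \<longleftrightarrow> summand K A M" if "M \<in> \<S>" for A M
  proof
    show "summand (restrict_to K \<H>) A M \<Longrightarrow> summand K A M"
      using restrict_biproduct[OF subcategoryD(1)[OF H(1)]] unfolding summand_def by blast
    assume "summand K A M"
    then obtain B i j p q where b: "biproduct K A B M i j p q" by (auto simp: summand_def)
    then have "summand K A M" "summand K B M" using biproduct_swap unfolding summand_def by blast+
    then have "A \<in> \<H>" "B \<in> \<H>" using H(2) S that by (auto simp: summand_closed_def)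
    then show "summand (restrict_to K \<H>) A M"
      using b restrict_biproduct[OF subcategoryD(1)[OF H(1)]] S that unfolding summand_def by blast
  qed
  then show ?thesis by (auto simp: summand_closed_def)
qed

lemma restrict_cotorsion_pair:
  assumes H: "subcategory K \<H>" "summand_closed K \<H>"
  shows "cotorsion_pair (restrict_to K \<H>) \<A> \<B> \<longleftrightarrow> relative_cotorsion_pair K \<H> \<A> \<B>"
proof (cases "\<A> \<subseteq> \<H> \<and> \<B> \<subseteq> \<H>")
  case True
  have 1: "Cone (restrict_to K \<H>) \<B> \<A> = \<H> \<inter> Cone K \<B> \<A>"
    "Cocone (restrict_to K \<H>) \<B> \<A> = \<H> \<inter> Cocone K \<B> \<A>"
    using restrict_Cone[OF subcategoryD(1)[OF H(1)]] True by blast+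
  show ?thesis
    using True unfolding cotorsion_pair_def relative_cotorsion_pair_def restrict_subcategory[OF H(1)]
      restrict_ext_vanishes 1 restrict_to_simps
    by (auto simp: restrict_summand_closed[OF H])
next
  case False
  then show ?thesis
    unfolding cotorsion_pair_def relative_cotorsion_pair_def restrict_subcategory[OF H(1)] by blast
qed

end

section \<open>Intervals of hereditary cotorsion pairs\<close>

locale cotorsion_interval = extriangulated_category +
  fixes \<X>\<^sub>1 \<Y>\<^sub>1 \<X>\<^sub>2 \<Y>\<^sub>2
  assumes pair1: "cotorsion_pair K \<X>\<^sub>1 \<Y>\<^sub>1" and pair2: "cotorsion_pair K \<X>\<^sub>2 \<Y>\<^sub>2"
    and le: "\<Y>\<^sub>1 \<subseteq> \<Y>\<^sub>2"
    and hereditary1: "cocone_closed K \<X>\<^sub>1" and hereditary2: "cocone_closed K \<X>\<^sub>2"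
begin

lemma le_left: "\<X>\<^sub>2 \<subseteq> \<X>\<^sub>1"
  using left_perp_antimono[OF le, of K] cotorsion_left_perp[OF pair1] cotorsion_left_perp[OF pair2] by simp

text \<open>Passing to \<open>op_cat K\<close> exchanges the two pairs and the two sides of each pair, and keeps \<open>\<X>\<^sub>1 \<inter> \<Y>\<^sub>2\<close>.\<close>

lemma op_interval: "cotorsion_interval R (op_cat K) \<Y>\<^sub>2 \<X>\<^sub>2 \<Y>\<^sub>1 \<X>\<^sub>1"
proof -
  interpret op: extriangulated_category R "op_cat K" by (rule extriangulated_op)
  show ?thesis
    by unfold_locales
      (auto simp: op_cotorsion_pair pair1 pair2 le_left cocone_closed_cone_closed[OF pair1 hereditary1]
        cocone_closed_cone_closed[OF pair2 hereditary2] subsetD[OF le_left])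
qed

abbreviation "\<H> \<equiv> \<X>\<^sub>1 \<inter> \<Y>\<^sub>2"

lemma obj: "\<X>\<^sub>1 \<subseteq> Obj K" "\<Y>\<^sub>1 \<subseteq> Obj K" "\<X>\<^sub>2 \<subseteq> Obj K" "\<Y>\<^sub>2 \<subseteq> Obj K"
  using cotorsion_pairD(1,2)[OF pair1] cotorsion_pairD(1,2)[OF pair2] subcategoryD(1) by auto

lemma restrict_coheart: "subcategory K \<H>" "summand_closed K \<H>"
  using cotorsion_pairD[OF pair1] cotorsion_pairD[OF pair2]
  by (auto simp: subcategory_Int summand_closed_def)

text \<open>In an approximation \<open>Y \<rightarrow> X \<rightarrow> M\<close> of \<open>M \<in> \<X>\<^sub>1 \<inter> \<Y>\<^sub>2\<close>, the object \<open>Y\<close> is in \<open>\<X>\<^sub>1\<close> because \<open>\<X>\<^sub>1\<close> is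
  hereditary and contains \<open>X\<close> and \<open>M\<close>, and \<open>X\<close> is in \<open>\<Y>\<^sub>2\<close> as an extension of \<open>M\<close> by \<open>Y\<close>.\<close>

lemma intersection_cone:
  assumes c: "cotorsion_pair K \<X> \<Y>" and i: "\<Y>\<^sub>1 \<subseteq> \<Y>" "\<Y> \<subseteq> \<Y>\<^sub>2"
  shows "\<H> \<subseteq> Cone K (\<X>\<^sub>1 \<inter> \<Y>) (\<X> \<inter> \<Y>\<^sub>2)"
proof
  fix M assume M: "M \<in> \<H>"
  have X: "\<X> \<subseteq> \<X>\<^sub>1"
    using left_perp_antimono[OF i(1), of K] cotorsion_left_perp[OF pair1] cotorsion_left_perp[OF c] by simp
  have "M \<in> Cone K \<Y> \<X>" using M obj cotorsion_pairD(6)[OF c] by auto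
  then obtain Y X f g where *: "Y \<in> \<Y>" "X \<in> \<X>" "conflation K Y f X g M" by (auto simp: Cone_def)
  have "Y \<in> \<X>\<^sub>1" using hereditary1 * X M unfolding cocone_closed_def by blast
  moreover have "X \<in> \<Y>\<^sub>2" using cotorsion_extension_right[OF pair2 *(3)] * i M by blast
  ultimately show "M \<in> Cone K (\<X>\<^sub>1 \<inter> \<Y>) (\<X> \<inter> \<Y>\<^sub>2)" using * by (auto simp: Cone_def)
qed

lemma intersection_relative_pair:
  assumes c: "cotorsion_pair K \<X> \<Y>" and i: "\<Y>\<^sub>1 \<subseteq> \<Y>" "\<Y> \<subseteq> \<Y>\<^sub>2"
  shows "relative_cotorsion_pair K \<H> (\<X> \<inter> \<Y>\<^sub>2) (\<X>\<^sub>1 \<inter> \<Y>)"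
proof -
  have X: "\<X> \<subseteq> \<X>\<^sub>1" "\<X>\<^sub>2 \<subseteq> \<X>"
    using left_perp_antimono[OF i(1), of K] left_perp_antimono[OF i(2), of K] cotorsion_left_perp[OF pair1]
      cotorsion_left_perp[OF pair2] cotorsion_left_perp[OF c] by simp_all
  note cd = cotorsion_pairD[OF c] cotorsion_pairD[OF pair1] cotorsion_pairD[OF pair2]
  interpret op: cotorsion_interval R "op_cat K" \<Y>\<^sub>2 \<X>\<^sub>2 \<Y>\<^sub>1 \<X>\<^sub>1 by (rule op_interval)
  have "\<H> \<subseteq> Cocone K (\<X>\<^sub>1 \<inter> \<Y>) (\<X> \<inter> \<Y>\<^sub>2)"
    using op.intersection_cone[of \<Y> \<X>] X c by (simp add: op_cotorsion_pair op_Cone Int_commute)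
  then show ?thesis
    unfolding relative_cotorsion_pair_def
  proof (intro conjI intersection_cone[OF assms])
    show "subcategory K (\<X> \<inter> \<Y>\<^sub>2)" "subcategory K (\<X>\<^sub>1 \<inter> \<Y>)" using cd by (simp_all add: subcategory_Int)
    show "summand_closed K (\<X> \<inter> \<Y>\<^sub>2)" "summand_closed K (\<X>\<^sub>1 \<inter> \<Y>)"
      using cd(3,4,10,18) unfolding summand_closed_def by blast+
    show "ext_vanishes K (\<X> \<inter> \<Y>\<^sub>2) (\<X>\<^sub>1 \<inter> \<Y>)" using cd(5) by (simp add: ext_vanishes_def)
  qed (use X(1) i(2) in auto)
qed

text \<open>Successive approximation. The pushout \<open>E\<close> of \<open>X\<^sub>2 \<leftarrow> Y\<^sub>2 \<rightarrow> B\<close> is an extension of \<open>A\<close> by (a copy of) \<open>X\<^sub>2\<close>,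
  and also one of \<open>X\<^sub>1\<close> by \<open>B\<close>. The kernel of \<open>E \<rightarrow> X\<^sub>1 \<rightarrow> M\<close> is then an extension of \<open>Y\<^sub>1\<close> by \<open>B\<close>.\<close>

lemma star_cone:
  assumes rel: "relative_cotorsion_pair K \<H> \<A> \<B>" 
  shows "Obj K \<subseteq> Cone K (star K \<B> \<Y>\<^sub>1) (star K \<X>\<^sub>2 \<A>)"
proof
  note rd = relative_cotorsion_pairD[OF rel]
  fix M assume M: "M \<in> Obj K"
  then have "M \<in> Cone K \<Y>\<^sub>1 \<X>\<^sub>1" using cotorsion_pairD(6)[OF pair1] by simp
  then obtain Y\<^sub>1 X\<^sub>1 f\<^sub>1 g\<^sub>1 where Y1: "Y\<^sub>1 \<in> \<Y>\<^sub>1" "X\<^sub>1 \<in> \<X>\<^sub>1" and c1: "conflation K Y\<^sub>1 f\<^sub>1 X\<^sub>1 g\<^sub>1 M"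
    by (auto simp: Cone_def)
  have "X\<^sub>1 \<in> Cone K \<Y>\<^sub>2 \<X>\<^sub>2" using Y1 obj cotorsion_pairD(6)[OF pair2] by auto
  then obtain Y\<^sub>2 X\<^sub>2 f\<^sub>2 g\<^sub>2 where Y2: "Y\<^sub>2 \<in> \<Y>\<^sub>2" "X\<^sub>2 \<in> \<X>\<^sub>2" and c2: "conflation K Y\<^sub>2 f\<^sub>2 X\<^sub>2 g\<^sub>2 X\<^sub>1"
    by (auto simp: Cone_def)
  have "Y\<^sub>2 \<in> \<X>\<^sub>1" using hereditary1 c2 Y1 Y2 le_left unfolding cocone_closed_def by blast
  then have "Y\<^sub>2 \<in> Cocone K \<B> \<A>" using Y2 rd(9) by auto
  then obtain B A f g where B: "B \<in> \<B>" "A \<in> \<A>" and c3: "conflation K Y\<^sub>2 f B g A"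
    by (auto simp: Cocone_def)
  obtain \<delta>\<^sub>1 \<delta>\<^sub>2 \<delta>\<^sub>3 where r: "realizes K Y\<^sub>1 f\<^sub>1 X\<^sub>1 g\<^sub>1 M \<delta>\<^sub>1" "realizes K Y\<^sub>2 f\<^sub>2 X\<^sub>2 g\<^sub>2 X\<^sub>1 \<delta>\<^sub>2"
    "realizes K Y\<^sub>2 f B g A \<delta>\<^sub>3"
    using c1 c2 c3 unfolding conflation_def by blast
  obtain E k l k' l' X' where E: "conflation K B k E l X\<^sub>1" "conflation K X' k' E l' A" "isomorphic K X\<^sub>2 X'"
    by (rule pushout_conflations[OF r(2,3)])
  have "X' \<in> \<X>\<^sub>2"
    using subcategoryD(2)[OF cotorsion_pairD(1)[OF pair2] Y2(2) _ E(3)] conflation_obj(1)[OF E(2)] by simp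
  then have EA: "E \<in> star K \<X>\<^sub>2 \<A>" using B(2) E(2) by (rule starI)
  obtain \<epsilon> where eps: "realizes K B k E l X\<^sub>1 \<epsilon>" using E(1) by (auto simp: conflation_def)
  obtain L h d e \<delta>'' where L: "realizes K L h E (g\<^sub>1 \<bullet> l) M \<delta>''"
    "realizes K B e L d Y\<^sub>1 (ext_pull K B f\<^sub>1 \<epsilon>)"
    by (rule ET4_op_mor[OF r(1) eps])
  have "L \<in> star K \<B> \<Y>\<^sub>1" by (rule starI[OF B(1) Y1(1) conflationI[OF L(2)]])
  then show "M \<in> Cone K (star K \<B> \<Y>\<^sub>1) (star K \<X>\<^sub>2 \<A>)"
    by (rule ConeI[OF _ EA conflationI[OF L(1)]])
qed

lemma add_star_interval:
  assumes rel: "relative_cotorsion_pair K \<H> \<A> \<B>"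
  shows "\<Y>\<^sub>1 \<subseteq> add_closure K (star K \<B> \<Y>\<^sub>1)" "\<B> \<subseteq> add_closure K (star K \<B> \<Y>\<^sub>1)"
    "add_closure K (star K \<B> \<Y>\<^sub>1) \<subseteq> \<Y>\<^sub>2" "star K \<B> \<Y>\<^sub>1 \<subseteq> Obj K"
proof -
  note rd = relative_cotorsion_pairD[OF rel]
  show o: "star K \<B> \<Y>\<^sub>1 \<subseteq> Obj K" using conflation_obj(2) by (auto simp: star_def)
  obtain Z where Z: "zero_object K Z" using zero_object_exists by blast
  have ZB: "Z \<in> \<B>" "Z \<in> \<Y>\<^sub>1"
    by (rule subcategory_zero[OF rd(4) Z] subcategory_zero[OF cotorsion_pairD(2)[OF pair1] Z])+
  have "M \<in> star K \<B> \<Y>\<^sub>1" if M: "M \<in> \<Y>\<^sub>1" for M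
  proof -
    obtain f g where "conflation K Z f M g M" using trivial_conflation[OF Z] M obj(2) by blast
    then show ?thesis by (rule starI[OF ZB(1) M])
  qed
  then have "\<Y>\<^sub>1 \<subseteq> star K \<B> \<Y>\<^sub>1" by blast
  then show "\<Y>\<^sub>1 \<subseteq> add_closure K (star K \<B> \<Y>\<^sub>1)" using add_closure(3)[OF o] by blast
  have "conflation K M (Ident K M) M \<zero>\<^bsub>Hom K M Z\<^esub> Z" if "M \<in> Obj K" for M
    using real_zero[OF biproduct_zero_right[OF Z that]] by (auto simp: conflation_def)
  then have "\<B> \<subseteq> star K \<B> \<Y>\<^sub>1" using ZB(2) subcategoryD(1)[OF rd(4)] by (fastforce simp: star_def)
  then show "\<B> \<subseteq> add_closure K (star K \<B> \<Y>\<^sub>1)" using add_closure(3)[OF o] by blast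
  have "star K \<B> \<Y>\<^sub>1 \<subseteq> \<Y>\<^sub>2"
    using cotorsion_extension_right[OF pair2] rd(2) le by (fastforce simp: star_def)
  then show "add_closure K (star K \<B> \<Y>\<^sub>1) \<subseteq> \<Y>\<^sub>2"
    by (rule add_closure_least[OF cotorsion_pairD(2,4)[OF pair2]])
qed

lemma add_star_interval_op:
  assumes rel: "relative_cotorsion_pair K \<H> \<A> \<B>"
  shows "\<X>\<^sub>2 \<subseteq> add_closure K (star K \<X>\<^sub>2 \<A>)" "\<A> \<subseteq> add_closure K (star K \<X>\<^sub>2 \<A>)"
    "add_closure K (star K \<X>\<^sub>2 \<A>) \<subseteq> \<X>\<^sub>1" "star K \<X>\<^sub>2 \<A> \<subseteq> Obj K"
proof -
  interpret op: cotorsion_interval R "op_cat K" \<Y>\<^sub>2 \<X>\<^sub>2 \<Y>\<^sub>1 \<X>\<^sub>1 by (rule op_interval)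
  have "relative_cotorsion_pair (op_cat K) (\<Y>\<^sub>2 \<inter> \<X>\<^sub>1) \<B> \<A>"
    using rel by (simp add: op_relative_cotorsion_pair Int_commute)
  from op.add_star_interval[OF this] show "\<X>\<^sub>2 \<subseteq> add_closure K (star K \<X>\<^sub>2 \<A>)" "\<A> \<subseteq> add_closure K (star K \<X>\<^sub>2 \<A>)"
    "add_closure K (star K \<X>\<^sub>2 \<A>) \<subseteq> \<X>\<^sub>1" "star K \<X>\<^sub>2 \<A> \<subseteq> Obj K"
    by (simp_all add: op_add_closure op_Cone op_cat_simps)
qed

lemma add_star_cotorsion_pair:
  assumes rel: "relative_cotorsion_pair K \<H> \<A> \<B>"
  shows "cotorsion_pair K (add_closure K (star K \<X>\<^sub>2 \<A>)) (add_closure K (star K \<B> \<Y>\<^sub>1))"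
proof -
  note rd = relative_cotorsion_pairD[OF rel] and p1 = cotorsion_pairD[OF pair1] and p2 = cotorsion_pairD[OF pair2]
  note Y = add_star_interval[OF rel] and X = add_star_interval_op[OF rel]
  note o = X(4) Y(4)
  have AB: "\<A> \<subseteq> Obj K" "\<B> \<subseteq> Obj K" by (rule subcategoryD(1)[OF rd(3)], rule subcategoryD(1)[OF rd(4)])
  interpret op: cotorsion_interval R "op_cat K" \<Y>\<^sub>2 \<X>\<^sub>2 \<Y>\<^sub>1 \<X>\<^sub>1 by (rule op_interval)
  have "relative_cotorsion_pair (op_cat K) (\<Y>\<^sub>2 \<inter> \<X>\<^sub>1) \<B> \<A>"
    using rel by (simp add: op_relative_cotorsion_pair Int_commute)
  from op.star_cone[OF this] have cocone: "Obj K \<subseteq> Cocone K (star K \<B> \<Y>\<^sub>1) (star K \<X>\<^sub>2 \<A>)"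
    by (simp add: op_cat_simps op_Cone)
  have "ext_vanishes K \<X>\<^sub>2 \<B>" "ext_vanishes K \<A> \<Y>\<^sub>1" "ext_vanishes K \<X>\<^sub>2 \<Y>\<^sub>1"
    using p1(5) p2(5) rd(1,2) le by (auto simp: ext_vanishes_def)
  then have "ext_vanishes K (star K \<X>\<^sub>2 \<A>) (star K \<B> \<Y>\<^sub>1)"
    using rd(7) obj AB by (intro ext_vanishes_star_left ext_vanishes_star_right o)
  then have "ext_vanishes K (add_closure K (star K \<X>\<^sub>2 \<A>)) (star K \<B> \<Y>\<^sub>1)"
    by (rule ext_vanishes_add_left[OF o(2,1)])
  then have van: "ext_vanishes K (add_closure K (star K \<X>\<^sub>2 \<A>)) (add_closure K (star K \<B> \<Y>\<^sub>1))"
    by (rule ext_vanishes_add_right[OF o(2) subcategoryD(1)[OF add_closure(1)[OF o(1)]]])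
  have "Obj K \<subseteq> Cone K (add_closure K (star K \<B> \<Y>\<^sub>1)) (add_closure K (star K \<X>\<^sub>2 \<A>))"
    using star_cone[OF rel] add_closure(3)[OF o(1)] add_closure(3)[OF o(2)] unfolding Cone_def by blast
  moreover have "Obj K \<subseteq> Cocone K (add_closure K (star K \<B> \<Y>\<^sub>1)) (add_closure K (star K \<X>\<^sub>2 \<A>))"
    using cocone add_closure(3)[OF o(1)] add_closure(3)[OF o(2)] unfolding Cocone_def by blast
  moreover have "Cone K P Q \<subseteq> Obj K" "Cocone K P Q \<subseteq> Obj K" for P Q
    using conflation_obj by (auto simp: Cone_def Cocone_def)
  ultimately show ?thesis
    unfolding cotorsion_pair_def
    by (intro conjI add_closure o van subset_antisym) 
qed

lemma relative_left_perp:
  assumes rel: "relative_cotorsion_pair K \<H> \<A> \<B>" and M: "M \<in> \<H>" "ext_vanishes K {M} \<B>"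
  shows "M \<in> \<A>"
proof -
  note rd = relative_cotorsion_pairD[OF rel]
  obtain B A f g where *: "B \<in> \<B>" "A \<in> \<A>" "conflation K B f A g M"
    using M rd(8) by (auto simp: Cone_def)
  have "ext_vanishes K {M} {B}" using M(2) *(1) by (auto simp: ext_vanishes_def)
  then show ?thesis
    using Cone_perp_summand[OF *(3)] rd(5) *(2) by (auto simp: summand_closed_def)
qed

text \<open>An object of the left-hand side lies in \<open>\<H>\<close> and is orthogonal to \<open>\<B>\<close>, hence belongs to \<open>\<A>\<close>.\<close>

lemma add_star_Int:
  assumes rel: "relative_cotorsion_pair K \<H> \<A> \<B>"
  shows "add_closure K (star K \<X>\<^sub>2 \<A>) \<inter> \<Y>\<^sub>2 = \<A>"
proof
  note Y = add_star_interval[OF rel] and X = add_star_interval_op[OF rel]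
  show "\<A> \<subseteq> add_closure K (star K \<X>\<^sub>2 \<A>) \<inter> \<Y>\<^sub>2"
    using X(2) relative_cotorsion_pairD(1)[OF rel] by blast
  show "add_closure K (star K \<X>\<^sub>2 \<A>) \<inter> \<Y>\<^sub>2 \<subseteq> \<A>"
  proof
    fix M assume M: "M \<in> add_closure K (star K \<X>\<^sub>2 \<A>) \<inter> \<Y>\<^sub>2"
    then have "ext_vanishes K {M} \<B>"
      using cotorsion_pairD(5)[OF add_star_cotorsion_pair[OF rel]] Y(2) by (auto simp: ext_vanishes_def)
    then show "M \<in> \<A>" using relative_left_perp[OF rel] X(3) M by blast
  qed
qed

lemma add_star_Int_op:
  assumes rel: "relative_cotorsion_pair K \<H> \<A> \<B>"
  shows "\<X>\<^sub>1 \<inter> add_closure K (star K \<B> \<Y>\<^sub>1) = \<B>"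
proof -
  interpret op: cotorsion_interval R "op_cat K" \<Y>\<^sub>2 \<X>\<^sub>2 \<Y>\<^sub>1 \<X>\<^sub>1 by (rule op_interval)
  have "relative_cotorsion_pair (op_cat K) (\<Y>\<^sub>2 \<inter> \<X>\<^sub>1) \<B> \<A>"
    using rel by (simp add: op_relative_cotorsion_pair Int_commute)
  from op.add_star_Int[OF this] show ?thesis
    by (simp add: op_add_closure op_Cone Int_commute)
qed

text \<open>The cotorsion pair built from the intersections is contained in \<open>(\<X>, \<Y>)\<close> componentwise. Passing to
  orthogonals reverses inclusions, so both components agree.\<close>

lemma cotorsion_pair_recovered:
  assumes c: "cotorsion_pair K \<X> \<Y>" and i: "\<Y>\<^sub>1 \<subseteq> \<Y>" "\<Y> \<subseteq> \<Y>\<^sub>2"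
  shows "add_closure K (star K \<X>\<^sub>2 (\<X> \<inter> \<Y>\<^sub>2)) = \<X>" "add_closure K (star K (\<X>\<^sub>1 \<inter> \<Y>) \<Y>\<^sub>1) = \<Y>"
proof -
  let ?X = "add_closure K (star K \<X>\<^sub>2 (\<X> \<inter> \<Y>\<^sub>2))" and ?Y = "add_closure K (star K (\<X>\<^sub>1 \<inter> \<Y>) \<Y>\<^sub>1)"
  note cd = cotorsion_pairD[OF c]
  have c': "cotorsion_pair K ?X ?Y"
    by (rule add_star_cotorsion_pair[OF intersection_relative_pair[OF assms]])
  have X2: "\<X>\<^sub>2 \<subseteq> \<X>"
    using left_perp_antimono[OF i(2), of K] cotorsion_left_perp[OF pair2] cotorsion_left_perp[OF c] by simp
  have "star K \<X>\<^sub>2 (\<X> \<inter> \<Y>\<^sub>2) \<subseteq> \<X>"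
    using cotorsion_extension_left[OF c] X2 by (fastforce simp: star_def)
  then have X: "?X \<subseteq> \<X>" by (rule add_closure_least[OF cd(1,3)])
  have "star K (\<X>\<^sub>1 \<inter> \<Y>) \<Y>\<^sub>1 \<subseteq> \<Y>"
    using cotorsion_extension_right[OF c] i(1) by (fastforce simp: star_def)
  then have Y: "?Y \<subseteq> \<Y>" by (rule add_closure_least[OF cd(2,4)])
  show "?X = \<X>"
    using X left_perp_antimono[OF Y, of K] cotorsion_left_perp[OF c] cotorsion_left_perp[OF c'] by blast
  show "?Y = \<Y>"
    using Y left_perp_antimono[OF X, of "op_cat K"] cotorsion_right_perp[OF c] cotorsion_right_perp[OF c'] by blast
qed

end

theorem theorem3p6:
  fixes R :: "('r, 'x) ring_scheme" and K :: "('r, 'o, 'm, 'e) ext_cat"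
    and \<X>\<^sub>1 \<Y>\<^sub>1 \<X>\<^sub>2 \<Y>\<^sub>2 :: "'o set"
  assumes "extriangulated_category R K"
    and "(\<X>\<^sub>1, \<Y>\<^sub>1) \<in> scotors R K" and "(\<X>\<^sub>2, \<Y>\<^sub>2) \<in> scotors R K"
    and "cotors_le (\<X>\<^sub>1, \<Y>\<^sub>1) (\<X>\<^sub>2, \<Y>\<^sub>2)"
  shows "inverse_poset_isos
           (cotors_interval K (\<X>\<^sub>1, \<Y>\<^sub>1) (\<X>\<^sub>2, \<Y>\<^sub>2)) cotors_le
           (cotors (restrict_to K (coheart (\<X>\<^sub>1, \<Y>\<^sub>1) (\<X>\<^sub>2, \<Y>\<^sub>2)))) cotors_le
           (\<lambda>(\<X>, \<Y>). (\<X> \<inter> \<Y>\<^sub>2, \<X>\<^sub>1 \<inter> \<Y>))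
           (\<lambda>(\<A>, \<B>). (add_closure K (star K \<X>\<^sub>2 \<A>), add_closure K (star K \<B> \<Y>\<^sub>1))) \<and>
         (ext2_vanishes R K \<X>\<^sub>1 \<Y>\<^sub>2 \<longrightarrow>
           cotors_interval K (\<X>\<^sub>1, \<Y>\<^sub>1) (\<X>\<^sub>2, \<Y>\<^sub>2) = scotors_interval R K (\<X>\<^sub>1, \<Y>\<^sub>1) (\<X>\<^sub>2, \<Y>\<^sub>2))"
proof -
  interpret cotorsion_interval R K \<X>\<^sub>1 \<Y>\<^sub>1 \<X>\<^sub>2 \<Y>\<^sub>2
    using assms extriangulated_category.scotorsion_cocone_closed[OF assms(1)]
    by (intro cotorsion_interval.intro cotorsion_interval_axioms.intro)
      (auto simp: scotors_def cotors_le_def)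
  let ?P = "cotors_interval K (\<X>\<^sub>1, \<Y>\<^sub>1) (\<X>\<^sub>2, \<Y>\<^sub>2)"
  let ?Q = "cotors (restrict_to K (coheart (\<X>\<^sub>1, \<Y>\<^sub>1) (\<X>\<^sub>2, \<Y>\<^sub>2)))"
  have P: "(\<X>, \<Y>) \<in> ?P \<longleftrightarrow> cotorsion_pair K \<X> \<Y> \<and> \<Y>\<^sub>1 \<subseteq> \<Y> \<and> \<Y> \<subseteq> \<Y>\<^sub>2" for \<X> \<Y>
    by (simp add: cotors_interval_def cotors_def cotors_le_def)
  have Q: "(\<A>, \<B>) \<in> ?Q \<longleftrightarrow> relative_cotorsion_pair K \<H> \<A> \<B>" for \<A> \<B>
    by (simp add: cotors_def coheart_def restrict_cotorsion_pair[OF restrict_coheart])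
  have "inverse_poset_isos ?P cotors_le ?Q cotors_le (\<lambda>(\<X>, \<Y>). (\<X> \<inter> \<Y>\<^sub>2, \<X>\<^sub>1 \<inter> \<Y>))
     (\<lambda>(\<A>, \<B>). (add_closure K (star K \<X>\<^sub>2 \<A>), add_closure K (star K \<B> \<Y>\<^sub>1)))"
    unfolding inverse_poset_isos_def
  proof (intro conjI)
    show "(\<lambda>(\<X>, \<Y>). (\<X> \<inter> \<Y>\<^sub>2, \<X>\<^sub>1 \<inter> \<Y>)) \<in> ?P \<rightarrow> ?Q"
      by (auto simp: P Q intro: intersection_relative_pair)
    show "(\<lambda>(\<A>, \<B>). (add_closure K (star K \<X>\<^sub>2 \<A>), add_closure K (star K \<B> \<Y>\<^sub>1))) \<in> ?Q \<rightarrow> ?P"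
    proof
      fix y assume "y \<in> ?Q"
      then obtain \<A> \<B> where "y = (\<A>, \<B>)" and rel: "relative_cotorsion_pair K \<H> \<A> \<B>"
        by (cases y) (simp add: Q)
      then show "(case y of (\<A>, \<B>) \<Rightarrow> (add_closure K (star K \<X>\<^sub>2 \<A>), add_closure K (star K \<B> \<Y>\<^sub>1))) \<in> ?P"
        using add_star_cotorsion_pair[OF rel] add_star_interval[OF rel] by (simp add: P)
    qed
    show "\<forall>x\<in>?P. (case case x of (\<X>, \<Y>) \<Rightarrow> (\<X> \<inter> \<Y>\<^sub>2, \<X>\<^sub>1 \<inter> \<Y>) of 
      (\<A>, \<B>) \<Rightarrow> (add_closure K (star K \<X>\<^sub>2 \<A>), add_closure K (star K \<B> \<Y>\<^sub>1))) = x"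
      by (simp add: Ball_def P) (intro allI impI conjI; elim conjE, rule cotorsion_pair_recovered; assumption)
    show "\<forall>y\<in>?Q. (case case y of (\<A>, \<B>) \<Rightarrow> (add_closure K (star K \<X>\<^sub>2 \<A>), add_closure K (star K \<B> \<Y>\<^sub>1)) of
      (\<X>, \<Y>) \<Rightarrow> (\<X> \<inter> \<Y>\<^sub>2, \<X>\<^sub>1 \<inter> \<Y>)) = y"
      by (simp add: Ball_def Q add_star_Int add_star_Int_op)
    show "monotone_on ?P cotors_le cotors_le (\<lambda>(\<X>, \<Y>). (\<X> \<inter> \<Y>\<^sub>2, \<X>\<^sub>1 \<inter> \<Y>))"
      by (auto simp: monotone_on_def cotors_le_def)
    show "monotone_on ?Q cotors_le cotors_le
      (\<lambda>(\<A>, \<B>). (add_closure K (star K \<X>\<^sub>2 \<A>), add_closure K (star K \<B> \<Y>\<^sub>1)))"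
    proof -
      have "add_closure K (star K \<B> \<Y>\<^sub>1) \<subseteq> add_closure K (star K \<B>' \<Y>\<^sub>1)" if "\<B> \<subseteq> \<B>'" for \<B> \<B>'
      proof -
        have "star K \<B> \<Y>\<^sub>1 \<subseteq> star K \<B>' \<Y>\<^sub>1" using that by (auto simp: star_def)
        then show ?thesis by (auto simp: add_closure_def)
      qed
      then show ?thesis by (auto simp: monotone_on_def cotors_le_def subset_iff)
    qed
  qed
  moreover have "?P = scotors_interval R K (\<X>\<^sub>1, \<Y>\<^sub>1) (\<X>\<^sub>2, \<Y>\<^sub>2)" if e2: "ext2_vanishes R K \<X>\<^sub>1 \<Y>\<^sub>2"
  proof -
    have "ext2_vanishes R K \<X> \<Y>" if "(\<X>, \<Y>) \<in> ?P" for \<X> \<Y>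
    proof -
      have c: "cotorsion_pair K \<X> \<Y>" "\<Y>\<^sub>1 \<subseteq> \<Y>" "\<Y> \<subseteq> \<Y>\<^sub>2" using that by (simp_all add: P)
      have "\<X> \<subseteq> \<X>\<^sub>1"
        using left_perp_antimono[OF c(2), of K] cotorsion_left_perp[OF pair1] cotorsion_left_perp[OF c(1)] by simp
      then show ?thesis using e2 c(3) unfolding ext2_vanishes_def by blast
    qed
    then show ?thesis by (auto simp: scotors_interval_def scotors_def P)
  qed
  ultimately show ?thesis by blast
qed

end
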